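(* Let $\Gamma$ be a finite simplicial graph with right-angled Artin group $A_\Gamma$. Every subgroup $H\le A_\Gamma$ generated by two elements is a free group or a free abelian group, and the inclusion $H\hookrightarrow A_\Gamma$ is a quasi-isometric embedding (with respect to word metrics from finite generating sets).
   Context: The right-angled Artin group $A_\Gamma$ is the group with generating set the vertices $V$ of $\Gamma$ and relations $v_iv_j=v_jv_i$ for each edge $(v_i,v_j)$ of $\Gamma$. For a finite generating set $S$ of a group $G$, the word metric is $d(g_1,g_2)=$ the length of a shortest word in $S^{\pm1}$ representing $g_1^{-1}g_2$. A map $f:Y\to Z$ of metric spaces is a quasi-isometric embedding if there are constants $\lambda\ge 1$, $\epsilon\ge 0$ with $\frac1\lambda d_Y(p,q)-\epsilon\le d_Z(f(p),f(q))\le\lambda d_Y(p,q)+\epsilon$ for all $p,q\in Y$ (for word metrics, this does not depend on the choice of finite generating sets). *)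

theory Defs
  imports
    "HOL-Algebra.Free_Abelian_Groups"
    "HOL-Algebra.Generated_Groups"
    "HOL-Analysis.Abstract_Metric_Spaces"
    "Graph_Theory.Digraph"
begin

section \<open>Presented groups\<close>

text \<open>A letter \<open>(True, x)\<close> stands for the generator \<open>x\<close> and \<open>(False, x)\<close> for its formal inverse.\<close>

type_synonym 'x gword = "(bool \<times> 'x) list"

definition gwords :: "'x set \<Rightarrow> 'x gword set" where
  "gwords X = lists (UNIV \<times> X)"

text \<open>The least congruence on the words over \<open>X\<close> that cancels adjacent inverse letters and
  identifies the two sides of each relation \<open>r = s\<close> with \<open>(r, s) \<in> R\<close>.\<close>

inductive_set word_cong :: "'x set \<Rightarrow> ('x gword \<times> 'x gword) set \<Rightarrow> ('x gword \<times> 'x gword) set"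
  for X :: "'x set" and R :: "('x gword \<times> 'x gword) set" where
  refl: "w \<in> gwords X \<Longrightarrow> (w, w) \<in> word_cong X R"
| sym: "(w, w') \<in> word_cong X R \<Longrightarrow> (w', w) \<in> word_cong X R"
| trans: "(w, w') \<in> word_cong X R \<Longrightarrow> (w', w'') \<in> word_cong X R \<Longrightarrow> (w, w'') \<in> word_cong X R"
| cancel: "u \<in> gwords X \<Longrightarrow> v \<in> gwords X \<Longrightarrow> x \<in> X \<Longrightarrow>
    (u @ [(e, x), (\<not> e, x)] @ v, u @ v) \<in> word_cong X R"
| relation: "(r, s) \<in> R \<Longrightarrow> u @ r @ v \<in> gwords X \<Longrightarrow> u @ s @ v \<in> gwords X \<Longrightarrow>
    (u @ r @ v, u @ s @ v) \<in> word_cong X R"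

definition presented_group :: "'x set \<Rightarrow> ('x gword \<times> 'x gword) set \<Rightarrow> 'x gword set monoid" where
  "presented_group X R =
    \<lparr>carrier = gwords X // word_cong X R,
     mult = (\<lambda>A B. \<Union>a\<in>A. \<Union>b\<in>B. word_cong X R `` {a @ b}),
     one = word_cong X R `` {[]}\<rparr>"

lemma gwords_append [simp]: "u @ v \<in> gwords X \<longleftrightarrow> u \<in> gwords X \<and> v \<in> gwords X"
  by (auto simp: gwords_def)

lemma gwords_Nil [simp]: "[] \<in> gwords X"
  by (auto simp: gwords_def)

lemma gwords_Cons [simp]: "(e, x) # w \<in> gwords X \<longleftrightarrow> x \<in> X \<and> w \<in> gwords X"
  by (auto simp: gwords_def)

lemma word_cong_in_gwords:
  "(u, v) \<in> word_cong X R \<Longrightarrow> u \<in> gwords X \<and> v \<in> gwords X"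
  by (induction rule: word_cong.induct) auto

lemma equiv_word_cong: "equiv (gwords X) (word_cong X R)"
  by (rule equivI)
    (auto simp: refl_on_def sym_def trans_def
      intro: word_cong.refl word_cong.sym word_cong.trans dest: word_cong_in_gwords)

lemma word_cong_context:
  assumes "(u, v) \<in> word_cong X R" "a \<in> gwords X" "b \<in> gwords X"
  shows "(a @ u @ b, a @ v @ b) \<in> word_cong X R"
  using assms
proof (induction rule: word_cong.induct)
  case (cancel u v x e)
  then show ?case using word_cong.cancel[of "a @ u" X "v @ b" x e R] by simp
next
  case (relation r s u v)
  then show ?case using word_cong.relation[of r s R "a @ u" "v @ b" X] by simp
qed (auto intro: word_cong.intros)

lemma word_cong_append:
  assumes "(u, u') \<in> word_cong X R" "(v, v') \<in> word_cong X R"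
  shows "(u @ v, u' @ v') \<in> word_cong X R"
proof -
  have "(u @ v, u' @ v) \<in> word_cong X R"
    using word_cong_context[of u u' X R "[]" v] assms word_cong_in_gwords by fastforce
  moreover have "(u' @ v, u' @ v') \<in> word_cong X R"
    using word_cong_context[of v v' X R u' "[]"] assms word_cong_in_gwords by fastforce
  ultimately show ?thesis by (rule word_cong.trans)
qed

lemma carrier_presented_group:
  "carrier (presented_group X R) = {word_cong X R `` {w} |w. w \<in> gwords X}"
  by (auto simp: presented_group_def quotient_def)

lemma one_presented_group: "\<one>\<^bsub>presented_group X R\<^esub> = word_cong X R `` {[]}"
  by (simp add: presented_group_def)

lemma mult_presented_group:
  assumes "u \<in> gwords X" "v \<in> gwords X"
  shows "word_cong X R `` {u} \<otimes>\<^bsub>presented_group X R\<^esub> word_cong X R `` {v}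
    = word_cong X R `` {u @ v}"
proof -
  have "word_cong X R `` {a @ b} = word_cong X R `` {u @ v}"
    if "a \<in> word_cong X R `` {u}" "b \<in> word_cong X R `` {v}" for a b
  proof -
    have "(u @ v, a @ b) \<in> word_cong X R"
      by (rule word_cong_append) (use that in \<open>simp_all only: Image_singleton_iff\<close>)
    from equiv_class_eq[OF equiv_word_cong this] show ?thesis by (rule HOL.sym)
  qed
  then have "(\<Union>a\<in>word_cong X R `` {u}. \<Union>b\<in>word_cong X R `` {v}. word_cong X R `` {a @ b})
      = (\<Union>a\<in>word_cong X R `` {u}. \<Union>b\<in>word_cong X R `` {v}. word_cong X R `` {u @ v})"
    by (intro SUP_cong HOL.refl)
  also have "\<dots> = word_cong X R `` {u @ v}"
  proof -
    have "word_cong X R `` {u} \<noteq> {}" "word_cong X R `` {v} \<noteq> {}"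
      using assms word_cong.refl by blast+
    then show ?thesis by (simp only: UN_constant if_False)
  qed
  finally show ?thesis by (simp only: presented_group_def monoid.simps)
qed

lemma word_cong_left_inverse:
  assumes "w \<in> gwords X"
  shows "\<exists>w'\<in>gwords X. (w' @ w, []) \<in> word_cong X R"
  using assms
proof (induction w)
  case Nil
  then show ?case by (auto intro!: bexI[of _ "[]"] word_cong.refl)
next
  case (Cons l w)
  obtain e x where l: "l = (e, x)" by (cases l)
  with Cons obtain w' where w': "w' \<in> gwords X" "(w' @ w, []) \<in> word_cong X R"
    by auto
  have "(w' @ [(\<not> e, x), (\<not> \<not> e, x)] @ w, w' @ w) \<in> word_cong X R"
    using w' Cons.prems l by (intro word_cong.cancel) auto
  then have "((w' @ [(\<not> e, x)]) @ l # w, []) \<in> word_cong X R"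
    using w' l word_cong.trans by fastforce
  then show ?case using w' Cons.prems l by (intro bexI[of _ "w' @ [(\<not> e, x)]"]) auto
qed

lemma presented_group_cases:
  assumes "A \<in> carrier (presented_group X R)"
  obtains w where "w \<in> gwords X" "A = word_cong X R `` {w}"
  using assms unfolding carrier_presented_group by blast

lemma presented_group_class_in_carrier:
  "w \<in> gwords X \<Longrightarrow> word_cong X R `` {w} \<in> carrier (presented_group X R)"
  unfolding carrier_presented_group by blast

lemma group_presented_group: "group (presented_group X R)" (is "group ?G")
proof (rule groupI)
  show "A \<otimes>\<^bsub>?G\<^esub> B \<in> carrier ?G" if "A \<in> carrier ?G" "B \<in> carrier ?G" for A B
    using that
    by (elim presented_group_cases)
      (simp only: mult_presented_group presented_group_class_in_carrier gwords_append)
next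
  show "\<one>\<^bsub>?G\<^esub> \<in> carrier ?G"
    by (simp only: one_presented_group presented_group_class_in_carrier gwords_Nil)
next
  show "A \<otimes>\<^bsub>?G\<^esub> B \<otimes>\<^bsub>?G\<^esub> C = A \<otimes>\<^bsub>?G\<^esub> (B \<otimes>\<^bsub>?G\<^esub> C)"
    if "A \<in> carrier ?G" "B \<in> carrier ?G" "C \<in> carrier ?G" for A B C
    using that
    by (elim presented_group_cases) (simp only: mult_presented_group gwords_append append_assoc)
next
  show "\<one>\<^bsub>?G\<^esub> \<otimes>\<^bsub>?G\<^esub> A = A" if "A \<in> carrier ?G" for A
    using that
    by (elim presented_group_cases)
      (simp only: mult_presented_group one_presented_group gwords_Nil append_Nil)
next
  fix A assume "A \<in> carrier ?G"
  then obtain w where w: "w \<in> gwords X" "A = word_cong X R `` {w}"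
    by (rule presented_group_cases)
  obtain w' where w': "w' \<in> gwords X" "(w' @ w, []) \<in> word_cong X R"
    using word_cong_left_inverse w by blast
  have "word_cong X R `` {w'} \<otimes>\<^bsub>?G\<^esub> A = \<one>\<^bsub>?G\<^esub>"
    using equiv_class_eq[OF equiv_word_cong w'(2)]
    by (simp only: w w' mult_presented_group one_presented_group)
  then show "\<exists>B\<in>carrier ?G. B \<otimes>\<^bsub>?G\<^esub> A = \<one>\<^bsub>?G\<^esub>"
    using w' presented_group_class_in_carrier by blast
qed

section \<open>Right-angled Artin groups, free and free abelian groups\<close>

text \<open>A finite simplicial graph is a \<open>graph\<close>: a finite symmetric digraph without
  loops and without parallel arcs. An edge is a pair of opposite arcs.\<close>

definition raag :: "('v, 'e) pre_digraph \<Rightarrow> 'v gword set monoid" where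
  "raag \<Gamma> = presented_group (verts \<Gamma>)
    {([(True, u), (True, v)], [(True, v), (True, u)]) |u v. u \<rightarrow>\<^bsub>\<Gamma>\<^esub> v}"

lemma group_raag: "group (raag \<Gamma>)"
  unfolding raag_def by (rule group_presented_group)

definition free_group :: "'x set \<Rightarrow> 'x gword set monoid" where
  "free_group X = presented_group X {}"

text \<open>Letting the index set range over the element type of \<open>G\<close> is no restriction: a basis
  is a subset of the carrier. The empty basis is allowed, so the trivial group is
  both free and free abelian.\<close>

definition is_free_group :: "('a, 'm) monoid_scheme \<Rightarrow> bool" where
  "is_free_group G \<longleftrightarrow> (\<exists>X :: 'a set. G \<cong> free_group X)"

definition is_free_abelian_group :: "('a, 'm) monoid_scheme \<Rightarrow> bool" where
  "is_free_abelian_group G \<longleftrightarrow> (\<exists>X :: 'a set. G \<cong> free_Abelian_group X)"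


section \<open>Word metrics and quasi-isometric embeddings\<close>

definition finite_generating_set :: "('a, 'm) monoid_scheme \<Rightarrow> 'a set \<Rightarrow> bool" where
  "finite_generating_set G S \<longleftrightarrow> finite S \<and> S \<subseteq> carrier G \<and> generate G S = carrier G"

definition word_length :: "('a, 'm) monoid_scheme \<Rightarrow> 'a set \<Rightarrow> 'a \<Rightarrow> nat" where
  "word_length G S g = (LEAST n. \<exists>ws. length ws = n \<and> set ws \<subseteq> S \<union> m_inv G ` S
     \<and> foldr (\<otimes>\<^bsub>G\<^esub>) ws \<one>\<^bsub>G\<^esub> = g)"

text \<open>The value \<open>0\<close> off the carrier is junk: \<open>Metric_space\<close> demands a distance
  function that is symmetric on the whole type.\<close>

definition word_dist :: "('a, 'm) monoid_scheme \<Rightarrow> 'a set \<Rightarrow> 'a \<Rightarrow> 'a \<Rightarrow> real" where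
  "word_dist G S g h =
    (if g \<in> carrier G \<and> h \<in> carrier G
     then real (word_length G S (inv\<^bsub>G\<^esub> g \<otimes>\<^bsub>G\<^esub> h)) else 0)"

definition word_metric :: "('a, 'm) monoid_scheme \<Rightarrow> 'a set \<Rightarrow> 'a metric" where
  "word_metric G S = metric (carrier G, word_dist G S)"

definition quasi_isometric_embedding :: "'a metric \<Rightarrow> 'b metric \<Rightarrow> ('a \<Rightarrow> 'b) \<Rightarrow> bool" where
  "quasi_isometric_embedding Y Z f \<longleftrightarrow> f \<in> mspace Y \<rightarrow> mspace Z \<and>
     (\<exists>L \<epsilon>. L \<ge> 1 \<and> \<epsilon> \<ge> 0 \<and> (\<forall>p\<in>mspace Y. \<forall>q\<in>mspace Y.
        1 / L * mdist Y p q - \<epsilon> \<le> mdist Z (f p) (f q) \<and>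
        mdist Z (f p) (f q) \<le> L * mdist Y p q + \<epsilon>))"

text \<open>The type \<open>'a metric\<close> gives meaning to \<open>word_metric\<close> only where
  \<open>word_dist\<close> satisfies the metric axioms, which it does for a generating set of a group.\<close>

context group
begin

lemma foldr_mult_closed: "set ws \<subseteq> carrier G \<Longrightarrow> foldr (\<otimes>) ws \<one> \<in> carrier G"
  by (induction ws) auto

lemma foldr_mult_append:
  "set us \<subseteq> carrier G \<Longrightarrow> set vs \<subseteq> carrier G \<Longrightarrow>
   foldr (\<otimes>) (us @ vs) \<one> = foldr (\<otimes>) us \<one> \<otimes> foldr (\<otimes>) vs \<one>"
proof (induction us)
  case (Cons u us)
  then show ?case
    using foldr_mult_closed by (simp add: m_assoc del: foldr_append)
qed (use foldr_mult_closed in auto)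

lemma foldr_mult_rev_inv:
  "set ws \<subseteq> carrier G \<Longrightarrow> foldr (\<otimes>) (rev (map (m_inv G) ws)) \<one> = inv (foldr (\<otimes>) ws \<one>)"
proof (induction ws)
  case (Cons w ws)
  have "set (rev (map (m_inv G) ws)) \<subseteq> carrier G" using Cons.prems by auto
  then show ?case
    using Cons foldr_mult_closed[of ws] foldr_mult_append[of "rev (map (m_inv G) ws)" "[inv w]"]
    by (simp add: inv_mult_group del: foldr_append)
qed simp

lemma generate_imp_word:
  assumes "S \<subseteq> carrier G" "g \<in> generate G S"
  shows "\<exists>ws. set ws \<subseteq> S \<union> m_inv G ` S \<and> foldr (\<otimes>) ws \<one> = g"
  using assms(2)
proof (induction rule: generate.induct)
  case one
  then show ?case by (intro exI[of _ "[]"]) auto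
next
  case (incl h)
  then show ?case using assms by (intro exI[of _ "[h]"]) auto
next
  case (inv h)
  then show ?case using assms by (intro exI[of _ "[inv h]"]) auto
next
  case (eng g h)
  then obtain us vs where "set us \<subseteq> S \<union> m_inv G ` S" "foldr (\<otimes>) us \<one> = g"
    "set vs \<subseteq> S \<union> m_inv G ` S" "foldr (\<otimes>) vs \<one> = h" by blast
  moreover have "S \<union> m_inv G ` S \<subseteq> carrier G" using assms by auto
  ultimately show ?case
    using foldr_mult_append[of us vs] by (intro exI[of _ "us @ vs"]) auto
qed

lemma word_length_le:
  assumes "set ws \<subseteq> S \<union> m_inv G ` S" "foldr (\<otimes>) ws \<one> = g"
  shows "word_length G S g \<le> length ws"
  unfolding word_length_def using assms by (intro Least_le) blast

lemma word_length_witness: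
  assumes "S \<subseteq> carrier G" "generate G S = carrier G" "g \<in> carrier G"
  obtains ws where "set ws \<subseteq> S \<union> m_inv G ` S" "foldr (\<otimes>) ws \<one> = g"
    "length ws = word_length G S g"
proof -
  have "\<exists>n ws. length ws = n \<and> set ws \<subseteq> S \<union> m_inv G ` S \<and> foldr (\<otimes>) ws \<one> = g"
    using generate_imp_word assms by blast
  from LeastI_ex[OF this] show ?thesis
    using that unfolding word_length_def by blast
qed

lemma word_length_inv_le:
  assumes "S \<subseteq> carrier G" "generate G S = carrier G" "g \<in> carrier G"
  shows "word_length G S (inv g) \<le> word_length G S g"
proof -
  obtain ws where ws: "set ws \<subseteq> S \<union> m_inv G ` S" "foldr (\<otimes>) ws \<one> = g"
    "length ws = word_length G S g" using word_length_witness[OF assms] .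
  have "set ws \<subseteq> carrier G" using ws assms(1) by auto
  moreover have "set (rev (map (m_inv G) ws)) \<subseteq> S \<union> m_inv G ` S"
  proof
    fix t assume "t \<in> set (rev (map (m_inv G) ws))"
    then obtain s where "s \<in> set ws" "t = inv s" by auto
    then have s: "s \<in> S \<union> m_inv G ` S" "t = inv s" using ws(1) by blast+
    then show "t \<in> S \<union> m_inv G ` S" using assms(1) by auto
  qed
  ultimately show ?thesis
    using word_length_le[of "rev (map (m_inv G) ws)" S "inv g"] ws foldr_mult_rev_inv[of ws]
    by simp
qed

lemma word_length_mult_le:
  assumes "S \<subseteq> carrier G" "generate G S = carrier G" "g \<in> carrier G" "h \<in> carrier G"
  shows "word_length G S (g \<otimes> h) \<le> word_length G S g + word_length G S h"
proof -
  obtain us where us: "set us \<subseteq> S \<union> m_inv G ` S" "foldr (\<otimes>) us \<one> = g"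
    "length us = word_length G S g" using word_length_witness assms by metis
  obtain vs where vs: "set vs \<subseteq> S \<union> m_inv G ` S" "foldr (\<otimes>) vs \<one> = h"
    "length vs = word_length G S h" using word_length_witness assms by metis
  have "S \<union> m_inv G ` S \<subseteq> carrier G" using assms by auto
  then have "set us \<subseteq> carrier G" "set vs \<subseteq> carrier G" using us(1) vs(1) by blast+
  then show ?thesis
    using word_length_le[of "us @ vs" S "g \<otimes> h"] foldr_mult_append[of us vs] us vs by simp
qed

lemma word_length_eq_0_iff:
  assumes "S \<subseteq> carrier G" "generate G S = carrier G" "g \<in> carrier G"
  shows "word_length G S g = 0 \<longleftrightarrow> g = \<one>"
proof
  assume "word_length G S g = 0"
  then show "g = \<one>" using word_length_witness[OF assms] by (metis foldr_Nil id_apply length_0_conv)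
next
  assume "g = \<one>"
  then show "word_length G S g = 0" using word_length_le[of "[]" S g] by simp
qed

lemma Metric_space_word_dist:
  assumes "S \<subseteq> carrier G" "generate G S = carrier G"
  shows "Metric_space (carrier G) (word_dist G S)"
proof
  show "0 \<le> word_dist G S x y" for x y by (simp add: word_dist_def)
next
  have *: "word_length G S (inv z) = word_length G S z" if "z \<in> carrier G" for z
    using word_length_inv_le[OF assms, of z] word_length_inv_le[OF assms, of "inv z"] that by simp
  show "word_dist G S x y = word_dist G S y x" for x y
    using *[of "inv x \<otimes> y"] by (auto simp: word_dist_def inv_mult_group)
next
  fix x y assume xy: "x \<in> carrier G" "y \<in> carrier G"
  have "inv x \<otimes> y = \<one> \<longleftrightarrow> x = y"
    using xy by (auto simp: inv_solve_left')
  then show "word_dist G S x y = 0 \<longleftrightarrow> x = y"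
    using xy word_length_eq_0_iff[OF assms, of "inv x \<otimes> y"] by (simp add: word_dist_def)
next
  fix x y z assume xyz: "x \<in> carrier G" "y \<in> carrier G" "z \<in> carrier G"
  have "(inv x \<otimes> y) \<otimes> (inv y \<otimes> z) = inv x \<otimes> z"
    using xyz m_assoc[of y "inv y" z] by (simp add: m_assoc)
  then show "word_dist G S x z \<le> word_dist G S x y + word_dist G S y z"
    using xyz word_length_mult_le[OF assms, of "inv x \<otimes> y" "inv y \<otimes> z"]
    by (simp add: word_dist_def)
qed

lemma
  assumes "S \<subseteq> carrier G" "generate G S = carrier G"
  shows mspace_word_metric: "mspace (word_metric G S) = carrier G"
    and mdist_word_metric: "mdist (word_metric G S) = word_dist G S"
  using Metric_space_word_dist[OF assms]
  by (simp_all add: word_metric_def Metric_space.mspace_metric Metric_space.mdist_metric)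

end

end

theory Submission
  imports Defs
begin

text \<open>Killing a vertex \<open>v\<close> retracts \<open>A\<close> onto \<open>A\<^bsub>V - v\<^esub>\<close>; the kernel is free on the conjugates
  of \<open>v\<close> and acts freely on its Cayley tree \<open>T\<^sub>v\<close>, on which all of \<open>A\<close> acts with vertex stabilizers
  the conjugates of \<open>A\<^bsub>V - v\<^esub>\<close>. Displacements in \<open>T\<^sub>v\<close> are bounded by word length, and a nontrivial
  element is hyperbolic in some \<open>T\<^sub>v\<close>.

  Let \<open>a, b\<close> not commute. If the images under some retraction still do not commute, pass to them, as
  retractions do not increase length. Otherwise \<open>\<langle>a, b\<rangle>\<close> has abelian image under every retraction that
  moves it, so elements whose commutator fixes a point of \<open>T\<^sub>v\<close> commute. A pair that is minimal
  among all Nielsen equivalent pairs and base points of \<open>T\<^sub>v\<close> then either moves the base point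
  along local geodesics, or \<open>a\<close> is elliptic and the displacement still dominates the number of
  syllables \<open>a\<^sup>n\<close>, \<open>b\<^sup>m\<close>. In the second case the group is free, hence in trees where \<open>a\<close> or \<open>b\<close> is
  hyperbolic distinct translates of their axes have bounded overlap, which bounds the exponents.\<close>

section \<open>Trees as integer metric spaces\<close>

text \<open>Powers of an element fixing a point of \<open>T_v\<close> have bounded displacement
  there. Therefore the second alternative can only count syllables, and the exponents have to be
  recovered in other trees, one chosen for each generator. Abelian images are what makes a tree
  usable: commutators then lie in the free kernel, which acts without fixed points, so elements
  sharing a long stretch of axis commute, while the conjugates met along a reduced word of a free
  group do not.

  Commuting pairs need a separate argument. Stabilizers are closed under roots, so the group is
  torsion free and a dependent pair generates a cyclic group. For an independent pair one tree
  cannot suffice: if \<open>a\<close> is hyperbolic in it, some \<open>a^x b^y\<close> with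
  \<open>y > 0\<close> fixes a point there, and a second tree, in which this combination is
  hyperbolic, controls the remaining coordinate.

  Trees are encoded by their vertices with an integer metric. The four point condition and the
  parity of perimeters exclude cycles; parity also makes Gromov products integers, so that base
  points can move to vertices.\<close>

locale tree =
  fixes X :: "'p set" and d :: "'p \<Rightarrow> 'p \<Rightarrow> nat"
  assumes d_eq_0: "\<lbrakk>x \<in> X; y \<in> X\<rbrakk> \<Longrightarrow> d x y = 0 \<longleftrightarrow> x = y"
    and d_sym: "\<lbrakk>x \<in> X; y \<in> X\<rbrakk> \<Longrightarrow> d x y = d y x"
    and d_tri: "\<lbrakk>x \<in> X; y \<in> X; z \<in> X\<rbrakk> \<Longrightarrow> d x z \<le> d x y + d y z"
    and d_parabolic: "\<lbrakk>x \<in> X; y \<in> X; z \<in> X\<rbrakk> \<Longrightarrow> even (d x y + d y z + d x z)"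
    and four_point: "\<lbrakk>x \<in> X; y \<in> X; z \<in> X; w \<in> X\<rbrakk> \<Longrightarrow>
      d x y + d z w \<le> max (d x z + d y w) (d x w + d y z)"
    and geodesic: "\<lbrakk>x \<in> X; y \<in> X; k \<le> d x y\<rbrakk> \<Longrightarrow> \<exists>z\<in>X. d x z = k \<and> d z y = d x y - k"
begin

section \<open>Gromov products, betweenness and uniqueness of geodesics\<close>

definition gromov :: "'p \<Rightarrow> 'p \<Rightarrow> 'p \<Rightarrow> nat" where
  "gromov p x y = (d p x + d p y - d x y) div 2"

definition btw :: "'p \<Rightarrow> 'p \<Rightarrow> 'p \<Rightarrow> bool" where
  "btw x z y \<longleftrightarrow> d x z + d z y = d x y"

lemma d_self [simp]: "x \<in> X \<Longrightarrow> d x x = 0"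
  by (simp add: d_eq_0)

lemma gromov_eq:
  assumes "p \<in> X" "x \<in> X" "y \<in> X"
  shows "2 * gromov p x y + d x y = d p x + d p y"
proof -
  have "d x y \<le> d p x + d p y" using d_tri[of x p y] d_sym[of x p] assms by simp
  moreover have "even (d p x + d x y + d p y)" using d_parabolic assms by blast
  then have "even (d p x + d p y - d x y)" using calculation by (simp add: even_diff_nat algebra_simps)
  ultimately show ?thesis by (simp add: gromov_def)
qed

lemma gromov_sym: "\<lbrakk>p \<in> X; x \<in> X; y \<in> X\<rbrakk> \<Longrightarrow> gromov p x y = gromov p y x"
  by (simp add: gromov_def d_sym add.commute)

lemma gromov_self: "\<lbrakk>p \<in> X; x \<in> X\<rbrakk> \<Longrightarrow> gromov p x x = d p x"
  using gromov_eq[of p x x] by simp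

lemma gromov_le1: "\<lbrakk>p \<in> X; x \<in> X; y \<in> X\<rbrakk> \<Longrightarrow> gromov p x y \<le> d p x"
  using gromov_eq[of p x y] d_tri[of p x y] by simp

lemma gromov_le2: "\<lbrakk>p \<in> X; x \<in> X; y \<in> X\<rbrakk> \<Longrightarrow> gromov p x y \<le> d p y"
  using gromov_le1[of p y x] gromov_sym by simp

text \<open>The four point condition in ultrametric form. The threshold \<open>k\<close> replaces a
  minimum: \<open>k \<le> gromov p x y\<close> means that the paths from \<open>p\<close> to
  \<open>x\<close> and to \<open>y\<close> agree up to distance \<open>k\<close>, and this relation
  is transitive.\<close>

lemma gromov_ultra:
  assumes "p \<in> X" "x \<in> X" "y \<in> X" "z \<in> X" "k \<le> gromov p x y" "k \<le> gromov p y z"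
  shows "k \<le> gromov p x z"
proof -
  have e: "2 * gromov p x y + d x y = d p x + d p y" "2 * gromov p y z + d y z = d p y + d p z"
    "2 * gromov p x z + d x z = d p x + d p z"
    using gromov_eq assms by blast+
  have "d x z + d p y \<le> max (d p x + d y z) (d x y + d p z)"
    using four_point[of x z p y] assms d_sym[of z y] d_sym[of x p] d_sym[of z p] by (simp add: max.commute)
  then have "d x z + d p y \<le> d p x + d y z \<or> d x z + d p y \<le> d x y + d p z"
    by (simp add: le_max_iff_disj)
  then show ?thesis using e assms(5,6) by linarith
qed

lemma btw_gromov: "\<lbrakk>p \<in> X; x \<in> X; z \<in> X\<rbrakk> \<Longrightarrow> btw p z x \<longleftrightarrow> gromov p z x = d p z"
  using gromov_eq[of p z x] by (auto simp: btw_def)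

text \<open>Paths from \<open>p\<close> agree up to the Gromov product of their ends, so a point
  there is determined by its distance from \<open>p\<close>. With \<open>x = y\<close> this is
  uniqueness of geodesics, the most frequent use.\<close>

lemma btw_eqI:
  assumes "p \<in> X" "x \<in> X" "y \<in> X" "z \<in> X" "z' \<in> X" "btw p z x" "btw p z' y"
    "d p z = d p z'" "d p z \<le> gromov p x y"
  shows "z = z'"
proof -
  have "d p z \<le> gromov p z x" "d p z \<le> gromov p y z'"
    using assms by (simp_all add: btw_gromov gromov_sym)
  then have "d p z \<le> gromov p z y" using gromov_ultra[of p z x y] assms by blast
  then have "d p z \<le> gromov p z z'" using gromov_ultra[of p z y z'] \<open>d p z \<le> gromov p y z'\<close> assms by blast
  then have "d z z' = 0" using gromov_eq[of p z z'] assms by simp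
  then show ?thesis using d_eq_0 assms by blast
qed

lemma btw_both_gromov:
  assumes "p \<in> X" "x \<in> X" "y \<in> X" "z \<in> X" "btw p z x" "btw p z y"
  shows "d p z \<le> gromov p x y"
  using gromov_ultra[of p x z y "d p z"] assms by (simp add: btw_gromov gromov_sym)

lemma obtain_pt:
  assumes "x \<in> X" "y \<in> X" "k \<le> d x y"
  obtains z where "z \<in> X" "btw x z y" "d x z = k" "d z y = d x y - k"
proof -
  obtain z where "z \<in> X" "d x z = k" "d z y = d x y - k" using geodesic[OF assms] by blast
  then show ?thesis using that[of z] assms(3) by (simp add: btw_def)
qed

lemma obtain_common_pt:
  assumes "p \<in> X" "x \<in> X" "y \<in> X" "k \<le> gromov p x y"
  obtains z where "z \<in> X" "btw p z x" "btw p z y" "d p z = k"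
proof -
  obtain z where z: "z \<in> X" "btw p z x" "d p z = k"
    by (rule obtain_pt[of p x k]) (use assms gromov_le1[of p x y] in simp_all)
  obtain z' where z': "z' \<in> X" "btw p z' y" "d p z' = k"
    by (rule obtain_pt[of p y k]) (use assms gromov_le2[of p x y] in simp_all)
  have "z = z'" by (rule btw_eqI[of p x y]) (use assms z z' in simp_all)
  then show ?thesis using that z z' by blast
qed

lemma btw_sym: "\<lbrakk>x \<in> X; y \<in> X; z \<in> X\<rbrakk> \<Longrightarrow> btw x z y \<longleftrightarrow> btw y z x"
  using d_sym[of y z] d_sym[of z x] d_sym[of y x] by (auto simp: btw_def)

lemma btw_symD: "\<lbrakk>x \<in> X; y \<in> X; z \<in> X; btw x z y\<rbrakk> \<Longrightarrow> btw y z x"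
  using btw_sym by blast

lemma btw_refl [simp]: "\<lbrakk>x \<in> X; y \<in> X\<rbrakk> \<Longrightarrow> btw x x y" "\<lbrakk>x \<in> X; y \<in> X\<rbrakk> \<Longrightarrow> btw x y y"
  by (auto simp: btw_def)

lemma btw_trans:
  assumes "x \<in> X" "y \<in> X" "z \<in> X" "w \<in> X" "btw x z y" "btw z w y"
  shows "btw x w y" "btw x z w"
  using assms d_tri[of x z w] d_tri[of x w y] by (auto simp: btw_def)

lemma btw_trans':
  assumes "x \<in> X" "y \<in> X" "z \<in> X" "w \<in> X" "btw x z y" "btw x w z"
  shows "btw x w y" "btw w z y"
  using assms d_tri[of x w y] d_tri[of w z y] by (auto simp: btw_def)

lemma btw_order:
  assumes "x \<in> X" "y \<in> X" "z \<in> X" "w \<in> X" "btw x z y" "btw x w y" "d x w \<le> d x z"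
  shows "btw x w z" "btw w z y"
proof -
  have "d x w \<le> gromov x w z"
    using gromov_ultra[of x w y z "d x w"] assms by (simp add: btw_gromov gromov_sym)
  then show 1: "btw x w z" using assms gromov_le1[of x w z] by (simp add: btw_gromov)
  then show "btw w z y" using btw_trans' assms by blast
qed

lemma btw_convex:
  assumes "p \<in> X" "q \<in> X" "u \<in> X" "v \<in> X" "m \<in> X" "btw p u q" "btw p v q" "btw u m v"
  shows "btw p m q"
proof -
  have *: "btw p m q" if "u \<in> X" "v \<in> X" "btw p u q" "btw p v q" "btw u m v" "d p u \<le> d p v" for u v
  proof -
    have "btw p u v" using btw_order(1)[of p q v u] that assms by blast
    then have "d p m + d m q \<le> d p q"
      using d_tri[of p u m] d_tri[of m v q] that assms unfolding btw_def by simp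
    then show ?thesis using d_tri[of p m q] assms unfolding btw_def by simp
  qed
  show ?thesis
  proof (cases "d p u \<le> d p v")
    case True
    show ?thesis by (rule *[of u v]) (fact assms True)+
  next
    case False
    have "btw v m u" using assms btw_sym by blast
    then show ?thesis using *[of v u] False assms by simp
  qed
qed

text \<open>The geodesic from the current point back to the starting point is kept as a stack of
  pieces, each inside one side of the path; a new side cancels at most \<open>\<delta>\<close> against each piece,
  and a piece that is completely cancelled never returns.\<close>

context
  fixes x :: "nat \<Rightarrow> 'p"
begin

definition on_side :: "nat \<Rightarrow> 'p \<Rightarrow> bool" where
  "on_side i u \<longleftrightarrow> btw (x i) u (x (Suc i))"

fun pieces :: "nat \<Rightarrow> 'p list \<Rightarrow> bool" where
  "pieces n [] = False"
| "pieces n [z] = (z = x 0)"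
| "pieces n (z # z' # zs) \<longleftrightarrow>
    z \<in> X \<and> z' \<in> X \<and> (\<exists>i<n. on_side i z \<and> on_side i z') \<and> btw z z' (x 0) \<and> pieces n (z' # zs)"

lemma pieces_mono: "pieces n zs \<Longrightarrow> n \<le> m \<Longrightarrow> pieces m zs"
proof (induction n zs rule: pieces.induct)
  case (3 n z z' zs)
  then show ?case using order_less_le_trans by (simp, blast)
qed auto

lemma pieces_cut:
  assumes X: "\<And>i. i \<le> Suc n \<Longrightarrow> x i \<in> X"
    and overlap: "\<And>i u v. \<lbrakk>i < n; u \<in> X; v \<in> X; on_side i u; on_side i v; on_side n u; on_side n v\<rbrakk>
        \<Longrightarrow> d u v \<le> \<delta>"
    and "pieces n (z # zs)" "z \<in> X" "m \<in> X" "btw z m (x 0)"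
    and "\<And>u. u \<in> X \<Longrightarrow> btw z u m \<Longrightarrow> on_side n u"
  shows "\<exists>zs'. pieces n (m # zs') \<and> length zs' \<le> length zs \<and>
    d z m + \<delta> * length zs' \<le> \<delta> * length zs + \<delta>"
  using assms(3-)
proof (induction zs arbitrary: z)
  case Nil
  then have "m = z" using X[of 0] d_eq_0[of m z] d_sym[of m z] by (simp add: btw_def)
  then show ?case using Nil by (intro exI[of _ "[]"]) simp
next
  case (Cons z' zs)
  have x0: "x 0 \<in> X" using X by simp
  have z': "z' \<in> X" "btw z z' (x 0)" "pieces n (z' # zs)" using Cons.prems by auto
  obtain i where i: "i < n" "on_side i z" "on_side i z'" using Cons.prems by auto
  show ?case
  proof (cases "d z m \<le> d z z'")
    \<comment> \<open>The branching point lies inside the first piece: that piece is shortened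
      instead of removed and accounts for the single \<delta> beyond the count of pieces.\<close>
    case True
    have b: "btw z m z'" "btw m z' (x 0)"
      using btw_order[of z "x 0" z' m] True Cons.prems z' x0 by blast+
    have "on_side i m"
      using btw_convex[of "x i" "x (Suc i)" z z' m] i b X Cons.prems z' by (simp add: on_side_def)
    moreover have "on_side n z" "on_side n m" using Cons.prems by simp_all
    ultimately have "d z m \<le> \<delta>" using overlap[of i z m] i Cons.prems by blast
    moreover have "pieces n (m # z' # zs)"
      using b i(1,3) \<open>on_side i m\<close> z' Cons.prems(3) by auto
    ultimately show ?thesis by (intro exI[of _ "z' # zs"]) simp
  next
    case False
    then have b: "btw z z' m" "btw z' m (x 0)"
      using btw_order[of z "x 0" m z'] Cons.prems z' x0 by simp_all
    have "on_side n u" if "u \<in> X" "btw z' u m" for u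
      using btw_trans(1)[of z m z' u] b that Cons.prems z' by blast
    from Cons.IH[OF z'(3,1) Cons.prems(3) b(2) this]
    obtain zs' where zs': "pieces n (m # zs')" "length zs' \<le> length zs"
      "d z' m + \<delta> * length zs' \<le> \<delta> * length zs + \<delta>" by blast
    have "on_side n z" "on_side n z'" using Cons.prems b z' by simp_all
    then have "d z z' \<le> \<delta>" using overlap[of i z z'] i Cons.prems z' by blast
    then show ?thesis
      using zs' b(1) by (intro exI[of _ zs']) (simp add: btw_def)
  qed
qed

text \<open>An amortised count in which every piece on the stack holds a credit of
  \<open>2 * \<delta>\<close>. Backtracking by \<open>r\<close> loses \<open>2 * r\<close>, and
  \<open>r\<close> is at most \<delta> for each destroyed piece plus one more \<delta>. So a new
  side costs \<open>2 * \<delta>\<close> for the last, incomplete cancellation and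
  \<open>2 * \<delta>\<close> of credit for the piece it pushes; this is the factor 4.\<close>

lemma bounded_overlap_length:
  assumes X: "\<And>i. i \<le> N \<Longrightarrow> x i \<in> X"
    and overlap: "\<And>i j u v. \<lbrakk>i < j; j < N; u \<in> X; v \<in> X; on_side i u; on_side i v;
        on_side j u; on_side j v\<rbrakk> \<Longrightarrow> d u v \<le> \<delta>"
  shows "(\<Sum>i<N. d (x i) (x (Suc i))) \<le> d (x 0) (x N) + 4 * \<delta> * N"
proof -
  have "\<exists>zs. pieces n (x n # zs) \<and>
      (\<Sum>i<n. d (x i) (x (Suc i))) + 2 * \<delta> * length zs \<le> d (x 0) (x n) + 4 * \<delta> * n"
    if "n \<le> N" for n
    using that
  proof (induction n)
    case 0
    show ?case by (intro exI[of _ "[]"]) simp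
  next
    case (Suc n)
    then obtain zs where zs: "pieces n (x n # zs)"
      "(\<Sum>i<n. d (x i) (x (Suc i))) + 2 * \<delta> * length zs \<le> d (x 0) (x n) + 4 * \<delta> * n" by auto
    have xs: "x 0 \<in> X" "x n \<in> X" "x (Suc n) \<in> X" using X Suc.prems by simp_all
    obtain m where m: "m \<in> X" "btw (x n) m (x 0)" "btw (x n) m (x (Suc n))"
      "d (x n) m = gromov (x n) (x 0) (x (Suc n))"
      using obtain_common_pt[OF xs(2,1,3) order_refl] by blast
    have on: "on_side n u" if "u \<in> X" "btw (x n) u m" for u
      using btw_trans'(1)[of "x n" "x (Suc n)" m u] that m xs by (simp add: on_side_def)
    obtain zs' where zs': "pieces n (m # zs')" "length zs' \<le> length zs"
      "d (x n) m + \<delta> * length zs' \<le> \<delta> * length zs + \<delta>"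
    proof -
      have "\<exists>zs'. pieces n (m # zs') \<and> length zs' \<le> length zs \<and>
          d (x n) m + \<delta> * length zs' \<le> \<delta> * length zs + \<delta>"
      proof (rule pieces_cut)
        show "x i \<in> X" if "i \<le> Suc n" for i using X that Suc.prems by simp
        show "d u v \<le> \<delta>" if "i < n" "u \<in> X" "v \<in> X" "on_side i u" "on_side i v"
          "on_side n u" "on_side n v" for i u v
          using overlap[of i n u v] that Suc.prems by simp
      qed (use zs m xs on in simp_all)
      then show ?thesis using that by blast
    qed
    have dd: "d (x 0) (x n) + d (x n) (x (Suc n)) = d (x 0) (x (Suc n)) + 2 * d (x n) m"
      using gromov_eq[of "x n" "x 0" "x (Suc n)"] m xs d_sym[of "x 0" "x n"] by simp
    have "btw (x (Suc n)) m (x 0)"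
      using m dd xs d_sym[of "x 0" "x n"] d_sym[of "x 0" m] d_sym[of "x (Suc n)" m] d_sym[of "x (Suc n)" "x 0"]
      unfolding btw_def by simp
    moreover have "on_side n m" "on_side n (x (Suc n))" using on m xs by (simp_all add: on_side_def)
    ultimately have "pieces (Suc n) (x (Suc n) # m # zs')"
      using m xs pieces_mono[OF zs'(1), of "Suc n"] by auto
    moreover have "(\<Sum>i<Suc n. d (x i) (x (Suc i))) + 2 * \<delta> * length (m # zs')
        \<le> d (x 0) (x (Suc n)) + 4 * \<delta> * Suc n"
      using zs(2) zs'(3) dd by (simp add: algebra_simps)
    ultimately show ?case by blast
  qed
  from this[of N] show ?thesis by auto
qed

end

end

section \<open>Syllables and Nielsen moves\<close>

text \<open>Normal forms of the free product of two infinite cyclic groups: \<open>(True, n)\<close>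
  stands for \<open>a^n\<close> and \<open>(False, n)\<close> for \<open>b^n\<close>.\<close>

definition alternating :: "(bool \<times> int) list \<Rightarrow> bool" where
  "alternating s \<longleftrightarrow> (\<forall>q\<in>set s. snd q \<noteq> 0) \<and> successively (\<lambda>q r. fst q \<noteq> fst r) s"

definition exponent_length :: "(bool \<times> int) list \<Rightarrow> nat" where
  "exponent_length s = (\<Sum>q\<leftarrow>s. nat \<bar>snd q\<bar>)"

definition letters :: "(bool \<times> int) list \<Rightarrow> (bool \<times> bool) list" where
  "letters s = concat (map (\<lambda>(x, n). replicate (nat \<bar>n\<bar>) (n > 0, x)) s)"

lemma alternating_Nil [simp]: "alternating []"
  by (simp add: alternating_def)

lemma alternating_Cons: "alternating ((x, n) # s) \<longleftrightarrow> n \<noteq> 0 \<and> (s = [] \<or> fst (hd s) \<noteq> x) \<and> alternating s"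
  by (auto simp: alternating_def successively_Cons)

lemma alternating_append:
  "alternating (s @ t) \<longleftrightarrow> alternating s \<and> alternating t \<and> (s = [] \<or> t = [] \<or> fst (last s) \<noteq> fst (hd t))"
  by (auto simp: alternating_def successively_append_iff)

lemma exponent_length_simps [simp]: "exponent_length [] = 0" "exponent_length ((x, n) # s) = nat \<bar>n\<bar> + exponent_length s"
  by (simp_all add: exponent_length_def)

lemma letters_simps [simp]:
  "letters [] = []" "letters ((x, n) # s) = replicate (nat \<bar>n\<bar>) (n > 0, x) @ letters s"
  by (simp_all add: letters_def)

lemma length_letters: "length (letters s) = exponent_length s"
  by (induction s) auto

lemma hd_letters: "alternating ((x, n) # s) \<Longrightarrow> letters ((x, n) # s) \<noteq> [] \<and> snd (hd (letters ((x, n) # s))) = x"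
  by (auto simp: alternating_Cons hd_append)

lemma successively_replicate: "P c c \<Longrightarrow> successively P (replicate k c)"
proof (induction k)
  case (Suc k)
  then show ?case by (cases k) (simp_all add: successively_Cons)
qed simp

lemma letters_reduced: "alternating s \<Longrightarrow> successively (\<lambda>i j. j \<noteq> (\<not> fst i, snd i)) (letters s)"
proof (induction s)
  case (Cons q s)
  obtain x n where q: "q = (x, n)" by fastforce
  have s: "alternating s" using Cons.prems q by (simp add: alternating_Cons)
  have "hd (letters s) \<noteq> (\<not> e, x)" if "letters s \<noteq> []" for e
  proof (cases s)
    case (Cons r t)
    obtain y m where r: "r = (y, m)" by fastforce
    then show ?thesis using hd_letters[of y m t] Cons s Cons.prems q \<open>alternating (q # s)\<close>
      by (auto simp: alternating_Cons)
  qed (use that in simp)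
  then have *: "letters s = [] \<or> hd (letters s) \<noteq> (\<not> (n > 0), x)" by blast
  have "n \<noteq> 0" using Cons.prems q by (simp add: alternating_Cons)
  then show ?case using Cons.IH[OF s] q *
    by (simp add: successively_append_iff successively_replicate last_replicate)
qed simp

context group
begin

fun syllable_prod :: "'a \<Rightarrow> 'a \<Rightarrow> (bool \<times> int) list \<Rightarrow> 'a" where
  "syllable_prod a b [] = \<one>"
| "syllable_prod a b ((x, n) # s) = (if x then a else b) [^] n \<otimes> syllable_prod a b s"

lemma syllable_prod_closed [simp]: "\<lbrakk>a \<in> carrier G; b \<in> carrier G\<rbrakk> \<Longrightarrow> syllable_prod a b s \<in> carrier G"
  by (induction a b s rule: syllable_prod.induct) auto

lemma syllable_prod_append:
  "\<lbrakk>a \<in> carrier G; b \<in> carrier G\<rbrakk> \<Longrightarrow> syllable_prod a b (s @ t) = syllable_prod a b s \<otimes> syllable_prod a b t"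
  by (induction a b s rule: syllable_prod.induct) (auto simp: m_assoc)

lemma syllable_prod_uminus:
  "\<lbrakk>a \<in> carrier G; b \<in> carrier G\<rbrakk> \<Longrightarrow>
    syllable_prod a b (rev (map (\<lambda>(x, n). (x, - n)) s)) = inv (syllable_prod a b s)"
  by (induction a b s rule: syllable_prod.induct) (auto simp: syllable_prod_append inv_mult_group int_pow_neg)

definition letter_val :: "'a \<Rightarrow> 'a \<Rightarrow> bool \<times> bool \<Rightarrow> 'a" where
  "letter_val a b q = (if fst q then (if snd q then a else b) else inv (if snd q then a else b))"

lemma letter_val_closed [simp]:
  "\<lbrakk>a \<in> carrier G; b \<in> carrier G\<rbrakk> \<Longrightarrow> letter_val a b q \<in> carrier G"
  by (simp add: letter_val_def)

lemma foldr_mult_foldr: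
  assumes "\<And>i. i \<in> set is \<Longrightarrow> f i \<in> carrier G" "g \<in> carrier G"
  shows "foldr (\<lambda>i h. f i \<otimes> h) is \<one> \<in> carrier G \<and>
    foldr (\<lambda>i h. f i \<otimes> h) is g = foldr (\<lambda>i h. f i \<otimes> h) is \<one> \<otimes> g"
  using assms by (induction "is") (auto simp: m_assoc)

lemma foldr_replicate_pow:
  assumes "f i \<in> carrier G"
  shows "foldr (\<lambda>i h. f i \<otimes> h) (replicate k i) \<one> = f i [^] k"
proof (induction k)
  case (Suc k)
  then show ?case using nat_pow_Suc2[OF assms] by simp
qed simp

lemma foldr_letters:
  assumes "a \<in> carrier G" "b \<in> carrier G"
  shows "foldr (\<lambda>i h. letter_val a b i \<otimes> h) (letters s) \<one> = syllable_prod a b s"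
proof (induction s)
  case (Cons q s)
  obtain x n where q: "q = (x, n)" by fastforce
  let ?x = "if x then a else b"
  have x: "?x \<in> carrier G" using assms by simp
  have "foldr (\<lambda>i h. letter_val a b i \<otimes> h) (replicate (nat \<bar>n\<bar>) (n > 0, x)) \<one> = ?x [^] n"
  proof (cases "n > 0")
    case True
    then show ?thesis
      using foldr_replicate_pow[of "letter_val a b" "(True, x)"] assms int_pow_int[of G ?x "nat n"]
      by (simp add: letter_val_def)
  next
    case False
    then have "letter_val a b (False, x) [^] nat \<bar>n\<bar> = inv (?x [^] int (nat \<bar>n\<bar>))"
      using x nat_pow_inv[of ?x] by (simp add: letter_val_def int_pow_int)
    also have "\<dots> = ?x [^] n" using False x int_pow_neg[of ?x "\<bar>n\<bar>"] by simp
    finally show ?thesis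
      using foldr_replicate_pow[of "letter_val a b" "(False, x)"] assms False by simp
  qed
  then show ?case
    using Cons.IH q assms foldr_mult_foldr[of "replicate (nat \<bar>n\<bar>) (n > 0, x)" "letter_val a b" "syllable_prod a b s"]
    by simp
qed simp

lemma int_pow_conj:
  assumes "c \<in> carrier G" "x \<in> carrier G"
  shows "(c \<otimes> x \<otimes> inv c) [^] (n::int) = c \<otimes> x [^] n \<otimes> inv c"
proof -
  have "group_hom G G (\<lambda>w. c \<otimes> w \<otimes> inv c)"
  proof (intro group_hom.intro group_hom_axioms.intro is_group homI)
    fix w z assume "w \<in> carrier G" "z \<in> carrier G"
    moreover have "inv c \<otimes> (c \<otimes> (z \<otimes> inv c)) = z \<otimes> inv c"
      using assms(1) \<open>z \<in> carrier G\<close> by (simp add: m_assoc[symmetric])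
    ultimately show "c \<otimes> (w \<otimes> z) \<otimes> inv c = c \<otimes> w \<otimes> inv c \<otimes> (c \<otimes> z \<otimes> inv c)"
      using assms(1) by (simp add: m_assoc)
  qed (use assms in simp)
  from group_hom.hom_int_pow[OF this assms(2)] show ?thesis by simp
qed

lemma subgroup_int_pow_closed:
  assumes "subgroup H G" "x \<in> H"
  shows "x [^] (n::int) \<in> H"
  using group.int_pow_closed[OF subgroup.subgroup_is_group[OF assms(1) is_group]] int_pow_consistent[OF assms]
    assms(2) by simp

text \<open>The remaining elementary moves arise by conjugating these with \<open>swap\<close>. The
  starting pair is a parameter, so properties are transported between it and the current pair by
  induction on the moves.\<close>

inductive nielsen :: "'a \<Rightarrow> 'a \<Rightarrow> 'a \<Rightarrow> 'a \<Rightarrow> bool" for a0 b0 where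
  refl: "nielsen a0 b0 a0 b0"
| swap: "nielsen a0 b0 a b \<Longrightarrow> nielsen a0 b0 b a"
| inv: "nielsen a0 b0 a b \<Longrightarrow> nielsen a0 b0 (inv a) b"
| mult: "nielsen a0 b0 a b \<Longrightarrow> nielsen a0 b0 a (a \<otimes> b)"

lemma nielsen_in_subgroup:
  assumes "nielsen a0 b0 a b" "subgroup H G" "a0 \<in> H" "b0 \<in> H"
  shows "a \<in> H \<and> b \<in> H"
  using assms by (induction rule: nielsen.induct) (auto simp: subgroup.m_inv_closed subgroup.m_closed)

lemma nielsen_closed:
  assumes "nielsen a0 b0 a b" "a0 \<in> carrier G" "b0 \<in> carrier G"
  shows "a \<in> carrier G" "b \<in> carrier G"
  using nielsen_in_subgroup[OF assms(1) subgroup_self] assms by auto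

lemma nielsen_inv2: "nielsen a0 b0 a b \<Longrightarrow> nielsen a0 b0 a (inv b)"
  by (rule nielsen.swap[OF nielsen.inv[OF nielsen.swap]])

lemma nielsen_inv_mult:
  assumes "nielsen a0 b0 a b" "a0 \<in> carrier G" "b0 \<in> carrier G"
  shows "nielsen a0 b0 a (inv a \<otimes> b)"
  using nielsen.inv[OF nielsen.mult[OF nielsen.inv[OF assms(1)]]] nielsen_closed[OF assms] by simp

lemma nielsen_pow_mult:
  assumes "nielsen a0 b0 a b" "a0 \<in> carrier G" "b0 \<in> carrier G"
  shows "nielsen a0 b0 a (a [^] (n::int) \<otimes> b)"
proof (induction n rule: int_induct[where k = 0])
  case base
  then show ?case using assms nielsen_closed[OF assms] by simp
next
  case (step1 i)
  have "a [^] (i + 1) = a \<otimes> a [^] i"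
    using int_pow_mult[of a 1 i] nielsen_closed[OF assms] by (simp add: add.commute)
  then show ?case using nielsen.mult[OF step1(2)] nielsen_closed[OF assms] by (simp add: m_assoc)
next
  case (step2 i)
  have "a [^] (i - 1) = inv a \<otimes> a [^] i"
    using int_pow_mult[of a "-1" i] nielsen_closed[OF assms] int_pow_neg[of a 1] by simp
  then show ?case using nielsen_inv_mult[OF step2(2)] assms nielsen_closed[OF assms] by (simp add: m_assoc)
qed

lemma nielsen_not_commute:
  assumes "nielsen a0 b0 a b" "a0 \<in> carrier G" "b0 \<in> carrier G" "a \<otimes> b = b \<otimes> a"
  shows "a0 \<otimes> b0 = b0 \<otimes> a0"
  using assms
proof (induction rule: nielsen.induct)
  case (inv a b)
  have c: "a \<in> carrier G" "b \<in> carrier G" using nielsen_closed inv by blast+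
  have "b \<otimes> a = a \<otimes> (inv a \<otimes> b) \<otimes> a" using c by (simp add: m_assoc[symmetric])
  also have "\<dots> = a \<otimes> b" using inv.prems c by (simp add: m_assoc)
  finally show ?case using inv by simp
next
  case (mult a b)
  have c: "a \<in> carrier G" "b \<in> carrier G" using nielsen_closed mult by blast+
  then have "a \<otimes> b = b \<otimes> a" using mult.prems by (simp add: m_assoc)
  then show ?case using mult by simp
qed auto

lemma nielsen_generate:
  assumes "nielsen a0 b0 a b" "a0 \<in> carrier G" "b0 \<in> carrier G"
  shows "generate G {a, b} = generate G {a0, b0}"
  using assms
proof (induction rule: nielsen.induct)
  case (swap a b)
  then show ?case by (simp add: insert_commute)
next
  case (inv a b)
  have c: "a \<in> carrier G" "b \<in> carrier G" using nielsen_closed inv by blast+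
  have "inv a \<in> generate G {a, b}" by (rule generate.inv) simp
  moreover have "inv (inv a) \<in> generate G {inv a, b}" by (rule generate.inv) simp
  ultimately have "generate G {inv a, b} = generate G {a, b}"
    using c generate.incl[of b "{a, b}" G] generate.incl[of b "{inv a, b}" G]
    by (intro subset_antisym generate_subgroup_incl generate_is_subgroup) auto
  then show ?case using inv by simp
next
  case (mult a b)
  have c: "a \<in> carrier G" "b \<in> carrier G" using nielsen_closed mult by blast+
  have "inv a \<otimes> (a \<otimes> b) \<in> generate G {a, a \<otimes> b}"
    by (intro generate.eng generate.inv generate.incl) auto
  then have "b \<in> generate G {a, a \<otimes> b}" using c by (simp add: m_assoc[symmetric])
  moreover have "a \<otimes> b \<in> generate G {a, b}" by (intro generate.eng generate.incl) auto
  ultimately have "generate G {a, a \<otimes> b} = generate G {a, b}"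
    using c generate.incl[of a "{a, b}" G] generate.incl[of a "{a, a \<otimes> b}" G]
    by (intro subset_antisym generate_subgroup_incl generate_is_subgroup) auto
  then show ?case using mult by simp
qed simp

end

text \<open>A good pair found in the image of a retraction is the image of a pair upstairs: the same
  moves are repeated there.\<close>

lemma (in group_hom) nielsen_lift:
  assumes "H.nielsen (h a0) (h b0) a' b'" "a0 \<in> carrier G" "b0 \<in> carrier G"
  shows "\<exists>a b. G.nielsen a0 b0 a b \<and> h a = a' \<and> h b = b'"
  using assms
proof (induction rule: H.nielsen.induct)
  case refl
  then show ?case using G.nielsen.refl by blast
next
  case (swap a b)
  then show ?case using G.nielsen.swap by blast
next
  case (inv a' b')
  then obtain a b where *: "G.nielsen a0 b0 a b" "h a = a'" "h b = b'" by blast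
  then show ?case using G.nielsen.inv[OF *(1)] G.nielsen_closed[OF *(1)] inv.prems
    by (metis hom_inv)
next
  case (mult a' b')
  then obtain a b where *: "G.nielsen a0 b0 a b" "h a = a'" "h b = b'" by blast
  then show ?case using G.nielsen.mult[OF *(1)] G.nielsen_closed[OF *(1)] mult.prems
    by (metis hom_mult)
qed

lemma (in group_hom) hom_syllable_prod:
  assumes "a \<in> carrier G" "b \<in> carrier G"
  shows "h (G.syllable_prod a b s) = H.syllable_prod (h a) (h b) s"
  using assms by (induction s) (auto simp: hom_int_pow)

section \<open>Actions on trees\<close>

text \<open>Inversions are excluded so that an isometry folding a path back onto itself fixes a
  vertex instead of flipping an edge.\<close>

locale tree_action = group G + tree X d
  for G :: "('a, 'm) monoid_scheme" (structure) and X :: "'p set" and d :: "'p \<Rightarrow> 'p \<Rightarrow> nat" +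
  fixes act :: "'a \<Rightarrow> 'p \<Rightarrow> 'p"
  assumes act_closed [simp]: "\<lbrakk>g \<in> carrier G; x \<in> X\<rbrakk> \<Longrightarrow> act g x \<in> X"
    and act_one [simp]: "x \<in> X \<Longrightarrow> act \<one> x = x"
    and act_mult: "\<lbrakk>g \<in> carrier G; h \<in> carrier G; x \<in> X\<rbrakk> \<Longrightarrow> act (g \<otimes> h) x = act g (act h x)"
    and d_act [simp]: "\<lbrakk>g \<in> carrier G; x \<in> X; y \<in> X\<rbrakk> \<Longrightarrow> d (act g x) (act g y) = d x y"
    and no_inversion: "\<lbrakk>g \<in> carrier G; x \<in> X; d x (act g x) = 1\<rbrakk> \<Longrightarrow> act g (act g x) \<noteq> x"
    and X_nonempty: "X \<noteq> {}"
begin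

abbreviation disp :: "'p \<Rightarrow> 'a \<Rightarrow> nat" where
  "disp p g \<equiv> d p (act g p)"

lemma act_inv_act [simp]:
  "\<lbrakk>g \<in> carrier G; x \<in> X\<rbrakk> \<Longrightarrow> act (inv g) (act g x) = x"
  "\<lbrakk>g \<in> carrier G; x \<in> X\<rbrakk> \<Longrightarrow> act g (act (inv g) x) = x"
  by (simp_all add: act_mult[symmetric])

lemma d_act_right: "\<lbrakk>g \<in> carrier G; x \<in> X; y \<in> X\<rbrakk> \<Longrightarrow> d x (act g y) = d (act (inv g) x) y"
  using d_act[of "inv g" x "act g y"] by simp

lemma d_act_left: "\<lbrakk>g \<in> carrier G; x \<in> X; y \<in> X\<rbrakk> \<Longrightarrow> d (act g x) y = d x (act (inv g) y)"
  using d_act_right[of "inv g" x y] by simp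

lemma disp_inv [simp]: "\<lbrakk>g \<in> carrier G; p \<in> X\<rbrakk> \<Longrightarrow> disp p (inv g) = disp p g"
  using d_act_left[of g p p] d_sym[of p "act g p"] by simp

lemma gromov_act [simp]:
  "\<lbrakk>g \<in> carrier G; p \<in> X; x \<in> X; y \<in> X\<rbrakk> \<Longrightarrow> gromov (act g p) (act g x) (act g y) = gromov p x y"
  by (simp add: gromov_def)

lemma btw_act [simp]:
  "\<lbrakk>g \<in> carrier G; x \<in> X; y \<in> X; z \<in> X\<rbrakk> \<Longrightarrow> btw (act g x) (act g z) (act g y) \<longleftrightarrow> btw x z y"
  by (simp add: btw_def)

lemma act_nat_pow_fixed: "\<lbrakk>g \<in> carrier G; p \<in> X; act g p = p\<rbrakk> \<Longrightarrow> act (g [^] (n::nat)) p = p"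
  by (induction n) (simp_all add: act_mult)

lemma act_inv_fixed: "\<lbrakk>g \<in> carrier G; p \<in> X; act g p = p\<rbrakk> \<Longrightarrow> act (inv g) p = p"
  using act_inv_act(1)[of g p] by simp

lemma act_int_pow_fixed: "\<lbrakk>g \<in> carrier G; p \<in> X; act g p = p\<rbrakk> \<Longrightarrow> act (g [^] (n::int)) p = p"
  by (simp only: int_pow_def2 split: if_split) (blast intro: act_inv_fixed act_nat_pow_fixed nat_pow_closed)

text \<open>Local geodesics in a tree are global, with cancellation allowed. Each factor reserves
  \<open>cin\<close> at its start and \<open>cout\<close> at its end and keeps a middle of length at
  least 1, so every further factor adds at least 1 to the displacement. The second conjunct, that
  the product leaves \<open>p\<close> along the first factor up to its last \<open>cout\<close>
  steps, is what the induction feeds on.\<close>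

lemma foldr_strong_local_global:
  fixes f :: "'i \<Rightarrow> 'a"
  assumes p: "p \<in> X" and f: "\<And>k. k \<in> set (i # js) \<Longrightarrow> f k \<in> carrier G"
    and c: "\<And>k. k \<in> set (i # js) \<Longrightarrow> cin k + cout k < disp p (f k)"
    and s: "successively (\<lambda>i j. gromov p (act (inv f i) p) (act (f j) p) \<le> min (cout i) (cin j)) (i # js)"
  defines "F \<equiv> \<lambda>js. foldr (\<lambda>i g. f i \<otimes> g) js \<one>"
  shows "length js + disp p (f i) \<le> disp p (F (i # js)) + cout i \<and>
    disp p (f i) \<le> gromov p (act (f i) p) (act (F (i # js)) p) + cout i"
  using f c s
proof (induction js arbitrary: i)
  case Nil
  then show ?case using p by (simp add: F_def gromov_self)
next
  case (Cons j js)
  have ci: "f i \<in> carrier G" "f j \<in> carrier G" using Cons.prems(1) by simp_all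
  have cF: "F (j # js) \<in> carrier G"
    using foldr_mult_foldr[of "j # js" f \<one>] Cons.prems(1) unfolding F_def by auto
  define y where "y = act (F (j # js)) p"
  define w where "w = act (inv f i) p"
  define c0 where "c0 = gromov p w (act (f j) p)"
  define e where "e = gromov p w y"
  have X: "y \<in> X" "w \<in> X" using ci cF p by (simp_all add: y_def w_def)
  have s': "successively (\<lambda>i j. gromov p (act (inv f i) p) (act (f j) p) \<le> min (cout i) (cin j)) (j # js)"
    using Cons.prems(3) by simp
  have c0: "c0 \<le> cout i" "c0 \<le> cin j" using Cons.prems(3) by (simp_all add: c0_def w_def)
  have IH: "length js + disp p (f j) \<le> d p y + cout j" "disp p (f j) \<le> gromov p (act (f j) p) y + cout j"
    using Cons.IH[OF _ _ s'] Cons.prems(1,2) by (simp_all add: y_def)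
  have cj: "cin j + cout j < disp p (f j)" using Cons.prems(2)[of j] by simp
  \<comment> \<open>Because the middle of \<open>f j\<close> survives, \<open>y\<close> and
    \<open>act (f j) p\<close> agree beyond \<open>c0\<close>; a larger overlap of \<open>w\<close>
    with \<open>y\<close> would also be one with \<open>act (f j) p\<close>.\<close>
  have e: "e \<le> c0"
  proof (rule ccontr)
    assume "\<not> e \<le> c0"
    then have "c0 + 1 \<le> gromov p w (act (f j) p)"
      using gromov_ultra[of p w y "act (f j) p" "c0 + 1"] p X ci IH(2) cj c0 gromov_sym[of p y "act (f j) p"]
      unfolding e_def by simp
    then show False by (simp add: c0_def)
  qed
  have Fy: "act (F (i # j # js)) p = act (f i) y"
    using act_mult[of "f i" "F (j # js)" p] ci cF p by (simp add: F_def y_def)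
  have dw: "d p w = disp p (f i)" using ci p by (simp add: w_def)
  have dy: "d w y = d p (act (f i) y)" using d_act_right[of "f i" p y] ci p X by (simp add: w_def)
  have e1: "2 * e + d p (act (f i) y) = disp p (f i) + d p y"
    using gromov_eq[of p w y] p X dw dy by (simp add: e_def)
  have "2 * gromov p (act (f i) p) (act (f i) y) + d p y = disp p (f i) + d p (act (f i) y)"
    using gromov_eq[of p "act (f i) p" "act (f i) y"] p X ci by simp
  then show ?case using e1 e c0 cj IH(1) unfolding Fy by simp
qed

lemma foldr_local_global:
  fixes f :: "'i \<Rightarrow> 'a"
  assumes p: "p \<in> X" and f: "\<And>i. i \<in> set is \<Longrightarrow> f i \<in> carrier G"
    and c: "\<And>i. i \<in> set is \<Longrightarrow> cin i + cout i < disp p (f i)"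
    and s: "successively (\<lambda>i j. gromov p (act (inv f i) p) (act (f j) p) \<le> min (cout i) (cin j)) is"
  shows "length is \<le> disp p (foldr (\<lambda>i g. f i \<otimes> g) is \<one>)"
proof (cases "is")
  case (Cons i js)
  have 1: "f k \<in> carrier G" if "k \<in> set (i # js)" for k using f that Cons by simp
  have 2: "cin k + cout k < disp p (f k)" if "k \<in> set (i # js)" for k using c that Cons by simp
  have 3: "cin i + cout i < disp p (f i)" using 2 by simp
  have "length js + disp p (f i) \<le> disp p (foldr (\<lambda>i g. f i \<otimes> g) (i # js) \<one>) + cout i"
    by (rule conjunct1, rule foldr_strong_local_global[where cin = cin and cout = cout, OF p])
      (use 1 2 s[unfolded Cons] in blast)+
  then show ?thesis using 3 unfolding Cons by simp
qed simp

section \<open>Axes and fixed points of a single isometry\<close>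

lemma axis_pow_nat:
  assumes "g \<in> carrier G" "p \<in> X" "gromov p (act g p) (act (inv g) p) = 0"
  shows "disp p (g [^] (n::nat)) = n * disp p g"
proof (cases "disp p g = 0")
  case True
  then show ?thesis using act_nat_pow_fixed[of g p n] assms d_eq_0[of p "act g p"] by simp
next
  case False
  have *: "disp p (g [^] Suc n) = Suc n * disp p g" for n
  proof (induction n)
    case 0
    then show ?case using assms by simp
  next
    case (Suc n)
    define y where "y = act (g [^] Suc n) p"
    have X: "y \<in> X" "act g p \<in> X" "act (inv g) p \<in> X" using assms by (auto simp: y_def simp del: nat_pow_Suc)
    have "d (act g p) y = d p (act (g [^] n) p)"
      using act_mult[of g "g [^] n" p] nat_pow_Suc2[of g n] assms by (simp add: y_def del: nat_pow_Suc)
    also have "\<dots> = n * disp p g" using Suc.IH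
    proof (cases n)
      case 0
      then show ?thesis using assms by simp
    next
      case (Suc m)
      have "d p y \<le> disp p (g [^] n) + disp p g" "disp p (g [^] n) \<le> n * disp p g"
      proof -
        have "d p y \<le> d p (act (g [^] n) p) + d (act (g [^] n) p) y"
          using d_tri[of p "act (g [^] n) p" y] assms X by simp
        moreover have "d (act (g [^] n) p) y = disp p g"
          using act_mult[of "g [^] n" g p] assms by (simp add: y_def)
        ultimately show "d p y \<le> disp p (g [^] n) + disp p g" by simp
        show "disp p (g [^] n) \<le> n * disp p g" for n
        proof (induction n)
          case (Suc n)
          have "d p (act (g [^] Suc n) p) \<le> d p (act (g [^] n) p) + d (act (g [^] n) p) (act (g [^] Suc n) p)"
            using d_tri[of p "act (g [^] n) p" "act (g [^] Suc n) p"] assms by (simp del: nat_pow_Suc)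
          moreover have "d (act (g [^] n) p) (act (g [^] Suc n) p) = disp p g"
            using act_mult[of "g [^] n" g p] assms by simp
          ultimately show ?case using Suc by simp
        qed (use assms in simp)
      qed
      then show ?thesis using Suc.IH by (simp add: y_def)
    qed
    finally have "2 * gromov p (act g p) y = 2 * disp p g"
      using gromov_eq[of p "act g p" y] assms X Suc.IH by (simp add: y_def)
    \<comment> \<open>The point \<open>y\<close> leaves \<open>p\<close> in the direction of
      \<open>act g p\<close>, hence not in that of \<open>act (inv g) p\<close>.\<close>
    then have "gromov p (act (inv g) p) y = 0"
      using gromov_ultra[of p "act g p" y "act (inv g) p" 1] assms X False gromov_sym[of p y "act (inv g) p"] by (cases "gromov p (act (inv g) p) y") auto
    then have "d (act (inv g) p) y = disp p g + d p y"
      using gromov_eq[of p "act (inv g) p" y] assms X by simp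
    moreover have "disp p (g [^] Suc (Suc n)) = d (act (inv g) p) y"
      using act_mult[of g "g [^] Suc n" p] nat_pow_Suc2[of g "Suc n"] d_act_right[of g p y] assms X
      by (simp add: y_def del: nat_pow_Suc)
    ultimately show ?case using Suc.IH by (simp add: y_def)
  qed
  from *[of "n - 1"] show ?thesis using assms by (cases n) (simp_all del: nat_pow_Suc)
qed

lemma axis_pow:
  assumes "g \<in> carrier G" "p \<in> X" "gromov p (act g p) (act (inv g) p) = 0"
  shows "disp p (g [^] (n::int)) = nat \<bar>n\<bar> * disp p g"
proof (cases "n < 0")
  case True
  then have "disp p (g [^] n) = disp p (g [^] nat (- n))"
    using disp_inv[of "g [^] nat (- n)" p] assms by (simp only: int_pow_def2 if_True nat_pow_closed)
  then show ?thesis using axis_pow_nat[OF assms, of "nat (- n)"] True by simp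
next
  case False
  then have "disp p (g [^] n) = disp p (g [^] nat n)" by (simp only: int_pow_def2 if_False)
  then show ?thesis using axis_pow_nat[OF assms, of "nat n"] False by simp
qed

text \<open>The first half of the path to \<open>act g p\<close> is also the first half of the path
  to \<open>act (inv g) p\<close>, and \<open>g\<close> maps the latter onto the second half of the
  former, reversed. So the midpoint is fixed; for odd displacement the middle edge would be
  inverted.\<close>

lemma elliptic_midpoint:
  assumes "g \<in> carrier G" "p \<in> X" "disp p g \<le> 2 * gromov p (act g p) (act (inv g) p)"
  obtains q where "q \<in> X" "act g q = q" "2 * d p q = disp p g"
proof -
  \<comment> \<open>Rounded up: for odd displacement \<open>z\<close> and \<open>act g z\<close>
    become the two ends of the middle edge.\<close>
  define k where "k = (disp p g + 1) div 2"
  have k: "k \<le> disp p g" "k \<le> gromov p (act g p) (act (inv g) p)" using assms(3) by (simp_all add: k_def)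
  have X: "act g p \<in> X" "act (inv g) p \<in> X" using assms by simp_all
  obtain z where z: "z \<in> X" "btw p z (act g p)" "btw p z (act (inv g) p)" "d p z = k"
    using obtain_common_pt[OF assms(2) X k(2)] .
  have gz: "act g z \<in> X" "d (act g p) (act g z) = k" "btw (act g p) (act g z) p"
    using assms z btw_act[of g p "act (inv g) p" z] by simp_all
  have gz': "btw p (act g z) (act g p)" using btw_symD[OF X(1) assms(2) gz(1,3)] .
  then have dgz: "d p (act g z) = disp p g - k"
    using gz d_sym[of "act g z" "act g p"] assms by (simp add: btw_def)
  show ?thesis
  proof (cases "even (disp p g)")
    case True
    then have "z = act g z"
      using btw_eqI[of p "act g p" "act g p" z "act g z"] assms X z gz gz' dgz gromov_self[of p "act g p"] k
      by (auto simp: k_def)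
    then show ?thesis using that[of z] z True by (simp add: k_def)
  next
    case False
    have "d p (act g z) \<le> gromov p (act g p) (act (inv g) p)" using dgz k by (simp add: k_def)
    then obtain w where w: "w \<in> X" "btw p w (act g p)" "btw p w (act (inv g) p)" "d p w = d p (act g z)"
      using obtain_common_pt[OF assms(2) X] by blast
    have "w = act g z"
      using btw_eqI[of p "act g p" "act g p" w "act g z"] assms X w gz gz' gromov_self[of p "act g p"] dgz by simp
    then have "btw p (act g z) (act (inv g) p)" using w by simp
    then have ggz: "btw (act g p) (act g (act g z)) p" "d (act g p) (act g (act g z)) = disp p g - k"
      using assms gz btw_act[of g p "act (inv g) p" "act g z"] dgz by simp_all
    have ggz': "btw p (act g (act g z)) (act g p)"
      using btw_symD[OF X(1) assms(2) act_closed[OF assms(1) gz(1)] ggz(1)] .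
    then have "d p (act g (act g z)) = k"
      using ggz d_sym[of "act g (act g z)" "act g p"] assms gz k by (simp add: btw_def)
    then have "act g (act g z) = z"
      using btw_eqI[of p "act g p" "act g p" "act g (act g z)" z] assms X z gz ggz' gromov_self[of p "act g p"] k
      by simp
    moreover have "d z (act g z) = 1"
    proof -
      have "btw p (act g z) z"
        using btw_order(1)[of p "act g p" z "act g z"] assms X z gz gz' dgz k by (simp add: k_def)
      then show ?thesis using z dgz gz d_sym[of z "act g z"] k False
        by (simp add: btw_def k_def) presburger
    qed
    ultimately show ?thesis using no_inversion[of g z] assms z by blast
  qed
qed

text \<open>The common first edge is a detour towards the axis or the fixed set of \<open>g\<close>;
  cutting it at both ends saves 2. Displacement 1 cannot occur, since \<open>g\<close> would then
  fix a vertex at distance one half.\<close>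

lemma shift_basepoint:
  assumes "g \<in> carrier G" "p \<in> X" "gromov p (act g p) (act (inv g) p) \<ge> 1"
  obtains q where "q \<in> X" "d p q = 1" "btw p q (act g p)" "btw p q (act (inv g) p)"
    "disp q g + 2 = disp p g"
proof -
  have X: "act g p \<in> X" "act (inv g) p \<in> X" using assms by simp_all
  obtain q where q: "q \<in> X" "btw p q (act g p)" "btw p q (act (inv g) p)" "d p q = 1"
    using obtain_common_pt[OF assms(2) X assms(3)] .
  have gq: "act g q \<in> X" "d (act g p) (act g q) = 1" "btw (act g p) (act g q) p"
    using assms q btw_act[of g p "act (inv g) p" q] by simp_all
  have gq': "btw p (act g q) (act g p)" using btw_symD[OF X(1) assms(2) gq(1,3)] .
  have "disp p g \<noteq> 1"
  proof
    assume 1: "disp p g = 1"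
    then have "disp p g \<le> 2 * gromov p (act g p) (act (inv g) p)" using assms(3) by simp
    from elliptic_midpoint[OF assms(1,2) this] 1 show False
      by (metis One_nat_def even_mult_iff even_numeral odd_one)
  qed
  then have 2: "2 \<le> disp p g" using q by (auto simp: btw_def)
  have dgq: "d p (act g q) = disp p g - 1"
    using gq gq' d_sym[of "act g q" "act g p"] assms by (simp add: btw_def)
  then have "btw p q (act g q)"
    using btw_order(1)[of p "act g p" "act g q" q] assms X q gq gq' 2 by simp
  then have "disp q g + 2 = disp p g" using q dgq 2 by (simp add: btw_def)
  then show ?thesis using that q by blast
qed

text \<open>A point of least displacement lies on the axis, because a doubled first edge could be
  cut off. If \<open>g\<close> is elliptic the point is fixed and both sides are 0.\<close>

lemma obtain_axis:
  assumes "g \<in> carrier G"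
  obtains p where "p \<in> X" "\<And>n::int. disp p (g [^] n) = nat \<bar>n\<bar> * disp p g"
proof -
  obtain p0 where "p0 \<in> X" using X_nonempty by blast
  from ex_has_least_nat[of "\<lambda>p. p \<in> X", OF this, of "\<lambda>p. disp p g"]
  obtain p where p: "p \<in> X" "\<forall>q. q \<in> X \<longrightarrow> disp p g \<le> disp q g" by blast
  have "gromov p (act g p) (act (inv g) p) = 0"
  proof (rule ccontr)
    assume "gromov p (act g p) (act (inv g) p) \<noteq> 0"
    then have "gromov p (act g p) (act (inv g) p) \<ge> 1" by simp
    from shift_basepoint[OF assms p(1) this] obtain q where "q \<in> X" "disp q g + 2 = disp p g" .
    then show False using p(2)[rule_format, of q] by simp
  qed
  from axis_pow[OF assms p(1) this] show ?thesis by (rule that[OF p(1)])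
qed

text \<open>The growth is linear with slope at least 1 on the axis; any other base point costs twice
  its distance from there.\<close>

lemma bounded_disp_pow:
  assumes "g \<in> carrier G" "p \<in> X" "\<And>x. x \<in> X \<Longrightarrow> act g x \<noteq> x"
  shows "\<exists>C. \<forall>n::int. nat \<bar>n\<bar> \<le> disp p (g [^] n) + C"
proof -
  obtain q where q: "q \<in> X" "\<And>n::int. disp q (g [^] n) = nat \<bar>n\<bar> * disp q g"
    by (rule obtain_axis[OF assms(1)]) (rule that)
  have "act g q \<noteq> q" "act g q \<in> X" using assms q(1) by simp_all
  then have "disp q g \<noteq> 0" using d_eq_0[OF q(1), of "act g q"] by metis
  then have "disp q g \<ge> 1" by simp
  have "nat \<bar>n\<bar> \<le> disp p (g [^] n) + 2 * d p q" for n :: int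
  proof -
    have X: "act (g [^] n) q \<in> X" "act (g [^] n) p \<in> X" using q assms by simp_all
    have "nat \<bar>n\<bar> \<le> disp q (g [^] n)" using q(2)[of n] \<open>disp q g \<ge> 1\<close> by simp
    moreover have "disp q (g [^] n) \<le> d q p + d p (act (g [^] n) q)"
      using d_tri[OF q(1) assms(2) X(1)] .
    moreover have "d p (act (g [^] n) q) \<le> disp p (g [^] n) + d (act (g [^] n) p) (act (g [^] n) q)"
      using d_tri[OF assms(2) X(2) X(1)] .
    moreover have "d (act (g [^] n) p) (act (g [^] n) q) = d p q" using assms q by simp
    ultimately show ?thesis using d_sym[OF assms(2) q(1)] by linarith
  qed
  then show ?thesis by blast
qed

end

section \<open>Bounds for a fixed pair\<close>

text \<open>Cuts a word into blocks \<open>a^n b^m\<close>. The exponent 0 marks a missing initial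
  power of \<open>a\<close>; a final power of \<open>a\<close> is dropped, because it fixes the base
  point.\<close>

fun b_steps :: "(bool \<times> int) list \<Rightarrow> (int \<times> int) list" where
  "b_steps [] = []"
| "b_steps [(True, n)] = []"
| "b_steps ((True, n) # (y, m) # s) = (n, m) # b_steps s"
| "b_steps ((False, m) # s) = (0, m) # b_steps s"

lemma hd_b_steps: "\<lbrakk>alternating s; fst (hd s); b_steps s \<noteq> []\<rbrakk> \<Longrightarrow> fst (hd (b_steps s)) \<noteq> 0"
  by (cases s rule: b_steps.cases) (auto simp: alternating_Cons)

lemma b_steps_alternating:
  "alternating s \<Longrightarrow> successively (\<lambda>i j. fst j \<noteq> 0) (b_steps s) \<and> (\<forall>q\<in>set (b_steps s). snd q \<noteq> 0)"
proof (induction s rule: b_steps.induct)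
  case (3 n y m s)
  then have s: "alternating s" "b_steps s \<noteq> [] \<Longrightarrow> fst (hd s)" "m \<noteq> 0" by (auto simp: alternating_Cons)
  then show ?case using 3(1) hd_b_steps[OF s(1)] by (cases "b_steps s = []") (auto simp: successively_Cons)
next
  case (4 m s)
  then have s: "alternating s" "b_steps s \<noteq> [] \<Longrightarrow> fst (hd s)" "m \<noteq> 0" by (auto simp: alternating_Cons)
  then show ?case using 4(1) hd_b_steps[OF s(1)] by (cases "b_steps s = []") (auto simp: successively_Cons)
qed auto

lemma length_b_steps: "length s \<le> 2 * length (b_steps s) + 1"
  by (induction s rule: b_steps.induct) auto

definition flip :: "bool \<times> 'c \<Rightarrow> bool \<times> 'c" where
  "flip q = (\<not> fst q, snd q)"

lemma (in group) letter_val_flip: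
  "\<lbrakk>a \<in> carrier G; b \<in> carrier G\<rbrakk> \<Longrightarrow> letter_val a b (flip q) = inv (letter_val a b q)"
  by (simp add: letter_val_def flip_def)

context tree_action
begin

definition commuting_stabs :: "'a set \<Rightarrow> bool" where
  "commuting_stabs H \<longleftrightarrow>
    (\<forall>g\<in>H. \<forall>h\<in>H. \<forall>x\<in>X. act (g \<otimes> h) x = act (h \<otimes> g) x \<longrightarrow> g \<otimes> h = h \<otimes> g)"

definition root_closed_stabs :: "'a set \<Rightarrow> bool" where
  "root_closed_stabs H \<longleftrightarrow>
    (\<forall>g\<in>H. \<forall>x\<in>X. \<forall>n::int. n \<noteq> 0 \<longrightarrow> act (g [^] n) x = x \<longrightarrow> act g x = x)"

lemma commuting_stabsD:
  "\<lbrakk>commuting_stabs H; g \<in> H; h \<in> H; x \<in> X; act (g \<otimes> h) x = act (h \<otimes> g) x\<rbrakk> \<Longrightarrow> g \<otimes> h = h \<otimes> g"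
  unfolding commuting_stabs_def by blast

lemma root_closed_stabsD:
  "\<lbrakk>root_closed_stabs H; g \<in> H; x \<in> X; n \<noteq> 0; act (g [^] (n::int)) x = x\<rbrakk> \<Longrightarrow> act g x = x"
  unfolding root_closed_stabs_def by blast

lemma d_act_fixed:
  assumes "a \<in> carrier G" "p \<in> X" "y \<in> X" "act a p = p"
  shows "d p (act a y) = d p y"
  using d_act[OF assms(1-3)] assms(4) by simp

lemma act_syllable_prod_b_steps:
  assumes "a \<in> carrier G" "b \<in> carrier G" "p \<in> X" "act a p = p" "alternating s"
  shows "act (syllable_prod a b s) p = act (foldr (\<lambda>q g. (a [^] fst q \<otimes> b [^] snd q) \<otimes> g) (b_steps s) \<one>) p"
  using assms(5)
proof (induction s rule: b_steps.induct)
  case (2 n)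
  then show ?case using act_int_pow_fixed[OF assms(1,3,4)] assms by simp
next
  case (3 n y m s)
  have "\<not> y" "alternating s" using 3(2) by (auto simp: alternating_Cons)
  moreover have "foldr (\<lambda>q g. (a [^] fst q \<otimes> b [^] snd q) \<otimes> g) (b_steps s) \<one> \<in> carrier G"
    using foldr_mult_foldr[of "b_steps s" "\<lambda>q. a [^] fst q \<otimes> b [^] snd q" \<one>] assms by simp
  ultimately show ?case using 3(1) assms by (simp add: m_assoc[symmetric]) (simp add: act_mult)
next
  case (4 m s)
  have "alternating s" using 4(2) by (auto simp: alternating_Cons)
  moreover have "foldr (\<lambda>q g. (a [^] fst q \<otimes> b [^] snd q) \<otimes> g) (b_steps s) \<one> \<in> carrier G"
    using foldr_mult_foldr[of "b_steps s" "\<lambda>q. a [^] fst q \<otimes> b [^] snd q" \<one>] assms by simp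
  ultimately show ?case using 4(1) assms by (simp add: act_mult)
qed simp

text \<open>As \<open>a\<close> fixes \<open>p\<close>, a block \<open>a^n b^m\<close> moves
  \<open>p\<close> as far as \<open>b^m\<close> does, and the local-to-global lemma applies to
  blocks. The reserve \<open>E\<close> may depend on the sign of the exponent, because positive and
  negative powers of \<open>b\<close> may leave \<open>p\<close> in different directions. A block
  has at most two syllables and one power of \<open>a\<close> may be left over; this gives the
  constants.\<close>

lemma syllable_bound:
  assumes ab: "a \<in> carrier G" "b \<in> carrier G" and p: "p \<in> X" "act a p = p"
    and E: "\<And>m::int. m \<noteq> 0 \<Longrightarrow> E True + E False < disp p (b [^] m)"
    and gromov: "\<And>(m::int) (m'::int) (n::int). \<lbrakk>m \<noteq> 0; m' \<noteq> 0; n \<noteq> 0\<rbrakk> \<Longrightarrow>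
      gromov p (act (b [^] m) p) (act (a [^] n) (act (b [^] m') p)) \<le> min (E (m > 0)) (E (m' > 0))"
    and s: "alternating s"
  shows "length s \<le> 2 * disp p (syllable_prod a b s) + 1"
proof -
  define f where "f = (\<lambda>q :: int \<times> int. a [^] fst q \<otimes> b [^] snd q)"
  define cin where "cin = (\<lambda>q :: int \<times> int. E (snd q > 0))"
  \<comment> \<open>Seen from its far end, a block starts with the opposite power of
    \<open>b\<close>.\<close>
  define cout where "cout = (\<lambda>q :: int \<times> int. E (\<not> snd q > 0))"
  have f: "f q \<in> carrier G" for q using ab by (simp add: f_def)
  have bs: "successively (\<lambda>i j. fst j \<noteq> 0) (b_steps s)" "\<And>q. q \<in> set (b_steps s) \<Longrightarrow> snd q \<noteq> 0"
    using b_steps_alternating[OF s] by blast+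
  have fp: "act (f q) p = act (a [^] fst q) (act (b [^] snd q) p)" for q
    using ab p(1) by (simp add: f_def act_mult)
  have invfp: "act (inv (f q)) p = act (b [^] (- snd q)) p" for q
    using ab p act_int_pow_fixed[OF ab(1) p, of "- fst q"]
    by (simp add: f_def inv_mult_group act_mult int_pow_neg)
  have "length (b_steps s) \<le> disp p (foldr (\<lambda>q g. f q \<otimes> g) (b_steps s) \<one>)"
  proof (rule foldr_local_global[where cin = cin and cout = cout, OF p(1)])
    show "f q \<in> carrier G" for q by fact
    show "cin q + cout q < disp p (f q)" if "q \<in> set (b_steps s)" for q
    proof -
      have "disp p (f q) = disp p (b [^] snd q)"
        using d_act_fixed[of "a [^] fst q" p "act (b [^] snd q) p"] act_int_pow_fixed[OF ab(1) p] ab p fp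
        by simp
      then show ?thesis using E[OF bs(2)[OF that]] by (cases "0 < snd q") (simp_all add: cin_def cout_def)
    qed
    show "successively (\<lambda>i j. gromov p (act (inv f i) p) (act (f j) p) \<le> min (cout i) (cin j)) (b_steps s)"
    proof (rule successively_mono[OF bs(1)])
      fix i j :: "int \<times> int" assume ij: "i \<in> set (b_steps s)" "j \<in> set (b_steps s)" "fst j \<noteq> 0"
      have "snd i \<noteq> 0" "snd j \<noteq> 0" using bs(2) ij by blast+
      moreover from this have "(- snd i > 0) = (\<not> snd i > 0)" by linarith
      ultimately show "gromov p (act (inv f i) p) (act (f j) p) \<le> min (cout i) (cin j)"
        using gromov[of "- snd i" "snd j" "fst j"] ij by (simp add: fp invfp cin_def cout_def)
    qed
  qed
  then show ?thesis
    using length_b_steps[of s] act_syllable_prod_b_steps[OF ab p s] by (simp add: f_def)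
qed

lemma fixed_initial:
  assumes "a \<in> carrier G" "p \<in> X" "act a p = p" "x \<in> X" "z \<in> X" "btw p z x" "d p z \<le> gromov p x (act a x)"
  shows "act a z = z"
proof -
  have "btw p (act a z) (act a x)" using btw_act[of a p x z] assms by simp
  moreover have "d p (act a z) = d p z" using d_act_fixed assms by blast
  ultimately show ?thesis using btw_eqI[of p x "act a x" z "act a z"] assms by simp
qed

lemma fixed_initial_gromov:
  assumes "a \<in> carrier G" "p \<in> X" "act a p = p" "x \<in> X" "z \<in> X" "btw p z x" "act a z = z"
  shows "d p z \<le> gromov p x (act a x)"
proof -
  have "btw p z (act a x)" using btw_act[of a p x z] assms by simp
  then show ?thesis using btw_both_gromov[of p x "act a x" z] assms by simp
qed

text \<open>The overlap of a path with its image under an isometry fixing its start is the initial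
  part fixed pointwise, and with root closed stabilizers \<open>a^n\<close> fixes no more of it than
  \<open>a\<close>.\<close>

lemma gromov_pow_fixed:
  assumes "root_closed_stabs H" "a \<in> H" "a \<in> carrier G" "p \<in> X" "act a p = p" "x \<in> X" "n \<noteq> 0"
  shows "gromov p x (act (a [^] (n::int)) x) \<le> gromov p x (act a x)"
proof -
  have X: "act (a [^] n) x \<in> X" using assms by simp
  obtain z where z: "z \<in> X" "btw p z x" "btw p z (act (a [^] n) x)" "d p z = gromov p x (act (a [^] n) x)"
    using obtain_common_pt[OF assms(4,6) X order_refl] .
  have "act (a [^] n) z = z"
    using fixed_initial[of "a [^] n" p x z] act_int_pow_fixed[OF assms(3-5)] assms z by simp
  then have "act a z = z" using root_closed_stabsD assms(1,2,7) z(1) by blast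
  then show ?thesis using fixed_initial_gromov[of a p x z] assms z by simp
qed

text \<open>If \<open>b\<close> fixes a point \<open>q\<close>, then \<open>p\<close> and its image
  under \<open>b^n\<close> are equally far from \<open>q\<close>, so the path between them starts
  towards \<open>q\<close>. Otherwise the cancellation at each corner is less than half of
  \<open>disp p b\<close>, and the path through the iterates keeps its first edge.\<close>

lemma gromov_pow_same_direction:
  assumes "b \<in> carrier G" "p \<in> X" "1 \<le> gromov p (act b p) (act (inv b) p)" "(n::nat) \<noteq> 0"
    "\<And>n::int. n \<noteq> 0 \<Longrightarrow> act (b [^] n) p \<noteq> p"
  shows "1 \<le> gromov p (act b p) (act (b [^] n) p)"
proof (cases "disp p b \<le> 2 * gromov p (act b p) (act (inv b) p)")
  case True
  obtain q where q: "q \<in> X" "act b q = q" using elliptic_midpoint[OF assms(1,2) True] .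
  have *: "1 \<le> gromov p (act (b [^] n) p) q" if "n \<noteq> 0" for n :: nat
  proof -
    have X: "act (b [^] n) p \<in> X" using assms by simp
    have "d (act (b [^] n) p) q = d p q"
      using d_act[of "b [^] n" p q] act_nat_pow_fixed[OF assms(1) q, of n] assms q by simp
    then have "2 * gromov p (act (b [^] n) p) q = disp p (b [^] n)"
      using gromov_eq[OF assms(2) X q(1)] by simp
    moreover have "act (b [^] n) p \<noteq> p" using assms(5)[of "int n"] that by (simp add: int_pow_int)
    then have "disp p (b [^] n) \<noteq> 0" using d_eq_0[OF assms(2) X] by metis
    ultimately show ?thesis by linarith
  qed
  have X: "act b p \<in> X" "act (b [^] n) p \<in> X" using assms by simp_all
  have "1 \<le> gromov p (act b p) q" using *[of 1] assms by simp
  moreover have "1 \<le> gromov p q (act (b [^] n) p)" using *[OF assms(4)] gromov_sym[OF assms(2) X(2) q(1)] by simp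
  ultimately show ?thesis using gromov_ultra[OF assms(2) X(1) q(1) X(2)] by blast
next
  case False
  define c where "c = gromov p (act b p) (act (inv b) p)"
  have X: "act b p \<in> X" "act (inv b) p \<in> X" using assms by simp_all
  obtain m where m: "n = Suc m" using assms(4) by (cases n) auto
  have "length (replicate m ()) + disp p b \<le> disp p (foldr (\<lambda>i g. b \<otimes> g) (() # replicate m ()) \<one>) + c \<and>
    disp p b \<le> gromov p (act b p) (act (foldr (\<lambda>i g. b \<otimes> g) (() # replicate m ()) \<one>) p) + c"
  proof (rule foldr_strong_local_global[where f = "\<lambda>_::unit. b" and cin = "\<lambda>_. c" and cout = "\<lambda>_. c", OF assms(2)])
    show "successively (\<lambda>i j::unit. gromov p (act (inv b) p) (act b p) \<le> min c c) (() # replicate m ())"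
      using successively_replicate[of "\<lambda>i j::unit. gromov p (act (inv b) p) (act b p) \<le> min c c" "()" "Suc m"]
        gromov_sym[OF assms(2) X] by (simp add: c_def)
  qed (use assms False in \<open>simp_all add: c_def\<close>)
  moreover have "foldr (\<lambda>i g. b \<otimes> g) (() # replicate m ()) \<one> = b [^] n"
    using foldr_replicate_pow[of "\<lambda>_::unit. b" "()" n] assms(1) m by simp
  ultimately show ?thesis using False by (simp add: c_def)
qed

text \<open>Here the path from \<open>p\<close> to the axis or fixed set of \<open>b\<close> starts
  with an edge to \<open>q\<close>. Moving the base point to \<open>q\<close> saves 2 for
  \<open>b\<close>, so by minimality \<open>a\<close> moves \<open>q\<close>, and so does every
  nontrivial power of \<open>a\<close>. All powers of \<open>b\<close> leave \<open>p\<close>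
  through \<open>q\<close>; after a power of \<open>a\<close> they leave through another vertex, and
  nothing cancels.\<close>

lemma bridge_bound:
  assumes H: "subgroup H G" and rc: "root_closed_stabs H" and ab: "a \<in> H" "b \<in> H"
    and p: "p \<in> X" "act a p = p" and b1: "1 \<le> gromov p (act b p) (act (inv b) p)"
    and minimal: "\<And>q. q \<in> X \<Longrightarrow> disp p b \<le> disp q a + disp q b"
    and s: "alternating s"
  shows "length s \<le> 2 * disp p (syllable_prod a b s) + 1"
proof -
  have c: "a \<in> carrier G" "b \<in> carrier G" using subgroup.mem_carrier[OF H] ab by blast+
  have Xb: "act (b [^] (n::int)) p \<in> X" "act (a [^] n) p \<in> X" for n using c p by simp_all
  have X1: "act b p \<in> X" "act (inv b) p \<in> X" using c p by simp_all
  obtain q where q: "q \<in> X" "d p q = 1" "btw p q (act b p)" "btw p q (act (inv b) p)"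
    "disp q b + 2 = disp p b" using shift_basepoint[OF c(2) p(1) b1] .
  have aq: "act a q \<noteq> q" using minimal[OF q(1)] q by auto
  have bp: "act (b [^] n) p \<noteq> p" if "n \<noteq> 0" for n :: int
  proof
    assume "act (b [^] n) p = p"
    then have "act b p = p" using root_closed_stabsD[OF rc ab(2) p(1) that] by blast
    then show False using q p by (simp add: btw_def)
  qed
  have inv_pow: "inv b [^] nat (- n) = b [^] n" if "n < 0" for n :: int
    using that c int_pow_def2[of G b n] nat_pow_inv[of b "nat (- n)"] by (simp del: pow_nat)
  have dir: "btw p q (act (b [^] n) p)" if n: "n \<noteq> 0" for n :: int
  proof -
    have "\<exists>b'\<in>{b, inv b}. 1 \<le> gromov p (act b' p) (act (b [^] n) p)"
    proof (cases "n < 0")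
      case True
      have "1 \<le> gromov p (act (inv b) p) (act (inv b [^] nat (- n)) p)"
      proof (rule gromov_pow_same_direction)
        show "act (inv b [^] m) p \<noteq> p" if "m \<noteq> 0" for m :: int
          using bp[of "- m"] that c by (simp add: int_pow_inv int_pow_neg)
        show "1 \<le> gromov p (act (inv b) p) (act (inv (inv b)) p)" using b1 gromov_sym[OF p(1) X1] c by simp
      qed (use c p True in simp_all)
      then show ?thesis using inv_pow[OF True] by simp
    next
      case False
      have "1 \<le> gromov p (act b p) (act (b [^] nat n) p)"
        by (rule gromov_pow_same_direction[OF c(2) p(1) b1 _ bp]) (use False n in simp_all)
      then show ?thesis using False by simp
    qed
    then obtain b' where b': "b' \<in> {b, inv b}" "1 \<le> gromov p (act b' p) (act (b [^] n) p)" by blast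
    have X': "act b' p \<in> X" using b' X1 by blast
    obtain z where z: "z \<in> X" "btw p z (act b' p)" "btw p z (act (b [^] n) p)" "d p z = 1"
      using obtain_common_pt[OF p(1) X' Xb(1) b'(2)] .
    have "btw p q (act b' p)" using b' q by blast
    then have "z = q" using btw_eqI[OF p(1) X' X' z(1) q(1) z(2)] z(4) q(2) gromov_self[OF p(1) X'] gromov_le1[OF p(1) X' Xb(1)[of n]] b'(2) by simp
    then show ?thesis using z by simp
  qed
  show ?thesis
  proof (rule syllable_bound[where E = "\<lambda>_. 0", OF c p _ _ s])
    show "0 + 0 < disp p (b [^] m)" if "m \<noteq> 0" for m :: int
      using bp[OF that] d_eq_0[OF p(1) Xb(1)[of m]] by auto
    show "gromov p (act (b [^] m) p) (act (a [^] n) (act (b [^] m') p)) \<le> min 0 0"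
      if m: "m \<noteq> 0" "m' \<noteq> 0" "n \<noteq> 0" for m m' n :: int
    proof (rule ccontr)
      define y where "y = act (a [^] n) (act (b [^] m') p)"
      have y: "y \<in> X" using c p by (simp add: y_def)
      assume "\<not> ?thesis"
      then have y1: "1 \<le> gromov p (act (b [^] m) p) y" by (simp add: y_def)
      have an: "act (a [^] n) p = p" using act_int_pow_fixed[OF c(1) p] .
      have b1: "btw p (act (a [^] n) q) y"
        using btw_act[of "a [^] n" p "act (b [^] m') p" q] dir[OF m(2)] c p q an Xb by (simp add: y_def)
      have d1: "d p q = d p (act (a [^] n) q)" using d_act_fixed[of "a [^] n" p q] an c p q by simp
      have X2: "act (a [^] n) q \<in> X" using c q by simp
      have "q = act (a [^] n) q"
        by (rule btw_eqI[OF p(1) Xb(1) y q(1) X2 dir[OF m(1)] b1 d1]) (use y1 q(2) in simp)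
      from root_closed_stabsD[OF rc ab(1) q(1) m(3) this[symmetric]] have "act a q = q" .
      then show False using aq by blast
    qed
  qed
qed

text \<open>Here \<open>p\<close> lies on the axis of \<open>b\<close>, and \<open>E\<close>
  measures how far \<open>a\<close> fixes the axis in either direction. If these two lengths filled
  a period, some \<open>y\<close> and \<open>act b y\<close> would both be fixed by
  \<open>a\<close>, the commutator would fix a point, and \<open>a\<close> and \<open>b\<close>
  would commute. By \<open>turn\<close> no power of \<open>a\<close> carries one direction of the
  axis into the other.\<close>

lemma axis_bound:
  assumes H: "subgroup H G" and rc: "root_closed_stabs H" and cs: "commuting_stabs H"
    and ab: "a \<in> H" "b \<in> H" "a \<otimes> b \<noteq> b \<otimes> a"
    and p: "p \<in> X" "act a p = p" and b0: "gromov p (act b p) (act (inv b) p) = 0"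
    and turn: "\<And>n::int. gromov p (act (a [^] n) (act b p)) (act (inv b) p) = 0"
    and s: "alternating s"
  shows "length s \<le> 2 * disp p (syllable_prod a b s) + 1"
proof -
  have c: "a \<in> carrier G" "b \<in> carrier G" using subgroup.mem_carrier[OF H] ab by blast+
  have Xb: "act (b [^] (n::int)) p \<in> X" for n using c p by simp
  have X1: "act b p \<in> X" "act (inv b) p \<in> X" "act a (act b p) \<in> X" "act a (act (inv b) p) \<in> X"
    using c p by simp_all
  have an: "act (a [^] n) p = p" for n :: int using act_int_pow_fixed[OF c(1) p] .
  define sg where "sg = (\<lambda>e. if e then b else inv b)"
  define E where "E = (\<lambda>e. gromov p (act (sg e) p) (act a (act (sg e) p)))"
  have sg: "sg e \<in> carrier G" "act (sg e) p \<in> X" "disp p (sg e) = disp p b" for e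
    using c p by (simp_all add: sg_def)
  have E_le: "E e \<le> disp p b" for e
    using gromov_le1[OF p(1) sg(2), of "act a (act (sg e) p)" e] sg c p by (simp add: E_def)
  have fixE: "act a z = z" if "z \<in> X" "btw p z (act (sg e) p)" "d p z \<le> E e" for z e
    using fixed_initial[OF c(1) p sg(2) that(1,2)] that(3) by (simp add: E_def)
  have E_sum: "E True + E False < disp p b"
  proof (rule ccontr)
    assume "\<not> E True + E False < disp p b"
    then have *: "disp p b - E True \<le> E False" by simp
    define k where "k = disp p b - E True"
    have "k \<le> d p (act (inv b) p)" using disp_inv[OF c(2) p(1)] by (simp add: k_def)
    then obtain y where y: "y \<in> X" "btw p y (act (inv b) p)" "d p y = k"
      using obtain_pt[OF p(1) X1(2)] by blast
    have ay: "act a y = y" using fixE[of y False] y * by (simp add: sg_def k_def)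
    have by_: "act b y \<in> X" "d (act b p) (act b y) = k" "btw (act b p) (act b y) p"
      using btw_act[of b p "act (inv b) p" y] c p y by simp_all
    have by': "btw p (act b y) (act b p)" using btw_symD[OF X1(1) p(1) by_(1,3)] .
    then have "d p (act b y) = E True"
      using by_(2) d_sym[OF by_(1) X1(1)] E_le[of True] by (simp add: btw_def k_def)
    then have "act a (act b y) = act b y" using fixE[of "act b y" True] by_ by' by (simp add: sg_def)
    then have "act (a \<otimes> b) y = act (b \<otimes> a) y" using ay c y by (simp add: act_mult)
    then show False using commuting_stabsD[OF cs ab(1,2) y(1)] ab(3) by blast
  qed
  have pos: "0 < disp p b" using E_sum by simp
  have bpow: "disp p (b [^] n) = nat \<bar>n\<bar> * disp p b" for n :: int
    using axis_pow[OF c(2) p(1) b0] .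
  have same: "gromov p (act (sg (n > 0)) p) (act (b [^] n) p) = disp p b" if "n \<noteq> 0" for n :: int
  proof -
    define t where "t = (if n > 0 then 1 else -1 :: int)"
    have sgt: "sg (n > 0) = b [^] t" using c by (simp add: sg_def t_def int_pow_neg)
    have "b [^] n = b [^] t \<otimes> b [^] (n - t)" using c by (simp add: int_pow_mult[symmetric])
    then have "d (act (b [^] t) p) (act (b [^] n) p) = disp p (b [^] (n - t))"
      using c p by (simp add: act_mult)
    also have "\<dots> = (nat \<bar>n\<bar> - 1) * disp p b"
    proof -
      have "nat \<bar>n - t\<bar> = nat \<bar>n\<bar> - 1" using that by (auto simp: t_def)
      then show ?thesis using bpow by simp
    qed
    finally have "2 * gromov p (act (b [^] t) p) (act (b [^] n) p) + (nat \<bar>n\<bar> - 1) * disp p b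
        = disp p b + nat \<bar>n\<bar> * disp p b"
      using gromov_eq[OF p(1) Xb[of t] Xb[of n]] bpow[of t] bpow[of n] by (simp add: t_def split: if_splits)
    moreover have "nat \<bar>n\<bar> * disp p b = (nat \<bar>n\<bar> - 1) * disp p b + disp p b"
      using that by (cases "nat \<bar>n\<bar>") auto
    ultimately show ?thesis by (simp add: sgt)
  qed
  show ?thesis
  proof (rule syllable_bound[where E = E, OF c p _ _ s])
    show "E True + E False < disp p (b [^] m)" if "m \<noteq> 0" for m :: int
    proof -
      have "disp p b \<le> nat \<bar>m\<bar> * disp p b" using that by (cases "nat \<bar>m\<bar>") auto
      from less_le_trans[OF E_sum this] show ?thesis by (simp only: bpow)
    qed
    fix m m' n :: int assume m: "m \<noteq> 0" "m' \<noteq> 0" "n \<noteq> 0"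
    define u where "u = act (b [^] m) p"
    define w where "w = act (a [^] n) (act (b [^] m') p)"
    define u1 where "u1 = act (sg (m > 0)) p"
    define w1 where "w1 = act (a [^] n) (act (sg (m' > 0)) p)"
    have X: "u \<in> X" "w \<in> X" "u1 \<in> X" "w1 \<in> X" using c p sg by (simp_all add: u_def w_def u1_def w1_def)
    have uu: "gromov p u1 u = disp p b" using same[OF m(1)] by (simp add: u_def u1_def)
    have ww: "gromov p w w1 = disp p b"
      using same[OF m(2)] gromov_act[of "a [^] n" p "act (sg (m' > 0)) p" "act (b [^] m') p"] an c p sg Xb
        gromov_sym[OF p(1) X(2,4)] by (simp add: w_def w1_def)
    \<comment> \<open>Replacing powers of \<open>b\<close> by \<open>b\<close> or its inverse loses
      nothing up to distance \<open>disp p b\<close>, because the powers continue along the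
      axis.\<close>
    have up: "k \<le> gromov p u1 w1" if "k \<le> disp p b" "k \<le> gromov p u w" for k
      using gromov_ultra[OF p(1) X(3,1,2), of k] gromov_ultra[OF p(1) X(3,2,4), of k] that uu ww by simp
    show "gromov p (act (b [^] m) p) (act (a [^] n) (act (b [^] m') p)) \<le> min (E (m > 0)) (E (m' > 0))"
    proof (cases "(m > 0) = (m' > 0)")
      case True
      have "gromov p u1 w1 \<le> E (m > 0)"
        using gromov_pow_fixed[OF rc ab(1) c(1) p sg(2) m(3)] True by (simp add: u1_def w1_def E_def)
      moreover have "E (m > 0) < disp p b" using E_sum by (cases "m > 0") auto
      ultimately have "gromov p u w \<le> E (m > 0)" using up[of "E (m > 0) + 1"] by (cases "gromov p u w \<le> E (m > 0)") auto
      then show ?thesis using True by (simp add: u_def w_def)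
    next
      case False
      have "gromov p u1 w1 = 0"
      proof (cases "m > 0")
        case True
        then have "u1 = act b p" "w1 = act (a [^] n) (act (inv b) p)" using False by (simp_all add: u1_def w1_def sg_def)
        moreover have "gromov p (act (a [^] (- n)) (act b p)) (act (inv b) p)
            = gromov p (act b p) (act (a [^] n) (act (inv b) p))"
          using gromov_act[of "a [^] n" p "act (a [^] (- n)) (act b p)" "act (inv b) p"] an c p X1
          by (simp add: int_pow_neg)
        ultimately show ?thesis using turn[of "- n"] by simp
      next
        case False
        then have "u1 = act (inv b) p" "w1 = act (a [^] n) (act b p)"
          using \<open>(m > 0) \<noteq> (m' > 0)\<close> by (simp_all add: u1_def w1_def sg_def)
        then show ?thesis using turn[of n] gromov_sym[OF p(1) X(3,4)] gromov_sym[OF p(1) X(4,3)] by simp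
      qed
      then have "gromov p u w = 0" using up[of 1] pos by (cases "gromov p u w") auto
      then show ?thesis by (simp add: u_def w_def)
    qed
  qed
qed

text \<open>A reduced word only meets overlaps of different letters, seen from a common base point.
  If the largest overlaps at the two ends of a letter never fill that letter, the local-to-global
  lemma applies letter by letter.\<close>

lemma reduced_bound:
  assumes ab: "a \<in> carrier G" "b \<in> carrier G" and p: "p \<in> X"
    and K: "\<And>y z z'. \<lbrakk>z \<noteq> y; z' \<noteq> flip y\<rbrakk> \<Longrightarrow>
      gromov p (act (letter_val a b z) p) (act (letter_val a b y) p) +
      gromov p (act (letter_val a b z') p) (act (letter_val a b (flip y)) p) < disp p (letter_val a b y)"
    and s: "alternating s"
  shows "exponent_length s \<le> disp p (syllable_prod a b s)"
proof -
  let ?v = "letter_val a b"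
  define cin where "cin = (\<lambda>y. Max ((\<lambda>z. gromov p (act (?v z) p) (act (?v y) p)) ` (- {y})))"
  have cin: "gromov p (act (?v z) p) (act (?v y) p) \<le> cin y" if "z \<noteq> y" for y z
    unfolding cin_def by (rule Max_ge) (use that in auto)
  have ne: "- {y} \<noteq> {}" for y :: "bool \<times> bool"
  proof -
    have "flip y \<in> - {y}" by (cases y) (simp add: flip_def)
    then show ?thesis by blast
  qed
  have cin_ex: "\<exists>z. z \<noteq> y \<and> cin y = gromov p (act (?v z) p) (act (?v y) p)" for y
  proof -
    have "cin y \<in> (\<lambda>z. gromov p (act (?v z) p) (act (?v y) p)) ` (- {y})"
      unfolding cin_def by (rule Max_in) (use ne[of y] in auto)
    then show ?thesis by auto
  qed
  have "length (letters s) \<le> disp p (foldr (\<lambda>i h. ?v i \<otimes> h) (letters s) \<one>)"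
  proof (rule foldr_local_global[where cin = cin and cout = "\<lambda>y. cin (flip y)", OF p])
    show "?v i \<in> carrier G" for i using ab by simp
    show "cin y + cin (flip y) < disp p (?v y)" for y
    proof -
      obtain z z' where "z \<noteq> y" "cin y = gromov p (act (?v z) p) (act (?v y) p)"
        "z' \<noteq> flip y" "cin (flip y) = gromov p (act (?v z') p) (act (?v (flip y)) p)"
        using cin_ex[of y] cin_ex[of "flip y"] by blast
      then show ?thesis using K[of z y z'] by simp
    qed
    show "successively (\<lambda>i j. gromov p (act (inv ?v i) p) (act (?v j) p) \<le> min (cin (flip i)) (cin j)) (letters s)"
    proof (rule successively_mono[OF letters_reduced[OF s]])
      fix i j :: "bool \<times> bool" assume "j \<noteq> (\<not> fst i, snd i)"
      then have ne: "j \<noteq> flip i" by (simp add: flip_def)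
      have X: "act (?v (flip i)) p \<in> X" "act (?v j) p \<in> X" using ab p by simp_all
      show "gromov p (act (inv ?v i) p) (act (?v j) p) \<le> min (cin (flip i)) (cin j)"
        using cin[of "flip i" j] cin[of j "flip i"] ne gromov_sym[OF p X] letter_val_flip[OF ab, of i] by simp
    qed
  qed
  then show ?thesis using foldr_letters[OF ab] by (simp add: length_letters)
qed

end

section \<open>Minimal pairs\<close>

context tree_action
begin

text \<open>Passing from \<open>y\<close> to \<open>inv x \<otimes> y\<close> removes the overlap
  with \<open>x\<close> and adds the rest of \<open>x\<close>. If this does not shorten
  \<open>y\<close>, the overlap is at most half of \<open>x\<close>.\<close>

lemma mixed_gromov_le:
  assumes "x \<in> carrier G" "y \<in> carrier G" "p \<in> X" "disp p y \<le> disp p (inv x \<otimes> y)"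
  shows "2 * gromov p (act x p) (act y p) \<le> disp p x"
proof -
  have "d (act x p) (act y p) = disp p (inv x \<otimes> y)"
    using d_act_left[of x p "act y p"] assms by (simp add: act_mult)
  then show ?thesis using gromov_eq[of p "act x p" "act y p"] assms by simp
qed

text \<open>An overlap of exactly half of \<open>x\<close> makes the move
  \<open>inv x \<otimes> y\<close> neutral at \<open>p\<close>. If it occurs at both ends, the
  midpoint \<open>q\<close> of the path to \<open>act (inv x) p\<close> is a better base point:
  there the move saves the whole length of \<open>x\<close>, and \<open>x\<close> itself does not
  grow.\<close>

lemma overlap_reduces:
  assumes c: "x \<in> carrier G" "y \<in> carrier G" and p: "p \<in> X"
    and eq: "2 * gromov p (act x p) (act y p) = disp p x" "2 * gromov p (act (inv x) p) (act (inv y) p) = disp p x"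
    and le: "disp p x \<le> disp p y"
  shows "\<exists>q\<in>X. disp q x \<le> disp p x \<and> disp q (inv x \<otimes> y) + disp p x \<le> disp p y"
proof -
  define r where "r = gromov p (act (inv x) p) (act (inv y) p)"
  have r: "2 * r = disp p x" using eq(2) by (simp add: r_def)
  have X: "act x p \<in> X" "act y p \<in> X" "act (inv x) p \<in> X" "act (inv y) p \<in> X" using c p by simp_all
  obtain q where q: "q \<in> X" "btw p q (act (inv x) p)" "btw p q (act (inv y) p)" "d p q = r"
    using obtain_common_pt[OF p X(3,4), of r] by (auto simp: r_def)
  have xq: "act x q \<in> X" "d (act x p) (act x q) = r" "btw (act x p) (act x q) p"
    using btw_act[of x p "act (inv x) p" q] c p q by simp_all
  have yq: "act y q \<in> X" "d (act y p) (act y q) = r" "btw (act y p) (act y q) p"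
    using btw_act[of y p "act (inv y) p" q] c p q by simp_all
  have xq': "btw p (act x q) (act x p)" using btw_symD[OF X(1) p xq(1,3)] .
  have yq': "btw p (act y q) (act y p)" using btw_symD[OF X(2) p yq(1,3)] .
  have dx: "d p (act x q) = r" using xq' xq(2) d_sym[OF xq(1) X(1)] r by (simp add: btw_def)
  have dy: "d p (act y q) + r = disp p y" using yq' yq(2) d_sym[OF yq(1) X(2)] by (simp add: btw_def)
  have "disp q x \<le> d q p + d p (act x q)" using d_tri[OF q(1) p xq(1)] .
  then have 1: "disp q x \<le> disp p x" using dx q(4) d_sym[OF q(1) p] r by simp
  have "r \<le> gromov p (act x p) (act y p)" using eq(1) r by simp
  then obtain w where w: "w \<in> X" "btw p w (act x p)" "btw p w (act y p)" "d p w = r"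
    using obtain_common_pt[OF p X(1,2)] by blast
  have "w = act x q"
    by (rule btw_eqI[OF p X(1) X(1) w(1) xq(1) w(2) xq']) (use w(4) dx r gromov_self[OF p X(1)] in simp_all)
  then have "btw p (act x q) (act y p)" using w(3) by simp
  then have "btw p (act x q) (act y q)"
    using btw_order(1)[OF p X(2) yq(1) xq(1) yq'] dx dy r le by simp
  then have "d (act x q) (act y q) + disp p x = disp p y" using dx dy r by (simp add: btw_def)
  moreover have "d (act x q) (act y q) = disp q (inv x \<otimes> y)"
    using d_act_left[of x q "act y q"] c q(1) by (simp add: act_mult)
  ultimately show ?thesis using 1 q(1) by auto
qed

text \<open>The minimum is lexicographic: first the total displacement, then that of the first
  element. The second condition excludes those changes of pair or base point that leave the total
  unchanged.\<close>

theorem nielsen_basis: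
  assumes H: "subgroup H G" and ab0: "a0 \<in> H" "b0 \<in> H" "a0 \<otimes> b0 \<noteq> b0 \<otimes> a0"
    and cs: "commuting_stabs H" and rc: "root_closed_stabs H"
  obtains a b p where "nielsen a0 b0 a b" "p \<in> X"
    "(\<forall>s. alternating s \<longrightarrow> exponent_length s \<le> disp p (syllable_prod a b s)) \<or>
     (\<forall>s. alternating s \<longrightarrow> length s \<le> 2 * disp p (syllable_prod a b s) + 1)"
proof -
  have c0: "a0 \<in> carrier G" "b0 \<in> carrier G" using subgroup.mem_carrier[OF H] ab0 by blast+
  define P where "P = (\<lambda>(a, b, p). nielsen a0 b0 a b \<and> p \<in> X)"
  define tot where "tot = (\<lambda>(a, b, p). disp p a + disp p b)"
  obtain p0 where "p0 \<in> X" using X_nonempty by blast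
  then have "P (a0, b0, p0)" by (simp add: P_def nielsen.refl)
  from ex_has_least_nat[of P, OF this, of tot] obtain t where
    t: "P t" "\<forall>u. P u \<longrightarrow> tot t \<le> tot u" by blast
  from ex_has_least_nat[of "\<lambda>u. P u \<and> tot u = tot t" t "\<lambda>(a, b, p). disp p a"] t(1)
  obtain u where u: "P u" "tot u = tot t"
    "\<forall>v. P v \<and> tot v = tot t \<longrightarrow> (case u of (a, b, p) \<Rightarrow> disp p a) \<le> (case v of (a, b, p) \<Rightarrow> disp p a)"
    by blast
  obtain a b p where abp: "u = (a, b, p)" by (cases u)
  have N: "nielsen a0 b0 a b" and p: "p \<in> X" using u(1) by (simp_all add: abp P_def)
  have c: "a \<in> carrier G" "b \<in> carrier G" using nielsen_closed[OF N c0] .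
  have ab: "a \<in> H" "b \<in> H" using nielsen_in_subgroup[OF N H ab0(1,2)] by blast+
  have nc: "a \<otimes> b \<noteq> b \<otimes> a" using nielsen_not_commute[OF N c0] ab0(3) by blast
  have M1: "disp p a + disp p b \<le> disp q a' + disp q b'" if "nielsen a0 b0 a' b'" "q \<in> X" for a' b' q
    using t(2)[rule_format, of "(a', b', q)"] u(2) that by (simp add: P_def tot_def abp)
  have M2: "disp p a \<le> disp q a'"
    if "nielsen a0 b0 a' b'" "q \<in> X" "disp q a' + disp q b' \<le> disp p a + disp p b" for a' b' q
  proof -
    have "disp q a' + disp q b' = disp p a + disp p b" using M1[OF that(1,2)] that(3) by simp
    then show ?thesis using u(3)[rule_format, of "(a', b', q)"] u(2) that by (simp add: P_def tot_def abp)
  qed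
  show ?thesis
  proof (cases "disp p a = 0")
    case True
    have ap: "act a p = p" using True d_eq_0[OF p, of "act a p"] c p by simp
    show ?thesis
    \<comment> \<open>The question is asked for all partners of \<open>a\<close> with the
      displacement of \<open>b\<close>. A negative answer then covers every
      \<open>a [^] n \<otimes> b\<close> and yields the condition \<open>turn\<close>.\<close>
    proof (cases "\<exists>b'. nielsen a0 b0 a b' \<and> disp p b' = disp p b \<and> 1 \<le> gromov p (act b' p) (act (inv b') p)")
      case bridge: True
      then obtain b' where b': "nielsen a0 b0 a b'" "disp p b' = disp p b"
        "1 \<le> gromov p (act b' p) (act (inv b') p)" by blast
      have "b' \<in> H" using nielsen_in_subgroup[OF b'(1) H ab0(1,2)] by blast
      moreover have "disp p b' \<le> disp q a + disp q b'" if "q \<in> X" for q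
        using M1[OF b'(1) that] True b'(2) by simp
      ultimately have "length s \<le> 2 * disp p (syllable_prod a b' s) + 1" if "alternating s" for s
        using bridge_bound[OF H rc ab(1) _ p ap b'(3) _ that] by blast
      then show ?thesis using that[OF b'(1) p] by blast
    next
      case False
      have b0: "gromov p (act b p) (act (inv b) p) = 0" using False N by (metis less_one linorder_le_less_linear)
      have turn: "gromov p (act (a [^] n) (act b p)) (act (inv b) p) = 0" for n :: int
      proof -
        have an: "act (a [^] n) p = p" for n :: int using act_int_pow_fixed[OF c(1) p ap] .
        have "nielsen a0 b0 a (a [^] n \<otimes> b)" using nielsen_pow_mult[OF N c0] .
        moreover have "act (a [^] n \<otimes> b) p = act (a [^] n) (act b p)" using c p by (simp add: act_mult)
        moreover have "d p (act (a [^] n) (act b p)) = disp p b"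
          using d_act_fixed[of "a [^] n" p "act b p"] c p an by simp
        moreover have "act (inv (a [^] n \<otimes> b)) p = act (inv b) p"
          using an[of "- n"] c p by (simp add: inv_mult_group act_mult int_pow_neg)
        ultimately show ?thesis using False by (metis less_one linorder_le_less_linear)
      qed
      have "length s \<le> 2 * disp p (syllable_prod a b s) + 1" if "alternating s" for s
        using axis_bound[OF H rc cs ab nc p ap b0 turn that] .
      then show ?thesis using that[OF N p] by blast
    qed
  next
    case False
    define A where "A = disp p a"
    define B where "B = disp p b"
    have Apos: "A > 0" using False by (simp add: A_def)
    have AB: "A \<le> B" using M2[OF nielsen.swap[OF N] p] by (simp add: A_def B_def)
    have X1: "act a p \<in> X" "act (inv a) p \<in> X" "act b p \<in> X" "act (inv b) p \<in> X" using c p by simp_all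
    \<comment> \<open>Cutting off a doubled first edge gains 2 for \<open>a\<close> and loses at
      most 2 for \<open>b\<close>: the total stays minimal while the first displacement
      drops.\<close>
    have alpha: "gromov p (act a p) (act (inv a) p) = 0"
    proof (rule ccontr)
      assume "\<not> ?thesis"
      then have "1 \<le> gromov p (act a p) (act (inv a) p)" by simp
      then obtain q where q: "q \<in> X" "d p q = 1" "disp q a + 2 = disp p a"
        using shift_basepoint[OF c(1) p] by blast
      have bq: "act b q \<in> X" using c q by simp
      have "disp q b \<le> d q p + d p (act b q)" using d_tri[OF q(1) p bq] .
      moreover have "d p (act b q) \<le> disp p b + d (act b p) (act b q)" using d_tri[OF p X1(3) bq] .
      moreover have "d (act b p) (act b q) = 1" "d q p = 1" using c p q d_sym[OF p q(1)] by simp_all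
      ultimately have "disp q a + disp q b \<le> disp p a + disp p b" using q(3) by simp
      from M2[OF N q(1) this] show False using q(3) by simp
    qed
    define \<beta> where "\<beta> = gromov p (act b p) (act (inv b) p)"
    \<comment> \<open>Otherwise \<open>b\<close> fixes the midpoint \<open>q\<close> of its path,
      where the swapped pair \<open>(b, a)\<close> has total at most \<open>A + B\<close> and first
      displacement 0.\<close>
    have beta: "2 * \<beta> < B"
    proof (rule ccontr)
      assume "\<not> ?thesis"
      then have "disp p b \<le> 2 * gromov p (act b p) (act (inv b) p)" by (simp add: \<beta>_def B_def)
      then obtain q where q: "q \<in> X" "act b q = q" "2 * d p q = disp p b"
        using elliptic_midpoint[OF c(2) p] by blast
      have aq: "act a q \<in> X" using c q by simp
      have "disp q a \<le> d q p + d p (act a q)" using d_tri[OF q(1) p aq] .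
      moreover have "d p (act a q) \<le> disp p a + d (act a p) (act a q)" using d_tri[OF p X1(1) aq] .
      moreover have "d (act a p) (act a q) = d p q" "d q p = d p q" using c p q d_sym[OF p q(1)] by simp_all
      ultimately have "disp q b + disp q a \<le> disp p a + disp p b" using q by simp
      from M2[OF nielsen.swap[OF N] q(1) this] show False using q Apos by (simp add: A_def)
    qed
    have Nx: "nielsen a0 b0 x y" if "x \<in> {a, inv a}" "y \<in> {b, inv b}" for x y
      using that N nielsen.inv[OF N] nielsen_inv2[OF N] nielsen.inv[OF nielsen_inv2[OF N]] by blast
    have xy: "x \<in> carrier G" "y \<in> carrier G" "disp p x = A" "disp p y = B"
      if "x \<in> {a, inv a}" "y \<in> {b, inv b}" for x y
      using that c p by (auto simp: A_def B_def)
    have half: "2 * gromov p (act x p) (act y p) \<le> A" if h: "x \<in> {a, inv a}" "y \<in> {b, inv b}" for x y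
    proof -
      have "disp p a + disp p b \<le> disp p x + disp p (inv x \<otimes> y)"
        using M1[OF nielsen_inv_mult[OF Nx[OF h] c0] p] .
      then have "disp p y \<le> disp p (inv x \<otimes> y)" using xy[OF h] by (simp add: A_def B_def)
      then show ?thesis using mixed_gromov_le[OF xy(1,2)[OF h] p] xy(3)[OF h] by simp
    qed
    have excl: "\<not> (2 * gromov p (act x p) (act y p) = A \<and> 2 * gromov p (act (inv x) p) (act (inv y) p) = A)"
      if h: "x \<in> {a, inv a}" "y \<in> {b, inv b}" for x y
    proof
      assume e: "2 * gromov p (act x p) (act y p) = A \<and> 2 * gromov p (act (inv x) p) (act (inv y) p) = A"
      obtain q where q: "q \<in> X" "disp q x \<le> A" "disp q (inv x \<otimes> y) + A \<le> B"
        using overlap_reduces[OF xy(1,2)[OF h] p] e AB xy(3,4)[OF h] by auto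
      have "disp p a + disp p b \<le> disp q x + disp q (inv x \<otimes> y)"
        using M1[OF nielsen_inv_mult[OF Nx[OF h] c0] q(1)] .
      then show False using q Apos by (simp add: A_def B_def)
    qed
    \<comment> \<open>If \<open>b\<close> doubles back along an edge that also starts the path of
      \<open>x\<close>, moving along it gains 2 for \<open>b\<close> and costs \<open>a\<close>
      nothing.\<close>
    have zero: "gromov p (act x p) (act y p) = 0" if b1: "\<beta> \<ge> 1" and h: "x \<in> {a, inv a}" "y \<in> {b, inv b}" for x y
    proof (rule ccontr)
      assume "\<not> ?thesis"
      then have g1: "1 \<le> gromov p (act x p) (act y p)" by simp
      obtain q where q: "q \<in> X" "d p q = 1" "btw p q (act b p)" "btw p q (act (inv b) p)"
        "disp q b + 2 = disp p b"
        using shift_basepoint[OF c(2) p b1[unfolded \<beta>_def]] .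
      have X2: "act x p \<in> X" "act y p \<in> X" "act x q \<in> X" using xy[OF h] p q by simp_all
      obtain z where z: "z \<in> X" "btw p z (act x p)" "btw p z (act y p)" "d p z = 1"
        using obtain_common_pt[OF p X2(1,2) g1] .
      have qy: "btw p q (act y p)" using h q by blast
      have "z = q"
        by (rule btw_eqI[OF p X2(2) X2(2) z(1) q(1) z(3) qy])
          (use z(4) q(2) gromov_self[OF p X2(2)] gromov_le2[OF p X2(1,2)] g1 in simp_all)
      then have "d q (act x p) + 1 = A" using z(2) q(2) xy(3)[OF h] by (simp add: btw_def)
      moreover have "d (act x p) (act x q) = 1" using xy[OF h] p q by simp
      moreover have "disp q x \<le> d q (act x p) + d (act x p) (act x q)" using d_tri[OF q(1) X2(1,3)] .
      ultimately have "disp q x \<le> A" by simp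
      moreover have "disp q x = disp q a" using h(1) c q(1) by auto
      ultimately show False using M1[OF N q(1)] q(5) by (simp add: A_def)
    qed
    define g where "g = (\<lambda>y z. gromov p (act (letter_val a b y) p) (act (letter_val a b z) p))"
    have lv: "act (letter_val a b y) p \<in> X" for y using c p by simp
    have g_sym: "g y z = g z y" for y z using gromov_sym[OF p lv lv] by (simp add: g_def)
    have g_ultra: "\<not> (1 \<le> g x y \<and> 1 \<le> g y z \<and> g x z = 0)" for x y z
      using gromov_ultra[OF p lv lv lv, of 1 x y z] by (auto simp: g_def)
    define c1 where "c1 = g (True, True) (True, False)"
    define c2 where "c2 = g (True, True) (False, False)"
    define c3 where "c3 = g (False, True) (True, False)"
    define c4 where "c4 = g (False, True) (False, False)"
    have gA: "g (True, True) (False, True) = 0" using alpha by (simp add: g_def letter_val_def)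
    have gB: "g (True, False) (False, False) = \<beta>" by (simp add: g_def letter_val_def \<beta>_def)
    have h: "2 * c1 \<le> A" "2 * c2 \<le> A" "2 * c3 \<le> A" "2 * c4 \<le> A"
      using half by (simp_all add: c1_def c2_def c3_def c4_def g_def letter_val_def)
    have ex: "\<not> (2 * c1 = A \<and> 2 * c4 = A)" "\<not> (2 * c2 = A \<and> 2 * c3 = A)"
      using excl[of a b] excl[of a "inv b"] c
      by (simp_all add: c1_def c2_def c3_def c4_def g_def letter_val_def)
    have z0: "\<beta> \<ge> 1 \<Longrightarrow> c1 = 0 \<and> c2 = 0 \<and> c3 = 0 \<and> c4 = 0"
      using zero by (simp add: c1_def c2_def c3_def c4_def g_def letter_val_def)
    have sym: "g (True, False) (True, True) = c1" "g (False, False) (True, True) = c2"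
      "g (True, False) (False, True) = c3" "g (False, False) (False, True) = c4"
      "g (False, True) (True, True) = 0" "g (False, False) (True, False) = \<beta>"
      using g_sym[of "(True, False)" "(True, True)"] g_sym[of "(False, False)" "(True, True)"]
        g_sym[of "(True, False)" "(False, True)"] g_sym[of "(False, False)" "(False, True)"]
        g_sym[of "(False, True)" "(True, True)"] g_sym[of "(False, False)" "(True, False)"] gA gB
      by (simp_all only: c1_def c2_def c3_def c4_def)
    \<comment> \<open>Two letters with overlap 0 cannot both overlap a third one. This applies to
      \<open>a\<close> and its inverse always, and to \<open>b\<close> and its inverse when \<beta>
      is 0.\<close>
    have u1: "c1 = 0 \<or> c3 = 0" "c2 = 0 \<or> c4 = 0"
      using g_ultra[of "(True, True)" "(True, False)" "(False, True)"]
        g_ultra[of "(True, True)" "(False, False)" "(False, True)"] gA sym(3,4)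
      unfolding c1_def[symmetric] c2_def[symmetric] by linarith+
    have u2: "\<beta> = 0 \<Longrightarrow> c1 = 0 \<or> c2 = 0" "\<beta> = 0 \<Longrightarrow> c3 = 0 \<or> c4 = 0"
      using g_ultra[of "(True, False)" "(True, True)" "(False, False)"]
        g_ultra[of "(True, False)" "(False, True)" "(False, False)"] gB sym(1,3)
      unfolding c2_def[symmetric] c4_def[symmetric] by linarith+
    have dA: "disp p (letter_val a b (e, True)) = A" and dB: "disp p (letter_val a b (e, False)) = B" for e
      using c p by (simp_all add: letter_val_def A_def B_def)
    have gs: "g (True, True) (True, False) = c1" "g (True, False) (True, True) = c1"
      "g (True, True) (False, False) = c2" "g (False, False) (True, True) = c2"
      "g (False, True) (True, False) = c3" "g (True, False) (False, True) = c3"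
      "g (False, True) (False, False) = c4" "g (False, False) (False, True) = c4"
      "g (True, True) (False, True) = 0" "g (False, True) (True, True) = 0"
      "g (True, False) (False, False) = \<beta>" "g (False, False) (True, False) = \<beta>"
      using gA gB sym by (simp_all only: c1_def c2_def c3_def c4_def)
    have ineq: "c1 + c2 < B" "c3 + c4 < B" "c1 + c3 < A" "c2 + c4 < A" "c1 + c4 < A" "c2 + c3 < A"
      "\<beta> + c1 < B" "\<beta> + c2 < B" "\<beta> + c3 < B" "\<beta> + c4 < B"
    proof -
      show "c1 + c3 < A" using u1(1) h(1,3) Apos by auto
      show "c2 + c4 < A" using u1(2) h(2,4) Apos by auto
      show "c1 + c4 < A" using ex(1) h(1,4) by linarith
      show "c2 + c3 < A" using ex(2) h(2,3) by linarith
      show "c1 + c2 < B" using z0 u2(1) h(1,2) AB Apos by (cases "\<beta> = 0") auto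
      show "c3 + c4 < B" using z0 u2(2) h(3,4) AB Apos by (cases "\<beta> = 0") auto
      show "\<beta> + c1 < B" using z0 h(1) AB Apos beta by (cases "\<beta> = 0") auto
      show "\<beta> + c2 < B" using z0 h(2) AB Apos beta by (cases "\<beta> = 0") auto
      show "\<beta> + c3 < B" using z0 h(3) AB Apos beta by (cases "\<beta> = 0") auto
      show "\<beta> + c4 < B" using z0 h(4) AB Apos beta by (cases "\<beta> = 0") auto
    qed
    have K: "g z y + g z' (flip y) < disp p (letter_val a b y)" if "z \<noteq> y" "z' \<noteq> flip y" for y z z'
    proof -
      obtain e x where y: "y = (e, x)" by (cases y)
      obtain e1 x1 where z: "z = (e1, x1)" by (cases z)
      obtain e2 x2 where z': "z' = (e2, x2)" by (cases z')
      show ?thesis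
        using that ineq h AB Apos beta
        unfolding y z z' flip_def
        by (cases e; cases x; cases e1; cases x1; cases e2; cases x2; simp add: gs dA dB)
    qed
    have "exponent_length s \<le> disp p (syllable_prod a b s)" if "alternating s" for s
      by (rule reduced_bound[OF c p _ that]) (use K in \<open>simp add: g_def\<close>)
    then show ?thesis using that[OF N p] by blast
  qed
qed

end

section \<open>Growth of long syllables\<close>

definition uminus_word :: "(bool \<times> int) list \<Rightarrow> (bool \<times> int) list" where
  "uminus_word s = rev (map (\<lambda>(x, n). (x, - n)) s)"

lemma uminus_word_eq_Nil [simp]: "uminus_word s = [] \<longleftrightarrow> s = []"
  by (simp add: uminus_word_def)

lemma fst_hd_uminus_word [simp]: "s \<noteq> [] \<Longrightarrow> fst (hd (uminus_word s)) = fst (last s)"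
  by (simp add: uminus_word_def hd_rev last_map case_prod_beta)

lemma fst_last_uminus_word [simp]: "s \<noteq> [] \<Longrightarrow> fst (last (uminus_word s)) = fst (hd s)"
  by (simp add: uminus_word_def last_rev hd_map case_prod_beta)

lemma alternating_uminus_word: "alternating s \<Longrightarrow> alternating (uminus_word s)"
  by (auto simp: alternating_def uminus_word_def successively_map case_prod_beta elim!: successively_mono)

text \<open>The word is the commutator of the generator \<open>x\<close> with the conjugate by
  \<open>w\<close> of the generator \<open>y\<close>.\<close>

lemma alternating_commutator_word:
  assumes "alternating ((x, n) # w @ (y, m) # t)"
  shows "alternating ((x, 1) # w @ (y, 1) # uminus_word w @ (x, -1) # w @ (y, -1) # uminus_word w)"
proof (cases "w = []")
  case True
  then show ?thesis using assms by (simp add: alternating_Cons uminus_word_def)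
next
  case False
  then have "alternating w" "fst (hd w) \<noteq> x" "fst (last w) \<noteq> y"
    using assms by (auto simp: alternating_Cons alternating_append)
  then show ?thesis using False alternating_uminus_word[of w]
    by (simp add: alternating_Cons alternating_append)
qed

context group
begin

lemma conj_commute_iff:
  assumes "c \<in> carrier G" "x \<in> carrier G" "y \<in> carrier G"
    "(c \<otimes> x \<otimes> inv c) \<otimes> (c \<otimes> y \<otimes> inv c) = (c \<otimes> y \<otimes> inv c) \<otimes> (c \<otimes> x \<otimes> inv c)"
  shows "x \<otimes> y = y \<otimes> x"
proof -
  have *: "(c \<otimes> x \<otimes> inv c) \<otimes> (c \<otimes> y \<otimes> inv c) = c \<otimes> (x \<otimes> y) \<otimes> inv c"
    if "x \<in> carrier G" "y \<in> carrier G" for x y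
  proof -
    have "inv c \<otimes> (c \<otimes> (y \<otimes> inv c)) = y \<otimes> inv c" using assms that by (simp add: m_assoc[symmetric])
    then show ?thesis using assms(1) that by (simp add: m_assoc)
  qed
  show ?thesis using assms(4) *[OF assms(2,3)] *[OF assms(3,2)] assms(1-3) by simp
qed

lemma commute_inv:
  assumes "x \<in> carrier G" "y \<in> carrier G" "inv x \<otimes> y = y \<otimes> inv x"
  shows "x \<otimes> y = y \<otimes> x"
proof -
  have "x \<otimes> y = x \<otimes> (y \<otimes> inv x) \<otimes> x" using assms by (simp add: m_assoc)
  also have "\<dots> = x \<otimes> (inv x \<otimes> y) \<otimes> x" using assms(3) by simp
  also have "\<dots> = y \<otimes> x" using assms(1,2) by (simp add: m_assoc[symmetric])
  finally show ?thesis .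
qed

lemma commute_cases:
  assumes "x \<in> carrier G" "y \<in> carrier G" "x' \<in> {x, inv x}" "y' \<in> {y, inv y}" "x' \<otimes> y' = y' \<otimes> x'"
  shows "x \<otimes> y = y \<otimes> x"
proof -
  have x'y': "x' \<in> carrier G" "y' \<in> carrier G" using assms by auto
  have "x \<otimes> y' = y' \<otimes> x"
    using assms(3,5) commute_inv[OF assms(1) x'y'(2)] by auto
  then have "y' \<otimes> x = x \<otimes> y'" by simp
  then have "y \<otimes> x = x \<otimes> y"
    using assms(4) commute_inv[OF assms(2,1)] by auto
  then show ?thesis by simp
qed

text \<open>Along the path of a reduced word, each syllable moves along the axis of a conjugate of
  \<open>a\<close> or \<open>b\<close>. Commuting conjugates would give the commutator word of their
  relative position, which is alternating and nonempty, the value 1.\<close>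

lemma syllable_conjugates_not_commute:
  assumes ab: "a \<in> carrier G" "b \<in> carrier G"
    and free: "\<And>s. \<lbrakk>alternating s; s \<noteq> []\<rbrakk> \<Longrightarrow> syllable_prod a b s \<noteq> \<one>"
    and s: "alternating s" "s = r @ (x, n) # w @ (y, m) # t"
  defines "v \<equiv> \<lambda>x. if x then a else b"
  defines "g1 \<equiv> syllable_prod a b r" and "g2 \<equiv> syllable_prod a b (r @ (x, n) # w)"
  shows "(g1 \<otimes> v x \<otimes> inv g1) \<otimes> (g2 \<otimes> v y \<otimes> inv g2) \<noteq> (g2 \<otimes> v y \<otimes> inv g2) \<otimes> (g1 \<otimes> v x \<otimes> inv g1)"
proof
  assume eq: "(g1 \<otimes> v x \<otimes> inv g1) \<otimes> (g2 \<otimes> v y \<otimes> inv g2) = (g2 \<otimes> v y \<otimes> inv g2) \<otimes> (g1 \<otimes> v x \<otimes> inv g1)"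
  define M where "M = syllable_prod a b w"
  \<comment> \<open>Conjugating by the syllable \<open>v x [^] n\<close> does not change
    \<open>v x\<close>. With it included, exactly \<open>w\<close> remains between the two
    generators and the commutator is reduced.\<close>
  define c where "c = g1 \<otimes> v x [^] n"
  have v: "v z \<in> carrier G" for z using ab by (simp add: v_def)
  have cl: "g1 \<in> carrier G" "M \<in> carrier G" "c \<in> carrier G" "g2 \<in> carrier G"
    using ab v by (simp_all add: g1_def M_def c_def g2_def)
  have g2: "g2 = c \<otimes> M"
    using ab v cl by (simp add: g2_def c_def g1_def M_def v_def syllable_prod_append m_assoc)
  have "v x [^] n \<otimes> v x = v x \<otimes> v x [^] n"
    using int_pow_mult[of "v x" n 1] int_pow_mult[of "v x" 1 n] v[of x] by (simp add: add.commute)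
  then have "v x [^] n \<otimes> v x \<otimes> inv (v x [^] n) = v x"
    using v[of x] by (simp add: m_assoc)
  moreover have "c \<otimes> v x \<otimes> inv c = g1 \<otimes> (v x [^] n \<otimes> v x \<otimes> inv (v x [^] n)) \<otimes> inv g1"
    using cl v[of x] by (simp add: c_def inv_mult_group m_assoc)
  ultimately have 1: "g1 \<otimes> v x \<otimes> inv g1 = c \<otimes> v x \<otimes> inv c" by simp
  have 2: "g2 \<otimes> v y \<otimes> inv g2 = c \<otimes> (M \<otimes> v y \<otimes> inv M) \<otimes> inv c"
    using cl v[of y] by (simp add: g2 inv_mult_group m_assoc)
  have comm: "v x \<otimes> (M \<otimes> v y \<otimes> inv M) = (M \<otimes> v y \<otimes> inv M) \<otimes> v x"
    using conj_commute_iff[of c "v x" "M \<otimes> v y \<otimes> inv M"] eq cl v unfolding 1 2 by simp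
  let ?W = "(x, 1) # w @ (y, 1) # uminus_word w @ (x, -1) # w @ (y, -1) # uminus_word w"
  have "syllable_prod a b ?W = v x \<otimes> (M \<otimes> v y \<otimes> inv M) \<otimes> (inv (v x) \<otimes> inv (M \<otimes> v y \<otimes> inv M))"
    using ab cl v by (simp add: syllable_prod_append syllable_prod_uminus uminus_word_def v_def M_def[symmetric]
        int_pow_neg inv_mult_group m_assoc)
  also have "\<dots> = \<one>"
    using comm cl v by (simp add: inv_mult_group[symmetric])
  finally have "syllable_prod a b ?W = \<one>" .
  moreover have "alternating ?W"
    by (rule alternating_commutator_word[of x n w y m t]) (use s in \<open>simp add: alternating_append\<close>)
  ultimately show False using free[of ?W] by simp
qed

end

context tree_action
begin

lemma btw_dist_le:
  assumes "p \<in> X" "q \<in> X" "u \<in> X" "v \<in> X" "btw p u q" "btw p v q"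
  shows "d u v \<le> d p q"
proof -
  have *: "d u v \<le> d p q" if "u \<in> X" "v \<in> X" "btw p u q" "btw p v q" "d p u \<le> d p v" for u v
    using btw_order(1)[of p q v u] that assms by (simp add: btw_def)
  show ?thesis
  proof (cases "d p u \<le> d p v")
    case True
    then show ?thesis using * assms by blast
  next
    case False
    then have "d v u \<le> d p q" using *[of v u] assms by simp
    then show ?thesis using d_sym[OF assms(3,4)] by simp
  qed
qed

lemma axis_shift_forward:
  assumes h: "h \<in> carrier G" and q: "q \<in> X" and ax: "\<And>m::int. disp q (h [^] m) = nat \<bar>m\<bar> * l"
    and n: "0 \<le> (n::int)" and uv: "u \<in> X" "v \<in> X" "btw q u (act (h [^] n) q)" "btw q v (act (h [^] n) q)"
    and le: "d q u \<le> d q v" and z: "z \<in> X" "btw u z v" "l \<le> d z v"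
  shows "btw u (act h z) v \<and> d u (act h z) = d u z + l"
proof -
  define e where "e = act (h [^] n) q"
  \<comment> \<open>One period beyond the given segment, so that \<open>act h z\<close> still lies
    on a known geodesic from \<open>q\<close>.\<close>
  define E where "E = act h e"
  define hq where "hq = act h q"
  define hz where "hz = act h z"
  have X: "e \<in> X" "E \<in> X" "hq \<in> X" "hz \<in> X" using h q z by (simp_all add: e_def E_def hq_def hz_def)
  have hn: "h \<otimes> h [^] n = h [^] (n + 1)" "h [^] n \<otimes> h = h [^] (n + 1)"
    using int_pow_mult[OF h, of 1 n] int_pow_mult[OF h, of n 1] h by (simp_all add: add.commute)
  have qE: "d q E = (nat n + 1) * l"
    using ax[of "n + 1"] act_mult[OF h _ q, of "h [^] n"] h n hn by (simp add: E_def e_def nat_add_distrib)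
  have qe: "d q e = nat n * l" using ax[of n] n by (simp add: e_def)
  have eE: "d e E = l"
    using ax[of 1] act_mult[OF h _ q, of "h [^] n"] act_mult[OF _ h q, of "h [^] n"] h hn q d_act[of "h [^] n" q hq]
    by (simp add: E_def e_def hq_def)
  have qhq: "d q hq = l" using ax[of 1] h by (simp add: hq_def)
  have hqE: "d hq E = nat n * l" using d_act[OF h q X(1)] qe by (simp add: hq_def E_def)
  have b1: "btw q hq E" "btw q e E" using qE qe eE qhq hqE by (simp_all add: btw_def algebra_simps)
  have quv: "btw q u v" "btw q u e" "btw q v e"
    using btw_order(1)[OF q X(1) uv(2,1)] uv(3,4) le by (simp_all add: e_def)
  have qz: "btw q z v" "btw q u z" using btw_trans[OF q uv(2,1) z(1) quv(1) z(2)] .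
  have qze: "btw q z e" using btw_trans'(1)[OF q X(1) uv(2) z(1) quv(3) qz(1)] .
  have "btw hq hz E" using btw_act[OF h q X(1) z(1)] qze by (simp add: hq_def hz_def E_def)
  then have qhz: "btw q hz E" "btw q hq hz" using btw_trans[OF q X(2,3,4) b1(1)] by blast+
  have "d hq hz = d q z" using d_act[OF h q z(1)] by (simp add: hq_def hz_def)
  then have dhz: "d q hz = l + d q z" using qhz(2) qhq by (simp add: btw_def)
  have dv: "d q hz \<le> d q v" using dhz qz(1) z(3) by (simp add: btw_def)
  moreover have "d q v \<le> d q e" using quv(3) by (simp add: btw_def)
  ultimately have "btw q hz e" using btw_order(1)[OF q X(2,1,4) b1(2) qhz(1)] by simp
  then have qhv: "btw q hz v" using btw_order(1)[OF q X(1) uv(2) X(4) quv(3)] dv by simp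
  have du: "d q u \<le> d q hz" using dhz qz(2) by (simp add: btw_def)
  have "btw q u hz" "btw u hz v" using btw_order[OF q uv(2) X(4) uv(1) qhv quv(1) du] .
  then show ?thesis using dhz qz(2) unfolding hz_def btw_def by simp
qed

text \<open>Whether \<open>h\<close> or its inverse moves forward from \<open>u\<close> to
  \<open>v\<close> depends on orientations: a negative \<open>n\<close> is absorbed by inverting
  \<open>h\<close>, and the reverse order of \<open>u\<close> and \<open>v\<close> by starting at
  the other end of the segment.\<close>

lemma axis_shift:
  assumes h: "h \<in> carrier G" and q: "q \<in> X" and ax: "\<And>m::int. disp q (h [^] m) = nat \<bar>m\<bar> * l"
    and uv: "u \<in> X" "v \<in> X" "btw q u (act (h [^] (n::int)) q)" "btw q v (act (h [^] n) q)"
  shows "\<exists>k\<in>{h, inv h}. \<forall>z\<in>X. btw u z v \<and> l \<le> d z v \<longrightarrow> btw u (act k z) v \<and> d u (act k z) = d u z + l"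
proof -
  have pos: "\<exists>k\<in>{h, inv h}. \<forall>z\<in>X. btw u z v \<and> l \<le> d z v \<longrightarrow> btw u (act k z) v \<and> d u (act k z) = d u z + l"
    if h: "h \<in> carrier G" and q: "q \<in> X" and ax: "\<And>m::int. disp q (h [^] m) = nat \<bar>m\<bar> * l"
    and n: "0 \<le> n" and b: "btw q u (act (h [^] n) q)" "btw q v (act (h [^] n) q)" for h q and n :: int
  proof (cases "d q u \<le> d q v")
    case True
    then show ?thesis using axis_shift_forward[OF h q ax n uv(1,2) b True] by blast
  next
    case False
    define q' where "q' = act (h [^] n) q"
    have q': "q' \<in> X" using h q by (simp add: q'_def)
    have ih: "inv h \<in> carrier G" using h by simp
    have ret: "act (inv h [^] n) q' = q"
      using h q by (simp add: q'_def int_pow_inv)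
    have ax': "disp q' (inv h [^] m) = nat \<bar>m\<bar> * l" for m :: int
    proof -
      have "h [^] n \<otimes> h [^] (- m) = h [^] (- m) \<otimes> h [^] n"
        using h by (simp add: int_pow_mult[symmetric] add.commute)
      then have "act (h [^] (- m)) q' = act (h [^] n) (act (h [^] (- m)) q)"
        using h q by (simp add: q'_def act_mult[symmetric])
      then have "d q' (act (h [^] (- m)) q') = disp q (h [^] (- m))"
        using h q by (simp add: q'_def)
      then show ?thesis using ax[of "- m"] h by (simp add: int_pow_neg int_pow_inv)
    qed
    have b': "btw q' u (act (inv h [^] n) q')" "btw q' v (act (inv h [^] n) q')"
      using btw_symD[OF q q' uv(1)] btw_symD[OF q q' uv(2)] b unfolding ret by (simp_all add: q'_def)
    have "d q u + d u q' = d q q'" "d q v + d v q' = d q q'" using b by (simp_all add: q'_def btw_def)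
    then have "d q' u \<le> d q' v" using False d_sym[OF uv(1) q'] d_sym[OF uv(2) q'] by simp
    from axis_shift_forward[OF ih q' ax' n uv(1,2) b' this] show ?thesis by blast
  qed
  show ?thesis
  proof (cases "0 \<le> n")
    case True
    show ?thesis by (rule pos[OF h q ax True uv(3,4)])
  next
    case False
    have ih: "inv h \<in> carrier G" using h by simp
    have eq: "inv h [^] (- m) = h [^] m" for m :: int using h by (simp add: int_pow_inv int_pow_neg)
    have ax': "disp q (inv h [^] m) = nat \<bar>m\<bar> * l" for m :: int
      using ax[of "- m"] eq[of "- m"] by simp
    have "\<exists>k\<in>{inv h, inv (inv h)}. \<forall>z\<in>X. btw u z v \<and> l \<le> d z v \<longrightarrow> btw u (act k z) v \<and> d u (act k z) = d u z + l"
      by (rule pos[OF ih q ax', of "- n"]) (use False uv eq[of n] in simp_all)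
    then show ?thesis using h by auto
  qed
qed

text \<open>On a common stretch of length at least \<open>l1 + l2\<close> both orders of the two
  translations carry \<open>u\<close> to the point at distance \<open>l1 + l2\<close>. The
  commutator therefore fixes a point, which forces commuting in \<open>H\<close>.\<close>

lemma axis_overlap_commute:
  assumes H: "subgroup H G" "commuting_stabs H" and h: "h1 \<in> H" "h2 \<in> H" and q: "q1 \<in> X" "q2 \<in> X"
    and ax1: "\<And>m::int. disp q1 (h1 [^] m) = nat \<bar>m\<bar> * l1" and ax2: "\<And>m::int. disp q2 (h2 [^] m) = nat \<bar>m\<bar> * l2"
    and uv: "u \<in> X" "v \<in> X" "btw q1 u (act (h1 [^] (n1::int)) q1)" "btw q1 v (act (h1 [^] n1) q1)"
      "btw q2 u (act (h2 [^] (n2::int)) q2)" "btw q2 v (act (h2 [^] n2) q2)"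
    and long: "l1 + l2 \<le> d u v"
  shows "h1 \<otimes> h2 = h2 \<otimes> h1"
proof -
  have c: "h1 \<in> carrier G" "h2 \<in> carrier G" using subgroup.mem_carrier[OF H(1)] h by blast+
  obtain k1 where k1: "k1 \<in> {h1, inv h1}"
    "\<And>z. \<lbrakk>z \<in> X; btw u z v; l1 \<le> d z v\<rbrakk> \<Longrightarrow> btw u (act k1 z) v \<and> d u (act k1 z) = d u z + l1"
    using axis_shift[OF c(1) q(1) ax1 uv(1-4)] by blast
  obtain k2 where k2: "k2 \<in> {h2, inv h2}"
    "\<And>z. \<lbrakk>z \<in> X; btw u z v; l2 \<le> d z v\<rbrakk> \<Longrightarrow> btw u (act k2 z) v \<and> d u (act k2 z) = d u z + l2"
    using axis_shift[OF c(2) q(2) ax2 uv(1,2,5,6)] by blast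
  have kH: "k1 \<in> H" "k2 \<in> H" using k1(1) k2(1) h subgroup.m_inv_closed[OF H(1)] by auto
  have kc: "k1 \<in> carrier G" "k2 \<in> carrier G" using subgroup.mem_carrier[OF H(1)] kH by blast+
  have buv: "btw u u v" using uv by simp
  have duu: "d u u = 0" using uv by simp
  have 1: "btw u (act k1 u) v" "d u (act k1 u) = l1" using k1(2)[OF uv(1) buv] long duu by simp_all
  have 2: "btw u (act k2 u) v" "d u (act k2 u) = l2" using k2(2)[OF uv(1) buv] long duu by simp_all
  have X: "act k1 u \<in> X" "act k2 u \<in> X" using kc uv by simp_all
  have 12: "btw u (act k1 (act k2 u)) v" "d u (act k1 (act k2 u)) = l2 + l1"
    using k1(2)[OF X(2) 2(1)] long 2 by (simp_all add: btw_def)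
  have 21: "btw u (act k2 (act k1 u)) v" "d u (act k2 (act k1 u)) = l1 + l2"
    using k2(2)[OF X(1) 1(1)] long 1 by (simp_all add: btw_def)
  have "act k1 (act k2 u) = act k2 (act k1 u)"
    by (rule btw_eqI[OF uv(1,2,2) _ _ 12(1) 21(1)])
      (use 12(2) 21(2) X kc long gromov_self[OF uv(1,2)] in simp_all)
  then have "act (k1 \<otimes> k2) u = act (k2 \<otimes> k1) u" using kc uv by (simp add: act_mult)
  then have "k1 \<otimes> k2 = k2 \<otimes> k1" using commuting_stabsD[OF H(2) kH uv(1)] by blast
  then show ?thesis using commute_cases[OF c k1(1) k2(1)] by blast
qed

text \<open>The path is made of sides along the axes of conjugates of \<open>a\<close> and
  \<open>b\<close>, one for each syllable, joined by bounded sides. Freeness prevents these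
  conjugates from commuting, so overlaps are bounded and the side lengths add up. An elliptic
  generator has weight \<open>l\<close> equal to 0, so its syllables contribute nothing to the left
  hand side.\<close>

theorem syllable_growth:
  assumes H: "subgroup H G" "commuting_stabs H" and ab: "a \<in> H" "b \<in> H" and bp: "bp \<in> X"
    and free: "\<And>s. \<lbrakk>alternating s; s \<noteq> []\<rbrakk> \<Longrightarrow> syllable_prod a b s \<noteq> \<one>"
  shows "\<exists>C l. (\<forall>x. (\<forall>p\<in>X. act (if x then a else b) p \<noteq> p) \<longrightarrow> l x \<ge> 1) \<and>
    (\<forall>s. alternating s \<longrightarrow> (\<Sum>q\<leftarrow>s. nat \<bar>snd q\<bar> * l (fst q)) \<le> disp bp (syllable_prod a b s) + C * (length s + 1))"
proof -
  have c: "a \<in> carrier G" "b \<in> carrier G" using subgroup.mem_carrier[OF H(1)] ab by blast+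
  define v where "v = (\<lambda>x. if x then a else b)"
  have v: "v x \<in> carrier G" "v x \<in> H" for x using c ab by (simp_all add: v_def)
  have "\<exists>p. p \<in> X \<and> (\<forall>n::int. disp p (v x [^] n) = nat \<bar>n\<bar> * disp p (v x))" for x
    by (rule obtain_axis[OF v(1)[of x]]) blast
  then obtain P where P: "\<And>x. P x \<in> X" "\<And>x (n::int). disp (P x) (v x [^] n) = nat \<bar>n\<bar> * disp (P x) (v x)"
    by metis
  define l where "l = (\<lambda>x. disp (P x) (v x))"
  define K where "K = d (P True) (P False)"
  \<comment> \<open>An overlap involving a joining side is at most \<open>K\<close>; two axes share
    less than the sum of their translation lengths, each at most
    \<open>l True + l False\<close>.\<close>
  define \<delta> where "\<delta> = 2 * l True + 2 * l False + K"
  define M where "M = d bp (P True) + d bp (P False)"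
  have PP: "d (P x) (P y) \<le> K" for x y
    using d_sym[OF P(1)[of True] P(1)[of False]] P(1) by (cases x; cases y) (simp_all add: K_def)
  have oP: "d bp (P x) \<le> M" for x by (cases x) (simp_all add: M_def)
  have l: "l x \<ge> 1" if "\<And>p. p \<in> X \<Longrightarrow> act (if x then a else b) p \<noteq> p" for x
  proof -
    have "act (v x) (P x) \<noteq> P x" using that[OF P(1)] by (simp add: v_def)
    then have "l x \<noteq> 0" using d_eq_0[OF P(1), of "act (v x) (P x)" x] act_closed[OF v(1) P(1)]
      unfolding l_def by metis
    then show ?thesis by simp
  qed
  \<comment> \<open>Two sides per syllable at \<open>4 * \<delta>\<close> each give
    \<open>8 * \<delta>\<close>; \<open>2 * M\<close> pays for moving both ends of the path to
    \<open>bp\<close>.\<close>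
  have main: "(\<Sum>q\<leftarrow>s. nat \<bar>snd q\<bar> * l (fst q)) \<le> disp bp (syllable_prod a b s) + (8 * \<delta> + 2 * M) * (length s + 1)"
    if s: "alternating s" for s
  proof -
    define k where "k = length s"
    define g where "g = (\<lambda>i. syllable_prod a b (take i s))"
    define x where "x = (\<lambda>i. fst (s ! i))"
    define n where "n = (\<lambda>i. snd (s ! i))"
    \<comment> \<open>Even sides follow the axis of a syllable, odd sides change to the next axis.
      At the last vertex \<open>x k\<close> reads past the end of \<open>s\<close>; its value is
      arbitrary, and only the bounds valid for both values of \<open>P\<close> are used
      there.\<close>
    define y where "y = (\<lambda>j. act (g ((j + 1) div 2)) (P (x (j div 2))))"
    have gc: "g i \<in> carrier G" "g i \<in> H" for i
    proof -
      show "g i \<in> carrier G" using c by (simp add: g_def)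
      have "syllable_prod a b t \<in> H" for t
      proof (induction t)
        case Nil
        then show ?case using subgroup.one_closed[OF H(1)] by simp
      next
        case (Cons q t)
        have "v (fst q) [^] snd q \<in> H" using subgroup_int_pow_closed[OF H(1) v(2)] .
        then show ?case using Cons subgroup.m_closed[OF H(1)] by (cases q) (simp add: v_def)
      qed
      then show "g i \<in> H" by (simp add: g_def)
    qed
    have gS: "g (Suc i) = g i \<otimes> v (x i) [^] n i" if "i < k" for i
    proof -
      have "s ! i = (x i, n i)" by (simp add: x_def n_def)
      then show ?thesis using that c
        by (simp add: g_def k_def take_Suc_conv_app_nth syllable_prod_append v_def)
    qed
    have y_even: "y (2 * i) = act (g i) (P (x i))" for i by (simp add: y_def)
    have y_odd: "y (Suc (2 * i)) = act (g (Suc i)) (P (x i))" for i by (simp add: y_def)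
    have yX: "y j \<in> X" for j using gc(1) P(1) by (simp add: y_def)
    have even_side: "d (y (2 * i)) (y (Suc (2 * i))) = nat \<bar>n i\<bar> * l (x i)" if "i < k" for i
      using gS[OF that] y_even y_odd gc(1)[of i] v(1)[of "x i"] P by (simp add: act_mult l_def)
    have odd_side: "d (y (Suc (2 * i))) (y (Suc (Suc (2 * i)))) \<le> K" for i
      using y_odd[of i] y_even[of "Suc i"] gc(1)[of "Suc i"] P(1) PP by simp
    define h where "h = (\<lambda>i. g i \<otimes> v (x i) \<otimes> inv (g i))"
    have hH: "h i \<in> H" for i
      unfolding h_def using subgroup.m_closed[OF H(1)] subgroup.m_inv_closed[OF H(1)] gc(2) v(2) by blast
    have hact: "act (h i [^] m) (y (2 * i)) = act (g i) (act (v (x i) [^] m) (P (x i)))" for i and m :: int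
      using int_pow_conj[OF gc(1)[of i] v(1)[of "x i"], of m] gc(1)[of i] v(1)[of "x i"] P(1)
      by (simp add: h_def y_even act_mult)
    have hax: "disp (y (2 * i)) (h i [^] m) = nat \<bar>m\<bar> * l (x i)" for i and m :: int
      unfolding hact using y_even gc(1)[of i] v(1)[of "x i"] P by (simp add: l_def)
    have hside: "act (h i [^] n i) (y (2 * i)) = y (Suc (2 * i))" if "i < k" for i
      unfolding hact using y_odd gS[OF that] gc(1)[of i] v(1)[of "x i"] P(1) by (simp add: act_mult)
    have not_comm: "h i \<otimes> h j \<noteq> h j \<otimes> h i" if "i < j" "j < k" for i j
    proof -
      have "s = take i s @ (x i, n i) # take (j - Suc i) (drop (Suc i) s) @ (x j, n j) # drop (Suc j) s"
      proof -
        have "s = take i s @ s ! i # drop (Suc i) s" using that by (simp add: id_take_nth_drop k_def)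
        moreover have "drop (Suc i) s = take (j - Suc i) (drop (Suc i) s) @ s ! j # drop (Suc j) s"
          using id_take_nth_drop[of "j - Suc i" "drop (Suc i) s"] that by (simp add: k_def)
        ultimately show ?thesis by (simp add: x_def n_def)
      qed
      moreover have "take i s @ (x i, n i) # take (j - Suc i) (drop (Suc i) s) = take j s"
      proof -
        have "take j s = take i (take j s) @ take j s ! i # drop (Suc i) (take j s)"
          using id_take_nth_drop[of i "take j s"] that by (simp add: k_def)
        then show ?thesis using that by (simp add: x_def n_def drop_take min_def)
      qed
      ultimately show ?thesis
        using syllable_conjugates_not_commute[OF c free s, of "take i s" "x i" "n i"
            "take (j - Suc i) (drop (Suc i) s)" "x j" "n j" "drop (Suc j) s"]
        by (simp add: h_def g_def v_def)
    qed
    have overlap: "d u w \<le> \<delta>" if ij: "i < j" "j < 2 * k" and uw: "u \<in> X" "w \<in> X"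
      and on: "on_side y i u" "on_side y i w" "on_side y j u" "on_side y j w" for i j u w
    proof -
      have side: "d u w \<le> d (y m) (y (Suc m))" if "on_side y m u" "on_side y m w" for m
        using btw_dist_le[OF yX yX uw] that by (simp add: on_side_def)
      have odd: "d u w \<le> \<delta>" if "odd m" "on_side y m u" "on_side y m w" for m
      proof -
        have "m = Suc (2 * (m div 2))" using that(1) by presburger
        then obtain m' where "m = Suc (2 * m')" by blast
        then show ?thesis using side[OF that(2,3)] odd_side[of m'] by (simp add: \<delta>_def)
      qed
      show ?thesis
      proof (cases "odd i \<or> odd j")
        case True
        then show ?thesis using odd on by blast
      next
        case False
        then obtain i' j' where ij': "i = 2 * i'" "j = 2 * j'" by (auto elim!: evenE)
        then have lt: "i' < j'" "j' < k" "i' < k" using ij by simp_all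
        have on': "btw (y (2 * i')) u (act (h i' [^] n i') (y (2 * i')))"
          "btw (y (2 * i')) w (act (h i' [^] n i') (y (2 * i')))"
          "btw (y (2 * j')) u (act (h j' [^] n j') (y (2 * j')))"
          "btw (y (2 * j')) w (act (h j' [^] n j') (y (2 * j')))"
          using on hside lt by (simp_all add: on_side_def ij')
        have "\<not> l (x i') + l (x j') \<le> d u w"
          using axis_overlap_commute[OF H hH hH yX yX hax hax uw on'] not_comm[OF lt(1,2)] by blast
        moreover have "l z \<le> l True + l False" for z by (cases z) simp_all
        then have "l (x i') \<le> l True + l False" "l (x j') \<le> l True + l False" by blast+
        ultimately show ?thesis by (simp add: \<delta>_def)
      qed
    qed
    have "(\<Sum>j<2 * k. d (y j) (y (Suc j))) \<le> d (y 0) (y (2 * k)) + 4 * \<delta> * (2 * k)"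
      using bounded_overlap_length[of "2 * k" y \<delta>, OF yX overlap] .
    moreover have "(\<Sum>i<m. nat \<bar>n i\<bar> * l (x i)) \<le> (\<Sum>j<2 * m. d (y j) (y (Suc j)))" if "m \<le> k" for m
      using that by (induction m) (simp_all add: even_side)
    then have "(\<Sum>i<k. nat \<bar>n i\<bar> * l (x i)) \<le> (\<Sum>j<2 * k. d (y j) (y (Suc j)))" by blast
    moreover have "(\<Sum>q\<leftarrow>s. nat \<bar>snd q\<bar> * l (fst q)) = (\<Sum>i<k. nat \<bar>n i\<bar> * l (x i))"
      by (simp add: sum_list_sum_nth atLeast0LessThan k_def n_def x_def)
    moreover have "d (y 0) (y (2 * k)) \<le> disp bp (syllable_prod a b s) + 2 * M"
    proof -
      define e where "e = syllable_prod a b s"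
      have e: "e \<in> carrier G" using c by (simp add: e_def)
      have y0: "y 0 = P (x 0)" using P(1) by (simp add: y_def g_def)
      have y2: "y (2 * k) = act e (P (x k))" unfolding y_even by (simp add: g_def k_def e_def)
      have X: "act e bp \<in> X" "y 0 \<in> X" "y (2 * k) \<in> X" using e bp yX by simp_all
      have "d (y 0) (y (2 * k)) \<le> d (y 0) bp + d bp (y (2 * k))" using d_tri[OF X(2) bp X(3)] .
      moreover have "d bp (y (2 * k)) \<le> disp bp e + d (act e bp) (y (2 * k))" using d_tri[OF bp X(1,3)] .
      moreover have "d (act e bp) (y (2 * k)) = d bp (P (x k))" using y2 e bp P(1) by simp
      moreover have "d (y 0) bp = d bp (P (x 0))" using y0 d_sym[OF P(1) bp] by simp
      ultimately show ?thesis using oP[of "x 0"] oP[of "x k"] by (simp add: e_def)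
    qed
    moreover have "2 * M \<le> 2 * M * (k + 1)" by simp
    ultimately have "(\<Sum>q\<leftarrow>s. nat \<bar>snd q\<bar> * l (fst q)) \<le> disp bp (syllable_prod a b s) + 2 * M * (k + 1) + 8 * \<delta> * k"
      by linarith
    then show ?thesis by (simp add: k_def algebra_simps)
  qed
  show ?thesis
  proof (intro exI conjI allI impI)
    show "1 \<le> l x" if "\<forall>p\<in>X. act (if x then a else b) p \<noteq> p" for x
      by (rule l) (rule that[rule_format])
  qed (rule main)
qed

end

section \<open>Trees of lists\<close>

definition lcp :: "'l list \<Rightarrow> 'l list \<Rightarrow> nat" where
  "lcp s t = Max {k. k \<le> length s \<and> k \<le> length t \<and> take k s = take k t}"

lemma lcp_ge_iff: "k \<le> lcp s t \<longleftrightarrow> k \<le> length s \<and> k \<le> length t \<and> take k s = take k t"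
proof -
  let ?K = "{k. k \<le> length s \<and> k \<le> length t \<and> take k s = take k t}"
  have fin: "finite ?K" by (rule finite_subset[of _ "{..length s}"]) auto
  have "lcp s t \<in> ?K" unfolding lcp_def by (rule Max_in[OF fin]) auto
  moreover have "take k s = take k t" if "k \<le> m" "take m s = take m t" for k m
    using arg_cong[OF that(2), of "take k"] that(1) by (simp add: min_absorb1)
  ultimately show ?thesis using Max_ge[OF fin, of k] unfolding lcp_def[symmetric]
    by (auto intro: order_trans)
qed

lemma lcp_le: "lcp s t \<le> length s" "lcp s t \<le> length t"
  using lcp_ge_iff[of "lcp s t" s t] by simp_all

lemma lcp_eqI: "(\<And>k. k \<le> lcp s t \<longleftrightarrow> k \<le> m) \<Longrightarrow> lcp s t = m"
  using nat_le_iff_add by (metis order_antisym order_refl)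

lemma lcp_sym: "lcp s t = lcp t s"
  by (rule lcp_eqI) (auto simp: lcp_ge_iff)

lemma lcp_self [simp]: "lcp s s = length s"
  by (rule lcp_eqI) (auto simp: lcp_ge_iff)

lemma lcp_Nil [simp]: "lcp [] t = 0" "lcp t [] = 0"
  using lcp_le[of "[]" t] lcp_le[of t "[]"] by auto

lemma lcp_Cons [simp]: "lcp (x # s) (y # t) = (if x = y then Suc (lcp s t) else 0)"
proof (rule lcp_eqI)
  fix k show "k \<le> lcp (x # s) (y # t) \<longleftrightarrow> k \<le> (if x = y then Suc (lcp s t) else 0)"
    by (cases k) (simp_all add: lcp_ge_iff)
qed

lemma lcp_take: "lcp (take k s) t = min k (lcp s t)"
proof (rule lcp_eqI)
  fix n show "n \<le> lcp (take k s) t \<longleftrightarrow> n \<le> min k (lcp s t)"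
    by (cases "n \<le> k") (simp_all add: lcp_ge_iff min_absorb1)
qed

lemma lcp_map: "inj_on f (set s \<union> set t) \<Longrightarrow> lcp (map f s) (map f t) = lcp s t"
proof (induction s arbitrary: t)
  case (Cons x s)
  then show ?case by (cases t) (auto simp: inj_on_def)
qed simp

lemma lcp_ultra: "lcp s t \<le> lcp s r \<or> lcp t r \<le> lcp s r"
proof -
  have "min (lcp s t) (lcp t r) \<le> lcp s r"
  proof -
    define k where "k = min (lcp s t) (lcp t r)"
    have "k \<le> lcp s t" "k \<le> lcp t r" by (simp_all add: k_def)
    then have "k \<le> lcp s r" unfolding lcp_ge_iff by simp
    then show ?thesis by (simp add: k_def)
  qed
  then show ?thesis by (simp add: min_le_iff_disj)
qed

text \<open>The path metric of the tree in which every nonempty list is joined to its longest proper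
  prefix.\<close>

definition ldist :: "'l list \<Rightarrow> 'l list \<Rightarrow> nat" where
  "ldist s t = length s + length t - 2 * lcp s t"

lemma ldist_eq: "ldist s t + 2 * lcp s t = length s + length t"
  using lcp_le[of s t] by (simp add: ldist_def)

lemma ldist_even: "even (ldist s t) \<longleftrightarrow> even (length s + length t)"
  using arg_cong[OF ldist_eq[of s t], of even] by simp

lemma ldist_sym: "ldist s t = ldist t s"
  by (simp add: ldist_def lcp_sym add.commute)

lemma ldist_Nil [simp]: "ldist [] s = length s"
  by (simp add: ldist_def)

lemma ldist_Cons: "ldist (x # s) (x # t) = ldist s t"
  by (simp add: ldist_def)

lemma ldist_take: "k \<le> length s \<Longrightarrow> lcp s t \<le> k \<Longrightarrow>
    ldist s (take k s) = length s - k \<and> ldist (take k s) t = k + length t - 2 * lcp s t"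
  by (simp add: ldist_def lcp_take lcp_sym[of s "take k s"] min_absorb1 min_absorb2)

text \<open>The four point condition is the ultrametric inequality for common prefixes. Geodesics
  first remove final letters down to the common prefix and then add letters; both phases stay inside
  a prefix-closed set.\<close>

theorem tree_of_lists:
  assumes prefix: "\<And>s k. s \<in> X \<Longrightarrow> take k s \<in> X"
  shows "tree X ldist"
proof
  fix s t :: "'a list"
  show "ldist s t = 0 \<longleftrightarrow> s = t"
  proof
    assume "ldist s t = 0"
    then have "lcp s t = length s" "lcp s t = length t"
      using ldist_eq[of s t] lcp_le[of s t] by linarith+
    then show "s = t" using lcp_ge_iff[of "length s" s t] by simp
  qed (simp add: ldist_def)
  show "ldist s t = ldist t s" by (rule ldist_sym)
next
  fix s t r :: "'a list"
  show "ldist s r \<le> ldist s t + ldist t r"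
    using ldist_eq[of s t] ldist_eq[of t r] ldist_eq[of s r] lcp_ultra[of s t r]
      lcp_le[of s t] lcp_le[of t r] by linarith
  show "even (ldist s t + ldist t r + ldist s r)" by (simp only: ldist_even even_add) auto
next
  fix x y z w :: "'a list"
  have u: "lcp x z \<le> lcp x y \<or> lcp y z \<le> lcp x y" "lcp x w \<le> lcp x y \<or> lcp y w \<le> lcp x y"
    "lcp x z \<le> lcp z w \<or> lcp x w \<le> lcp z w" "lcp y z \<le> lcp z w \<or> lcp y w \<le> lcp z w"
    using lcp_ultra[of x z y] lcp_ultra[of x w y] lcp_ultra[of z x w] lcp_ultra[of z y w]
      lcp_sym[of z y] lcp_sym[of w y] lcp_sym[of z x] by simp_all
  have "lcp x z + lcp y w \<le> lcp x y + lcp z w \<or> lcp x w + lcp y z \<le> lcp x y + lcp z w"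
    using u by (elim disjE; simp add: add_mono disjI1 disjI2; linarith)
  moreover have "ldist x y + ldist z w + 2 * (lcp x y + lcp z w) = ldist x z + ldist y w + 2 * (lcp x z + lcp y w)"
    "ldist x y + ldist z w + 2 * (lcp x y + lcp z w) = ldist x w + ldist y z + 2 * (lcp x w + lcp y z)"
    using ldist_eq[of x y] ldist_eq[of z w] ldist_eq[of x z] ldist_eq[of y w] ldist_eq[of x w] ldist_eq[of y z]
    by simp_all
  ultimately have "ldist x y + ldist z w \<le> ldist x z + ldist y w \<or> ldist x y + ldist z w \<le> ldist x w + ldist y z"
    by (elim disjE) simp_all
  then show "ldist x y + ldist z w \<le> max (ldist x z + ldist y w) (ldist x w + ldist y z)"
    by (simp add: le_max_iff_disj)
next
  fix s t :: "'a list" and k assume X: "s \<in> X" "t \<in> X" and k: "k \<le> ldist s t"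
  show "\<exists>z\<in>X. ldist s z = k \<and> ldist z t = ldist s t - k"
  proof (cases "k \<le> length s - lcp s t")
    case True
    let ?z = "take (length s - k) s"
    have k': "k \<le> length s" "lcp s t \<le> length s - k" using True lcp_le(1)[of s t] by linarith+
    from ldist_take[OF _ k'(2)] have "ldist s ?z = k" "ldist ?z t = length s - k + length t - 2 * lcp s t"
      using k'(1) by simp_all
    then show ?thesis using ldist_eq[of s t] k'(1) by (intro bexI[of _ ?z] prefix X(1)) simp_all
  next
    case False
    define m where "m = lcp s t + (k - (length s - lcp s t))"
    have m: "m \<le> length t" "lcp t s \<le> m"
      using False k ldist_eq[of s t] lcp_le[of s t] by (simp_all add: m_def lcp_sym[of t s])
    from ldist_take[OF m] have "ldist (take m t) t = length t - m" "ldist s (take m t) = m + length s - 2 * lcp s t"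
      by (simp_all add: ldist_sym[of s "take m t"] ldist_sym[of "take m t" t] lcp_sym[of t s])
    moreover have "m + length s - 2 * lcp s t = k" using False lcp_le(1)[of s t] by (simp add: m_def)
    moreover have "length t - m = ldist s t - k" using False lcp_le(1)[of s t] ldist_eq[of s t] k by (simp add: m_def)
    ultimately show ?thesis by (intro bexI[of _ "take m t"] prefix X(2)) simp_all
  qed
qed

text \<open>An orientation of the tree: the ends of an edge have different heights, and each group
  element will change all heights by the same amount. An element inverting an edge would have to
  change heights by 0, which is a contradiction.\<close>

definition height :: "(bool \<times> 'c) list \<Rightarrow> int" where
  "height s = (\<Sum>l\<leftarrow>s. if fst l then 1 else -1)"

lemma height_simps [simp]: "height [] = 0" "height (l # s) = (if fst l then 1 else -1) + height s"
  by (simp_all add: height_def)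

lemma height_append [simp]: "height (s @ t) = height s + height t"
  by (simp add: height_def)

lemma height_adjacent:
  assumes "ldist s t = 1"
  shows "height s \<noteq> height t"
proof -
  have *: "height s \<noteq> height t" if "ldist s t = 1" "length s \<le> length t" for s t :: "(bool \<times> 'c) list"
  proof -
    have l: "lcp s t = length s" "length t = Suc (length s)"
      using ldist_eq[of s t] lcp_le[of s t] that by arith+
    then have "take (length s) t = s" using lcp_ge_iff[of "length s" s t] by simp
    then have "t = s @ [t ! length s]" using l(2) take_Suc_conv_app_nth[of "length s" t] by simp
    then have "height t = height (s @ [t ! length s])" by simp
    then show ?thesis by simp
  qed
  show ?thesis using *[of s t] *[of t s] assms ldist_sym[of s t] by (cases "length s \<le> length t") auto
qed

section \<open>Left multiplication on reduced words\<close>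

definition reduced :: "(bool \<times> 'c) list \<Rightarrow> bool" where
  "reduced s \<longleftrightarrow> successively (\<lambda>i j. j \<noteq> flip i) s"

text \<open>Left multiplication by a letter in a free group. Neighbours in the tree differ in the
  last letter, so this change at the head is an isometry.\<close>

definition push :: "bool \<times> 'c \<Rightarrow> (bool \<times> 'c) list \<Rightarrow> (bool \<times> 'c) list" where
  "push l s = (if s \<noteq> [] \<and> hd s = flip l then tl s else l # s)"

lemma flip_flip [simp]: "flip (flip l) = l" and flip_neq [simp]: "flip l \<noteq> l" "l \<noteq> flip l"
  and flip_eq_iff [simp]: "flip l = flip l' \<longleftrightarrow> l = l'"
  by (auto simp: flip_def prod_eq_iff)

lemma reduced_Nil [simp]: "reduced []"
  by (simp add: reduced_def)

lemma reduced_Cons: "reduced (l # s) \<longleftrightarrow> reduced s \<and> (s = [] \<or> hd s \<noteq> flip l)"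
  by (auto simp: reduced_def successively_Cons)

lemma reduced_take: "reduced s \<Longrightarrow> reduced (take k s)"
  using successively_append_iff[of _ "take k s" "drop k s"] by (simp add: reduced_def)

lemma reduced_push: "reduced s \<Longrightarrow> reduced (push l s)"
  by (cases s) (auto simp: push_def reduced_Cons)

lemma push_push: "reduced s \<Longrightarrow> push (flip l) (push l s) = s"
  by (cases s) (auto simp: push_def reduced_Cons)

lemma ldist_push: "reduced s \<Longrightarrow> reduced t \<Longrightarrow> ldist (push l s) (push l t) = ldist s t"
proof -
  assume r: "reduced s" "reduced t"
  have *: "ldist (push l s) (push l t) = ldist s t" if ne: "s \<noteq> []" "hd s = flip l" and rs: "reduced s" for s t
  proof -
    obtain s' where s: "s = flip l # s'" using ne by (cases s) auto
    have s': "push l s = s'" "s' = [] \<or> hd s' \<noteq> l" using rs by (auto simp: s push_def reduced_Cons)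
    show ?thesis
    proof (cases "t \<noteq> [] \<and> hd t = flip l")
      case True
      then obtain t' where t: "t = flip l # t'" by (cases t) auto
      then show ?thesis using s s' by (simp add: push_def ldist_Cons)
    next
      case False
      then have "lcp s t = 0" using s by (cases t) auto
      moreover have "lcp s' (l # t) = 0" using s'(2) by (cases s') auto
      ultimately show ?thesis using False s s'(1) by (auto simp: push_def ldist_def)
    qed
  qed
  show ?thesis
  proof (cases "s \<noteq> [] \<and> hd s = flip l")
    case True
    then show ?thesis using * r by blast
  next
    case False
    show ?thesis
    proof (cases "t \<noteq> [] \<and> hd t = flip l")
      case True
      then have "ldist (push l t) (push l s) = ldist t s" using * r by blast
      then show ?thesis by (simp add: ldist_sym)
    next
      case f: False
      then show ?thesis using False by (auto simp: push_def ldist_Cons)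
    qed
  qed
qed

lemma height_push: "height (push l s) = height s + (if fst l then 1 else -1)"
  by (cases s) (auto simp: push_def flip_def)

lemma length_push: "length (push l s) \<le> Suc (length s)"
  by (auto simp: push_def)

lemma set_push: "set (push l s) \<subseteq> insert l (set s)"
  by (cases s) (auto simp: push_def)

section \<open>Right-angled Artin groups\<close>

lemma word_cong_fun_eq:
  assumes "(u, v) \<in> word_cong X R"
    and cancel: "\<And>u v e x. \<lbrakk>u \<in> gwords X; v \<in> gwords X; x \<in> X\<rbrakk> \<Longrightarrow> f (u @ [(e, x), (\<not> e, x)] @ v) = f (u @ v)"
    and relation: "\<And>u v r s. \<lbrakk>(r, s) \<in> R; u \<in> gwords X; v \<in> gwords X; r \<in> gwords X; s \<in> gwords X\<rbrakk> \<Longrightarrow>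
      f (u @ r @ v) = f (u @ s @ v)"
  shows "f u = f v"
  using assms(1)
proof (induction rule: word_cong.induct)
  case (relation r s u v)
  then show ?case using assms(3)[of r s u v] by simp
qed (use cancel in auto)

definition commutations :: "('v \<Rightarrow> 'v \<Rightarrow> bool) \<Rightarrow> ('v gword \<times> 'v gword) set" where
  "commutations E = {([(True, u), (True, v)], [(True, v), (True, u)]) |u v. E u v}"

locale artin = group G
  for G :: "'v gword set monoid" (structure) and V :: "'v set" and E :: "'v \<Rightarrow> 'v \<Rightarrow> bool" +
  assumes G_def: "G = presented_group V (commutations E)"
    and finite_V: "finite V"
    and E_sym: "E u v \<Longrightarrow> E v u"
    and E_irrefl: "\<not> E v v"
begin

abbreviation R where "R \<equiv> commutations E"

definition word_class :: "'v gword \<Rightarrow> 'v gword set" where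
  "word_class w = word_cong V R `` {w}"

lemma word_class_closed [simp]: "w \<in> gwords V \<Longrightarrow> word_class w \<in> carrier G"
  by (simp add: G_def word_class_def presented_group_class_in_carrier)

lemma word_class_append: "\<lbrakk>u \<in> gwords V; v \<in> gwords V\<rbrakk> \<Longrightarrow> word_class (u @ v) = word_class u \<otimes> word_class v"
  by (simp add: G_def word_class_def mult_presented_group)

lemma word_class_Nil: "word_class [] = \<one>"
  by (simp add: G_def word_class_def one_presented_group)

lemma word_class_Cons: "\<lbrakk>snd l \<in> V; w \<in> gwords V\<rbrakk> \<Longrightarrow> word_class (l # w) = word_class [l] \<otimes> word_class w"
  using word_class_append[of "[l]" w] by (cases l) simp

lemma word_class_ex: "g \<in> carrier G \<Longrightarrow> \<exists>w\<in>gwords V. g = word_class w"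
  unfolding G_def word_class_def by (elim presented_group_cases) blast

lemma word_class_eqI: "(u, v) \<in> word_cong V R \<Longrightarrow> word_class u = word_class v"
  unfolding word_class_def by (rule equiv_class_eq[OF equiv_word_cong])

lemma word_class_eqD: "\<lbrakk>word_class u = word_class v; v \<in> gwords V\<rbrakk> \<Longrightarrow> (u, v) \<in> word_cong V R"
  unfolding word_class_def by (rule eq_equiv_class[OF _ equiv_word_cong])

lemma word_class_letter_inv:
  assumes "x \<in> V"
  shows "word_class [(\<not> e, x)] = inv (word_class [(e, x)])"
proof -
  have "word_class ([(\<not> e, x)] @ [(e, x)]) = word_class []"
    using word_cong.cancel[of "[]" V "[]" x "\<not> e" R] assms by (intro word_class_eqI) simp
  then have "word_class [(\<not> e, x)] \<otimes> word_class [(e, x)] = \<one>"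
    using word_class_append[of "[(\<not> e, x)]" "[(e, x)]"] assms by (simp add: word_class_Nil)
  then show ?thesis using assms by (intro inv_equality[symmetric]) auto
qed

section \<open>Retractions killing a set of vertices\<close>

definition rep :: "'v gword set \<Rightarrow> 'v gword" where
  "rep g = (SOME w. w \<in> gwords V \<and> g = word_class w)"

lemma rep: "g \<in> carrier G \<Longrightarrow> rep g \<in> gwords V \<and> g = word_class (rep g)"
  using someI_ex[of "\<lambda>w. w \<in> gwords V \<and> g = word_class w"] word_class_ex unfolding rep_def by blast

lemma rep_word_class: "w \<in> gwords V \<Longrightarrow> (rep (word_class w), w) \<in> word_cong V R"
  using rep[OF word_class_closed] by (intro word_class_eqD) auto

definition erase :: "'v set \<Rightarrow> 'v gword \<Rightarrow> 'v gword" where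
  "erase W w = filter (\<lambda>l. snd l \<notin> W) w"

definition kill :: "'v set \<Rightarrow> 'v gword set \<Rightarrow> 'v gword set" where
  "kill W g = word_class (erase W (rep g))"

lemma gwords_iff: "w \<in> gwords X \<longleftrightarrow> snd ` set w \<subseteq> X"
  by (induction w) (auto simp: gwords_def)

lemma erase_simps [simp]:
  "erase W [] = []" "erase W (l # w) = (if snd l \<in> W then erase W w else l # erase W w)"
  "erase W (u @ w) = erase W u @ erase W w"
  by (simp_all add: erase_def)

lemma erase_gwords: "w \<in> gwords X \<Longrightarrow> erase W w \<in> gwords (X - W)"
  by (auto simp: gwords_iff erase_def)

lemma erase_gwords' [simp]: "w \<in> gwords V \<Longrightarrow> erase W w \<in> gwords V"
  by (auto simp: gwords_iff erase_def)

lemma erase_erase: "erase W (erase W' w) = erase (W \<union> W') w"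
  by (simp add: erase_def conj_commute)

lemma erase_id: "\<lbrakk>w \<in> gwords X; X \<inter> W = {}\<rbrakk> \<Longrightarrow> erase W w = w"
  by (auto simp: gwords_iff erase_def filter_id_conv)

lemma length_erase: "length (erase W w) \<le> length w"
  by (simp add: erase_def)

text \<open>Erasing letters respects the presentation: a commutation that loses a letter turns into
  an equality of words, and every other one survives unchanged.\<close>

lemma kill_word_class: "w \<in> gwords V \<Longrightarrow> kill W (word_class w) = word_class (erase W w)"
  unfolding kill_def
proof (rule word_cong_fun_eq[OF rep_word_class, of w "\<lambda>w. word_class (erase W w)"])
  fix u v e x assume uv: "u \<in> gwords V" "v \<in> gwords V" "x \<in> V"
  have "(erase W u @ [(e, x), (\<not> e, x)] @ erase W v, erase W u @ erase W v) \<in> word_cong V R"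
    using uv by (intro word_cong.cancel) simp_all
  from word_class_eqI[OF this]
  show "word_class (erase W (u @ [(e, x), (\<not> e, x)] @ v)) = word_class (erase W (u @ v))" by simp
next
  fix u v r s assume uv: "(r, s) \<in> R" "u \<in> gwords V" "v \<in> gwords V" "r \<in> gwords V" "s \<in> gwords V"
  obtain a b where rs: "r = [(True, a), (True, b)]" "s = [(True, b), (True, a)]"
    using uv(1) by (auto simp: commutations_def)
  show "word_class (erase W (u @ r @ v)) = word_class (erase W (u @ s @ v))"
  proof (cases "a \<in> W \<or> b \<in> W")
    case True
    then show ?thesis by (auto simp: rs)
  next
    case False
    have "(erase W u @ r @ erase W v, erase W u @ s @ erase W v) \<in> word_cong V R"
      using uv by (intro word_cong.relation) simp_all
    from word_class_eqI[OF this] show ?thesis using False by (simp add: rs)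
  qed
qed

lemma kill_closed [simp]: "g \<in> carrier G \<Longrightarrow> kill W g \<in> carrier G"
  using rep[of g] by (simp add: kill_def)

lemma kill_mult: "\<lbrakk>g \<in> carrier G; h \<in> carrier G\<rbrakk> \<Longrightarrow> kill W (g \<otimes> h) = kill W g \<otimes> kill W h"
proof -
  assume "g \<in> carrier G" "h \<in> carrier G"
  then obtain u v where uv: "u \<in> gwords V" "g = word_class u" "v \<in> gwords V" "h = word_class v" using word_class_ex by blast
  then show ?thesis by (simp add: word_class_append[symmetric] kill_word_class)
qed

lemma group_hom_kill: "group_hom G G (kill W)"
  by (intro group_hom.intro group_hom_axioms.intro is_group homI) (auto simp: kill_mult)

lemma kill_one [simp]: "kill W \<one> = \<one>"
  using group_hom.hom_one[OF group_hom_kill] .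

lemma kill_inv: "g \<in> carrier G \<Longrightarrow> kill W (inv g) = inv (kill W g)"
  using group_hom.hom_inv[OF group_hom_kill] .

lemma kill_kill: "g \<in> carrier G \<Longrightarrow> kill W (kill W' g) = kill (W \<union> W') g"
  using rep[of g] by (metis kill_word_class erase_erase erase_gwords')

lemma kill_commute: "g \<in> carrier G \<Longrightarrow> kill W (kill W' g) = kill W' (kill W g)"
  by (simp add: kill_kill Un_commute)

lemma kill_V: "g \<in> carrier G \<Longrightarrow> kill V g = \<one>"
proof -
  assume "g \<in> carrier G"
  then obtain w where "w \<in> gwords V" "g = word_class w" using word_class_ex by blast
  moreover have "erase V w = []" using calculation(1) by (auto simp: gwords_iff erase_def filter_empty_conv)
  ultimately show ?thesis by (simp add: kill_word_class word_class_Nil)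
qed

lemma kill_empty: "g \<in> carrier G \<Longrightarrow> kill {} g = g"
  using rep[of g] by (simp add: kill_def erase_def)

lemma kill_finite_union:
  assumes "finite W" "g \<in> carrier G" "\<And>w. w \<in> W \<Longrightarrow> kill {w} g = g"
  shows "kill W g = g"
  using assms
proof (induction W rule: finite_induct)
  case empty
  then show ?case by (simp add: kill_empty)
next
  case (insert w W)
  then show ?case using kill_kill[of g "{w}" W] by simp
qed

section \<open>Special subgroups\<close>

definition parabolic :: "'v set \<Rightarrow> 'v gword set set" where
  "parabolic \<Lambda> = word_class ` gwords \<Lambda>"

lemma gwords_mono: "w \<in> gwords X \<Longrightarrow> X \<subseteq> Y \<Longrightarrow> w \<in> gwords Y"
  by (auto simp: gwords_iff)

lemma parabolic_closed: "\<Lambda> \<subseteq> V \<Longrightarrow> g \<in> parabolic \<Lambda> \<Longrightarrow> g \<in> carrier G"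
  using gwords_mono[of _ \<Lambda> V] by (auto simp: parabolic_def)

lemma parabolic_mono: "\<Lambda> \<subseteq> \<Lambda>' \<Longrightarrow> parabolic \<Lambda> \<subseteq> parabolic \<Lambda>'"
  using gwords_mono by (fastforce simp: parabolic_def)

lemma parabolic_V: "parabolic V = carrier G"
  using word_class_ex by (auto simp: parabolic_def)

text \<open>A special subgroup is the image of an idempotent endomorphism and hence its fixed set;
  membership becomes an equation.\<close>

lemma parabolic_iff:
  assumes "\<Lambda> \<subseteq> V"
  shows "g \<in> parabolic \<Lambda> \<longleftrightarrow> g \<in> carrier G \<and> kill (V - \<Lambda>) g = g"
proof
  assume "g \<in> parabolic \<Lambda>"
  then obtain w where w: "w \<in> gwords \<Lambda>" "g = word_class w" by (auto simp: parabolic_def)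
  then have "erase (V - \<Lambda>) w = w" by (intro erase_id[of w \<Lambda>]) auto
  then show "g \<in> carrier G \<and> kill (V - \<Lambda>) g = g" using w gwords_mono[OF w(1) assms] by (simp add: kill_word_class)
next
  assume g: "g \<in> carrier G \<and> kill (V - \<Lambda>) g = g"
  then obtain w where w: "w \<in> gwords V" "g = word_class w" using word_class_ex by blast
  then have "g = word_class (erase (V - \<Lambda>) w)" using g by (simp add: kill_word_class)
  moreover have "erase (V - \<Lambda>) w \<in> gwords \<Lambda>" using erase_gwords[OF w(1), of "V - \<Lambda>"] assms
    by (simp add: Diff_Diff_Int inf.absorb2)
  ultimately show "g \<in> parabolic \<Lambda>" by (auto simp: parabolic_def)
qed

lemma parabolic_single_kill: "\<lbrakk>\<Lambda> \<subseteq> V; g \<in> parabolic \<Lambda>; w \<notin> \<Lambda>\<rbrakk> \<Longrightarrow> kill {w} g = g"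
proof -
  assume a: "\<Lambda> \<subseteq> V" "g \<in> parabolic \<Lambda>" "w \<notin> \<Lambda>"
  then obtain u where u: "u \<in> gwords \<Lambda>" "g = word_class u" by (auto simp: parabolic_def)
  then have "erase {w} u = u" using a by (intro erase_id[of u \<Lambda>]) auto
  then show ?thesis using u gwords_mono[OF u(1) a(1)] by (simp add: kill_word_class)
qed

lemma parabolic_kill: "\<lbrakk>\<Lambda> \<subseteq> V; g \<in> parabolic \<Lambda>\<rbrakk> \<Longrightarrow> kill W g \<in> parabolic (\<Lambda> - W)"
proof -
  assume a: "\<Lambda> \<subseteq> V" "g \<in> parabolic \<Lambda>"
  then obtain u where u: "u \<in> gwords \<Lambda>" "g = word_class u" by (auto simp: parabolic_def)
  then show ?thesis using erase_gwords[OF u(1)] gwords_mono[OF u(1) a(1)] by (auto simp: kill_word_class parabolic_def)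
qed

text \<open>Special subgroups are intersections of fixed sets of single-vertex retractions. This
  allows the root argument to treat the subgroup of a link one vertex at a time.\<close>

lemma parabolic_memI:
  assumes "\<Lambda> \<subseteq> V" "g \<in> carrier G" "\<And>w. w \<in> V - \<Lambda> \<Longrightarrow> kill {w} g = g"
  shows "g \<in> parabolic \<Lambda>"
  using kill_finite_union[of "V - \<Lambda>" g] assms finite_V by (simp add: parabolic_iff)

lemma parabolic_subgroup:
  assumes "\<Lambda> \<subseteq> V"
  shows "subgroup (parabolic \<Lambda>) G"
proof (rule subgroupI)
  show "parabolic \<Lambda> \<subseteq> carrier G" using parabolic_closed[OF assms] by blast
  show "parabolic \<Lambda> \<noteq> {}" using gwords_Nil[of \<Lambda>] unfolding parabolic_def by blast
  show "inv g \<in> parabolic \<Lambda>" if "g \<in> parabolic \<Lambda>" for g using that assms by (simp add: parabolic_iff kill_inv)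
  show "g \<otimes> h \<in> parabolic \<Lambda>" if "g \<in> parabolic \<Lambda>" "h \<in> parabolic \<Lambda>" for g h
    using that assms by (simp add: parabolic_iff kill_mult)
qed

section \<open>Word length in the standard generators\<close>

definition len :: "'v gword set \<Rightarrow> nat" where
  "len g = (LEAST n. \<exists>w\<in>gwords V. g = word_class w \<and> length w = n)"

lemma len_le: "w \<in> gwords V \<Longrightarrow> len (word_class w) \<le> length w"
  unfolding len_def by (rule Least_le) blast

lemma len_ex: "g \<in> carrier G \<Longrightarrow> \<exists>w\<in>gwords V. g = word_class w \<and> length w = len g"
  unfolding len_def by (rule LeastI_ex) (use word_class_ex in blast)

lemma len_kill_le: "g \<in> carrier G \<Longrightarrow> len (kill W g) \<le> len g"
proof -
  assume "g \<in> carrier G"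
  then obtain w where w: "w \<in> gwords V" "g = word_class w" "length w = len g" using len_ex by blast
  then show ?thesis using len_le[of "erase W w"] length_erase[of W w] by (simp add: kill_word_class)
qed

lemma len_mult_le: "\<lbrakk>g \<in> carrier G; h \<in> carrier G\<rbrakk> \<Longrightarrow> len (g \<otimes> h) \<le> len g + len h"
proof -
  assume "g \<in> carrier G" "h \<in> carrier G"
  then obtain u v where uv: "u \<in> gwords V" "g = word_class u" "length u = len g" "v \<in> gwords V" "h = word_class v" "length v = len h"
    using len_ex by metis
  then show ?thesis using len_le[of "u @ v"] by (simp add: word_class_append)
qed

definition link :: "'v \<Rightarrow> 'v set" where
  "link v = {u \<in> V. E u v}"

lemma link_subset: "link v \<subseteq> V - {v}" "link v \<subseteq> V"
  using E_irrefl by (auto simp: link_def)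

lemma link_commute:
  assumes "v \<in> V" "l \<in> parabolic (link v)"
  shows "l \<otimes> word_class [(e, v)] = word_class [(e, v)] \<otimes> l"
proof -
  have t: "word_class [(True, v)] \<in> carrier G" using assms(1) by simp
  have pos: "word_class [(True, u)] \<otimes> word_class [(True, v)] = word_class [(True, v)] \<otimes> word_class [(True, u)]" if "u \<in> link v" for u
  proof -
    have u: "u \<in> V" "E u v" using that by (auto simp: link_def)
    then have "([(True, u), (True, v)], [(True, v), (True, u)]) \<in> R" by (auto simp: commutations_def)
    from word_class_eqI[OF word_cong.relation[OF this, of "[]" "[]"]]
    have "word_class ([(True, u)] @ [(True, v)]) = word_class ([(True, v)] @ [(True, u)])" using u assms(1) by simp
    then show ?thesis using u assms(1) by (simp only: word_class_append gwords_Cons gwords_Nil simp_thms)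
  qed
  have letter: "word_class [(f, u)] \<otimes> word_class [(True, v)] = word_class [(True, v)] \<otimes> word_class [(f, u)]" if "u \<in> link v" for f u
  proof (cases f)
    case True
    then show ?thesis using pos[OF that] by simp
  next
    case False
    have u: "u \<in> V" using that by (simp add: link_def)
    have ui: "word_class [(False, u)] = inv (word_class [(True, u)])" using word_class_letter_inv[OF u, of True] by simp
    have "inv (inv (word_class [(True, u)])) \<otimes> word_class [(True, v)] = word_class [(True, v)] \<otimes> inv (inv (word_class [(True, u)]))"
      using pos[OF that] u by simp
    from commute_inv[OF _ t this] show ?thesis using False u by (simp add: ui)
  qed
  obtain w where w: "w \<in> gwords (link v)" "l = word_class w" using assms(2) by (auto simp: parabolic_def)
  have comm: "l \<otimes> word_class [(True, v)] = word_class [(True, v)] \<otimes> l"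
    using w(1) unfolding w(2)
  proof (induction w)
    case Nil
    then show ?case using t by (simp add: word_class_Nil)
  next
    case (Cons q w)
    obtain f u where q: "q = (f, u)" by fastforce
    have u: "u \<in> link v" "w \<in> gwords (link v)" using Cons.prems q by auto
    have uV: "u \<in> V" "w \<in> gwords V" using u link_subset(2) gwords_mono by blast+
    have "word_class (q # w) \<otimes> word_class [(True, v)] = word_class [(f, u)] \<otimes> (word_class w \<otimes> word_class [(True, v)])"
      using word_class_Cons[of q w] uV t by (simp add: q m_assoc)
    also have "\<dots> = (word_class [(f, u)] \<otimes> word_class [(True, v)]) \<otimes> word_class w"
      using Cons.IH[OF u(2)] uV t by (simp add: m_assoc)
    also have "\<dots> = word_class [(True, v)] \<otimes> word_class (q # w)"
      using letter[OF u(1)] word_class_Cons[of q w] uV t by (simp add: q m_assoc)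
    finally show ?case .
  qed
  show ?thesis
  proof (cases e)
    case True
    then show ?thesis using comm by simp
  next
    case False
    have l: "l \<in> carrier G" using parabolic_closed[OF link_subset(2) assms(2)] .
    have ti: "word_class [(False, v)] = inv (word_class [(True, v)])" using word_class_letter_inv[OF assms(1), of True] by simp
    have "inv (inv (word_class [(True, v)])) \<otimes> l = l \<otimes> inv (inv (word_class [(True, v)]))" using comm t by simp
    from commute_inv[OF _ l this] show ?thesis using False t by (simp add: ti)
  qed
qed

end

section \<open>The tree of a vertex\<close>

locale artin_vertex = artin +
  fixes v
  assumes v: "v \<in> V"
begin

definition L where "L = parabolic (link v)"

text \<open>These index the conjugates of \<open>v\<close>: the conjugate by \<open>y\<close>
  depends only on \<open>y <# L\<close>, since \<open>L\<close> commutes with \<open>v\<close>. The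
  parameter \<Lambda> serves to follow elements of a special subgroup.\<close>

definition cosets :: "'a set \<Rightarrow> 'a gword set set set" where
  "cosets \<Lambda> = (\<lambda>y. y <# L) ` parabolic (\<Lambda> - {v})"

abbreviation Q where "Q \<equiv> parabolic (V - {v})"

definition X :: "(bool \<times> 'a gword set set) list set" where
  "X = {s. snd ` set s \<subseteq> cosets V \<and> reduced s}"

definition shift where
  "shift q s = map (map_prod id (\<lambda>c. q <# c)) s"

text \<open>The kernel acts on its Cayley tree by left multiplication and \<open>Q\<close> by
  conjugation. So \<open>v\<close> multiplies by its own letter, the coset \<open>L\<close>, while
  every other vertex permutes the letters, as conjugating by \<open>q\<close> turns the conjugate of
  \<open>v\<close> by \<open>y\<close> into the one by \<open>q \<otimes> y\<close>.\<close>

definition lact where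
  "lact l s = (if snd l = v then push (fst l, L) s else shift (word_class [l]) s)"

definition wact where
  "wact w s = foldr lact w s"

definition act where
  "act g s = wact (rep g) s"

lemma sub: "subgroup L G" "subgroup Q G"
  using parabolic_subgroup link_subset by (auto simp: L_def)

lemma Q_closed: "q \<in> Q \<Longrightarrow> q \<in> carrier G"
  using parabolic_closed[of "V - {v}"] by blast

lemma L_sub_Q: "L \<subseteq> Q"
  using parabolic_mono link_subset by (auto simp: L_def)

lemma L_closed: "l \<in> L \<Longrightarrow> l \<in> carrier G"
  using L_sub_Q Q_closed by blast

lemma lcos_L_iff: "z \<in> carrier G \<Longrightarrow> z <# L = L \<longleftrightarrow> z \<in> L"
proof
  assume z: "z \<in> carrier G" "z <# L = L"
  have "z \<otimes> \<one> \<in> z <# L" using subgroup.one_closed[OF sub(1)] by (auto simp: l_coset_def)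
  then show "z \<in> L" using z by simp
next
  assume z: "z \<in> carrier G" "z \<in> L"
  show "z <# L = L"
  proof
    show "z <# L \<subseteq> L" using z subgroup.m_closed[OF sub(1)] by (auto simp: l_coset_def)
    show "L \<subseteq> z <# L"
    proof
      fix l assume l: "l \<in> L"
      then have "inv z \<otimes> l \<in> L" using z subgroup.m_closed[OF sub(1)] subgroup.m_inv_closed[OF sub(1)] by blast
      moreover have "l = z \<otimes> (inv z \<otimes> l)" using z L_closed[OF l] by (simp add: m_assoc[symmetric])
      ultimately show "l \<in> z <# L" by (auto simp: l_coset_def)
    qed
  qed
qed

lemma L_subset: "L \<subseteq> carrier G" using L_closed by blast

lemma cosets_closed: "c \<in> cosets V \<Longrightarrow> c \<subseteq> carrier G"
  using l_coset_subset_G[OF L_subset] Q_closed by (auto simp: cosets_def)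

lemma cosets_mono: "\<Lambda> \<subseteq> \<Lambda>' \<Longrightarrow> cosets \<Lambda> \<subseteq> cosets \<Lambda>'"
  using parabolic_mono[of "\<Lambda> - {v}" "\<Lambda>' - {v}"] by (auto simp: cosets_def)

lemma cosets_lcos: "\<lbrakk>\<Lambda> \<subseteq> V; q \<in> parabolic (\<Lambda> - {v}); c \<in> cosets \<Lambda>\<rbrakk> \<Longrightarrow> q <# c \<in> cosets \<Lambda>"
proof -
  assume a: "\<Lambda> \<subseteq> V" "q \<in> parabolic (\<Lambda> - {v})" "c \<in> cosets \<Lambda>"
  have s: "\<Lambda> - {v} \<subseteq> V" using a(1) by blast
  obtain y where y: "y \<in> parabolic (\<Lambda> - {v})" "c = y <# L" using a(3) by (auto simp: cosets_def)
  have "q <# c = (q \<otimes> y) <# L"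
    using y(2) lcos_m_assoc[OF L_subset] parabolic_closed[OF s] a(2) y(1) by simp
  then show ?thesis using subgroup.m_closed[OF parabolic_subgroup[OF s] a(2) y(1)] by (auto simp: cosets_def)
qed

lemma lcos_cancel:
  assumes "y \<in> carrier G" "M \<subseteq> carrier G" "M' \<subseteq> carrier G"
  shows "inv y <# M = inv y <# M' \<longleftrightarrow> M = M'"
proof
  assume "inv y <# M = inv y <# M'"
  then have "y <# (inv y <# M) = y <# (inv y <# M')" by simp
  then show "M = M'" using assms by (simp add: lcos_m_assoc lcos_mult_one)
qed simp

lemma L_in_cosets: "\<Lambda> \<subseteq> V \<Longrightarrow> L \<in> cosets \<Lambda>"
proof -
  assume "\<Lambda> \<subseteq> V"
  then have "\<one> \<in> parabolic (\<Lambda> - {v})" by (intro subgroup.one_closed parabolic_subgroup) blast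
  moreover have "\<one> <# L = L" using lcos_mult_one[OF L_subset] .
  ultimately show ?thesis by (force simp: cosets_def)
qed

lemma lcos_inj: "\<lbrakk>q \<in> carrier G; c \<in> cosets V; c' \<in> cosets V\<rbrakk> \<Longrightarrow> q <# c = q <# c' \<longleftrightarrow> c = c'"
proof
  assume a: "q \<in> carrier G" "c \<in> cosets V" "c' \<in> cosets V" and "q <# c = q <# c'"
  then have "inv q <# (q <# c) = inv q <# (q <# c')" by simp
  then show "c = c'"
    using a lcos_m_assoc[OF cosets_closed] lcos_mult_one[OF cosets_closed] by simp
qed simp

lemma X_iff: "s \<in> X \<longleftrightarrow> snd ` set s \<subseteq> cosets V \<and> reduced s"
  by (simp add: X_def)

lemma Nil_X [simp]: "[] \<in> X"
  by (simp add: X_iff)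

lemma X_Cons: "l # s \<in> X \<longleftrightarrow> snd l \<in> cosets V \<and> s \<in> X \<and> (s = [] \<or> hd s \<noteq> flip l)"
  by (auto simp: X_iff reduced_Cons)

lemma take_X: "s \<in> X \<Longrightarrow> take k s \<in> X"
  using set_take_subset[of k s] reduced_take[of s k] by (fastforce simp: X_iff)

lemma shift_simps [simp]: "shift q [] = []" "shift q (l # s) = (fst l, q <# snd l) # shift q s"
  by (cases l; simp add: shift_def)+

lemma hd_shift: "s \<noteq> [] \<Longrightarrow> hd (shift q s) = (fst (hd s), q <# snd (hd s))"
  by (cases s) simp_all

lemma shift_eq_Nil [simp]: "shift q s = [] \<longleftrightarrow> s = []"
  by (simp add: shift_def)

lemma flip_shift_eq:
  assumes "q \<in> carrier G" "snd l \<in> cosets V" "snd l' \<in> cosets V"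
  shows "(fst l', q <# snd l') = flip (fst l, q <# snd l) \<longleftrightarrow> l' = flip l"
  using lcos_inj[OF assms(1,3,2)] by (auto simp: flip_def prod_eq_iff)

lemma shift_X: "\<lbrakk>q \<in> Q; s \<in> X\<rbrakk> \<Longrightarrow> shift q s \<in> X"
proof (induction s)
  case (Cons l s)
  have "snd (hd s) \<in> cosets V" if "s \<noteq> []" using Cons.prems(2) that by (cases s) (auto simp: X_Cons)
  then show ?case
    using Cons cosets_lcos[of V q "snd l"] flip_shift_eq[OF Q_closed[OF Cons.prems(1)], of l "hd s"]
    by (auto simp: X_Cons hd_shift)
qed simp

lemma shift_shift: "\<lbrakk>q \<in> carrier G; q' \<in> carrier G; s \<in> X\<rbrakk> \<Longrightarrow> shift q (shift q' s) = shift (q \<otimes> q') s"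
  by (induction s) (auto simp: X_Cons lcos_m_assoc cosets_closed)

lemma shift_one: "s \<in> X \<Longrightarrow> shift \<one> s = s"
  by (induction s) (auto simp: X_Cons lcos_mult_one cosets_closed)

lemma shift_inv: "\<lbrakk>q \<in> carrier G; s \<in> X\<rbrakk> \<Longrightarrow> shift (inv q) (shift q s) = s"
  by (simp add: shift_shift shift_one)

lemma ldist_shift: "\<lbrakk>q \<in> carrier G; s \<in> X; t \<in> X\<rbrakk> \<Longrightarrow> ldist (shift q s) (shift q t) = ldist s t"
proof -
  assume a: "q \<in> carrier G" "s \<in> X" "t \<in> X"
  have "inj_on (map_prod id (\<lambda>c. q <# c)) (set s \<union> set t)"
  proof (rule inj_onI)
    fix i j assume ij: "i \<in> set s \<union> set t" "j \<in> set s \<union> set t" "map_prod id (\<lambda>c. q <# c) i = map_prod id (\<lambda>c. q <# c) j"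
    then have "snd i \<in> cosets V" "snd j \<in> cosets V" using a by (auto simp: X_iff)
    then show "i = j" using lcos_inj[OF a(1)] ij(3) by (auto simp: prod_eq_iff)
  qed
  then show ?thesis by (simp add: shift_def ldist_def lcp_map)
qed

lemma height_shift [simp]: "height (shift q s) = height s"
  by (induction s) simp_all

lemma length_shift [simp]: "length (shift q s) = length s"
  by (simp add: shift_def)

lemma push_X: "\<lbrakk>c \<in> cosets V; s \<in> X\<rbrakk> \<Longrightarrow> push (e, c) s \<in> X"
  using reduced_push[of s "(e, c)"] set_push[of "(e, c)" s] by (fastforce simp: X_iff)

lemma shift_push:
  assumes "q \<in> carrier G" "c \<in> cosets V" "s \<in> X"
  shows "shift q (push (e, c) s) = push (e, q <# c) (shift q s)"
proof (cases s)
  case (Cons l t)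
  then have "snd l \<in> cosets V" using assms(3) by (simp add: X_Cons)
  then show ?thesis
    using flip_shift_eq[OF assms(1), of "(e, c)" l] assms(2) Cons by (simp add: push_def)
qed (simp add: push_def)

lemma letter_Q: "\<lbrakk>x \<in> V; x \<noteq> v\<rbrakk> \<Longrightarrow> word_class [(e, x)] \<in> Q"
  by (simp add: parabolic_def)

lemma letter_parabolic: "\<lbrakk>x \<in> \<Lambda>; x \<noteq> v\<rbrakk> \<Longrightarrow> word_class [(e, x)] \<in> parabolic (\<Lambda> - {v})"
  by (simp add: parabolic_def)

lemma lact_X: "\<lbrakk>snd l \<in> V; s \<in> X\<rbrakk> \<Longrightarrow> lact l s \<in> X"
  using push_X[OF L_in_cosets[OF order_refl]] shift_X[OF letter_Q] by (cases l) (simp add: lact_def)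

lemma lact_inv: "\<lbrakk>x \<in> V; s \<in> X\<rbrakk> \<Longrightarrow> lact (\<not> e, x) (lact (e, x) s) = s"
proof (cases "x = v")
  case True
  assume "s \<in> X"
  then show ?thesis using push_push[of s "(e, L)"] True by (simp add: lact_def flip_def X_iff)
next
  case False
  assume "x \<in> V" "s \<in> X"
  then show ?thesis using shift_inv[of "word_class [(e, x)]" s] False by (simp add: lact_def word_class_letter_inv)
qed

lemma ldist_lact: "\<lbrakk>snd l \<in> V; s \<in> X; t \<in> X\<rbrakk> \<Longrightarrow> ldist (lact l s) (lact l t) = ldist s t"
  using ldist_push[of s t] ldist_shift[of "word_class [l]" s t] by (cases l) (auto simp: lact_def X_iff)

text \<open>The relations mixing the two kinds of action are those between \<open>v\<close> and a
  neighbour \<open>u\<close>. Then \<open>u\<close> lies in \<open>L\<close>, so translation by it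
  fixes the letter \<open>L\<close> and commutes with pushing it.\<close>

lemma lact_commute:
  assumes E: "E a b" "a \<in> V" "b \<in> V" and s: "s \<in> X"
  shows "lact (True, a) (lact (True, b) s) = lact (True, b) (lact (True, a) s)"
proof -
  have LV: "L \<in> cosets V" using L_in_cosets by blast
  have link: "lact (True, u) (push (True, L) s) = push (True, L) (lact (True, u) s)" if "E u v" "u \<in> V" for u
  proof -
    have u: "u \<noteq> v" using that E_irrefl by blast
    have uL: "word_class [(True, u)] \<in> L" using that by (simp add: L_def parabolic_def link_def)
    have "word_class [(True, u)] <# L = L" using lcos_L_iff[OF L_closed[OF uL]] uL by blast
    then show ?thesis using shift_push[OF L_closed[OF uL] LV s] u by (simp add: lact_def)
  qed
  show ?thesis
  proof (cases "a = v \<or> b = v")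
    case True
    then show ?thesis
    proof
      assume a: "a = v"
      then have "b \<noteq> v" "E b v" using E E_irrefl E_sym by blast+
      then show ?thesis using link[of b] E a by (simp add: lact_def)
    next
      assume b: "b = v"
      then have "a \<noteq> v" using E E_irrefl by blast
      then show ?thesis using link[of a] E b by (simp add: lact_def)
    qed
  next
    case False
    have "word_class [(True, a)] \<in> parabolic (link b)" using E by (simp add: parabolic_def link_def)
    then have "word_class [(True, a)] \<otimes> word_class [(True, b)] = word_class [(True, b)] \<otimes> word_class [(True, a)]"
      using link_commute[OF E(3)] by blast
    then show ?thesis using False E s by (simp add: lact_def shift_shift)
  qed
qed

lemma wact_simps [simp]: "wact [] s = s" "wact (l # w) s = lact l (wact w s)" "wact (u @ w) s = wact u (wact w s)"
  by (simp_all add: wact_def)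

lemma gwords_Cons': "l # w \<in> gwords Y \<longleftrightarrow> snd l \<in> Y \<and> w \<in> gwords Y"
  by (cases l) simp

lemma wact_X: "\<lbrakk>w \<in> gwords V; s \<in> X\<rbrakk> \<Longrightarrow> wact w s \<in> X"
  by (induction w) (auto simp: gwords_Cons' lact_X)

lemma wact_cong:
  assumes "(u, w) \<in> word_cong V R" "s \<in> X"
  shows "wact u s = wact w s"
proof (rule word_cong_fun_eq[OF assms(1), of "\<lambda>u. wact u s"])
  fix u w e x assume "u \<in> gwords V" "w \<in> gwords V" "x \<in> V"
  then show "wact (u @ [(e, x), (\<not> e, x)] @ w) s = wact (u @ w) s"
    using lact_inv[of x "wact w s" "\<not> e"] wact_X[of w s] assms(2) by simp
next
  fix u w r t assume "(r, t) \<in> R" "u \<in> gwords V" "w \<in> gwords V" "r \<in> gwords V" "t \<in> gwords V"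
  moreover from this(1) obtain a b where "E a b" "r = [(True, a), (True, b)]" "t = [(True, b), (True, a)]"
    by (auto simp: commutations_def)
  ultimately show "wact (u @ r @ w) s = wact (u @ t @ w) s"
    using lact_commute[of a b "wact w s"] wact_X[of w s] assms(2) by simp
qed

lemma act_word_class: "\<lbrakk>w \<in> gwords V; s \<in> X\<rbrakk> \<Longrightarrow> act (word_class w) s = wact w s"
  unfolding act_def by (rule wact_cong[OF rep_word_class])

lemma ldist_wact: "\<lbrakk>w \<in> gwords V; s \<in> X; t \<in> X\<rbrakk> \<Longrightarrow> ldist (wact w s) (wact w t) = ldist s t"
  by (induction w) (auto simp: gwords_Cons' ldist_lact wact_X)

lemma height_wact: "height (wact w s) = height s + (\<Sum>l\<leftarrow>w. if snd l = v then if fst l then 1 else -1 else 0)"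
  by (induction w) (auto simp: lact_def height_push)

lemma length_wact: "length (wact w []) \<le> length w"
proof (induction w)
  case (Cons l w)
  then show ?case using length_push[of "(fst l, L)" "wact w []"] by (auto simp: lact_def)
qed simp

theorem tree_action: "tree_action G X ldist act"
proof -
  interpret tree X ldist by (rule tree_of_lists) (rule take_X)
  show ?thesis
  proof (intro tree_action.intro tree_action_axioms.intro)
    show "group G" "tree X ldist" by unfold_locales
    fix g assume "g \<in> carrier G"
    then obtain w where w: "w \<in> gwords V" "g = word_class w" using word_class_ex by blast
    show "act g s \<in> X" if "s \<in> X" for s using w that by (simp add: act_word_class wact_X)
    show "ldist (act g s) (act g t) = ldist s t" if "s \<in> X" "t \<in> X" for s t
      using w that by (simp add: act_word_class ldist_wact)
    show "act (g \<otimes> h) s = act g (act h s)" if h: "h \<in> carrier G" "s \<in> X" for h s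
    proof -
      obtain u where u: "u \<in> gwords V" "h = word_class u" using word_class_ex h by blast
      then show ?thesis using w h act_word_class[of "w @ u" s] by (simp add: word_class_append act_word_class wact_X)
    qed
    show "act g (act g s) \<noteq> s" if s: "s \<in> X" "ldist s (act g s) = 1" for s
    proof
      assume eq: "act g (act g s) = s"
      define h where "h = (\<Sum>l\<leftarrow>w. if snd l = v then if fst l then 1 else -1 else 0 :: int)"
      have "height (act g s) = height s + h" "height (act g (act g s)) = height (act g s) + h"
        using w s by (simp_all add: act_word_class wact_X height_wact h_def)
      then show False using eq height_adjacent[OF s(2)] by simp
    qed
  next
    show "act \<one> s = s" if "s \<in> X" for s using act_word_class[of "[]" s] that by (simp add: word_class_Nil)
    show "X \<noteq> {}" using Nil_X by blast
  qed
qed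

lemma length_act_le: "g \<in> carrier G \<Longrightarrow> length (act g []) \<le> len g"
  using len_ex[of g] length_wact act_word_class Nil_X by metis

section \<open>Vertices of the tree as elements of the kernel\<close>

definition evl where
  "evl l = (let y = (SOME y. y \<in> snd l) in y \<otimes> word_class [(fst l, v)] \<otimes> inv y)"

definition ev where
  "ev s = foldr (\<lambda>l g. evl l \<otimes> g) s \<one>"

lemma ev_simps [simp]: "ev [] = \<one>" "ev (l # s) = evl l \<otimes> ev s"
  by (simp_all add: ev_def)

lemma v_letter [simp]: "word_class [(e, v)] \<in> carrier G"
  using v by simp

text \<open>The chosen representative is \<open>y \<otimes> l\<close> with \<open>l\<close> in
  \<open>L\<close>, and \<open>l\<close> cancels because it commutes with \<open>v\<close>.\<close>

lemma evl_coset: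
  assumes "y \<in> Q"
  shows "evl (e, y <# L) = y \<otimes> word_class [(e, v)] \<otimes> inv y"
proof -
  define z where "z = (SOME z. z \<in> y <# L)"
  have y: "y \<in> carrier G" using Q_closed[OF assms] .
  have "y \<otimes> \<one> \<in> y <# L" using subgroup.one_closed[OF sub(1)] by (auto simp: l_coset_def)
  then have "z \<in> y <# L" unfolding z_def by (rule someI)
  then obtain l where l: "l \<in> L" "z = y \<otimes> l" by (auto simp: l_coset_def)
  have lc: "l \<in> carrier G" using L_closed[OF l(1)] .
  have "l \<otimes> word_class [(e, v)] = word_class [(e, v)] \<otimes> l" using link_commute[OF v] l(1) by (simp add: L_def)
  then have "l \<otimes> word_class [(e, v)] \<otimes> inv l = word_class [(e, v)]" using lc by (simp add: m_assoc)
  moreover have "z \<otimes> word_class [(e, v)] \<otimes> inv z = y \<otimes> (l \<otimes> word_class [(e, v)] \<otimes> inv l) \<otimes> inv y"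
    using y lc by (simp add: l(2) inv_mult_group m_assoc)
  ultimately show ?thesis by (simp add: evl_def z_def[symmetric])
qed

lemma evl_L: "evl (e, L) = word_class [(e, v)]"
  using evl_coset[OF subgroup.one_closed[OF sub(2)], of e] lcos_mult_one[OF L_subset] by simp

lemma cosets_V_E:
  assumes "c \<in> cosets V"
  obtains y where "y \<in> Q" "y \<in> carrier G" "c = y <# L"
  using assms Q_closed by (auto simp: cosets_def)

lemma evl_closed [simp]: "snd l \<in> cosets V \<Longrightarrow> evl l \<in> carrier G"
  by (cases l) (auto elim!: cosets_V_E simp: evl_coset)

lemma evl_lcos: "\<lbrakk>q \<in> Q; c \<in> cosets V\<rbrakk> \<Longrightarrow> evl (e, q <# c) = q \<otimes> evl (e, c) \<otimes> inv q"
proof -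
  assume q: "q \<in> Q" and "c \<in> cosets V"
  then obtain y where y: "y \<in> Q" "y \<in> carrier G" "c = y <# L" by (elim cosets_V_E)
  have qc: "q \<in> carrier G" using Q_closed[OF q] .
  have "q <# c = (q \<otimes> y) <# L" using lcos_m_assoc[OF L_subset qc y(2)] y(3) by simp
  then show ?thesis using evl_coset[OF subgroup.m_closed[OF sub(2) q y(1)]] evl_coset[OF y(1)] qc y
    by (simp add: inv_mult_group m_assoc)
qed

lemma evl_flip: "snd l \<in> cosets V \<Longrightarrow> evl (flip l) = inv (evl l)"
proof -
  assume "snd l \<in> cosets V"
  then obtain y where y: "y \<in> Q" "y \<in> carrier G" "snd l = y <# L" by (elim cosets_V_E)
  obtain e where l: "l = (e, y <# L)" using y(3) by (cases l) auto
  show ?thesis using evl_coset[OF y(1)] y(2) word_class_letter_inv[OF v]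
    by (simp add: l flip_def inv_mult_group m_assoc)
qed

lemma ev_closed [simp]: "s \<in> X \<Longrightarrow> ev s \<in> carrier G"
  by (induction s) (auto simp: X_Cons)

lemma ev_append: "\<lbrakk>snd ` set s \<subseteq> cosets V; snd ` set t \<subseteq> cosets V\<rbrakk> \<Longrightarrow> ev (s @ t) = ev s \<otimes> ev t"
proof (induction s)
  case Nil
  have "ev t \<in> carrier G" using Nil(2) by (induction t) auto
  then show ?case by simp
next
  case (Cons l s)
  have "ev s \<in> carrier G" "ev t \<in> carrier G"
    using Cons.prems by (induction s) (auto, induction t, auto)
  then show ?case using Cons by (simp add: m_assoc)
qed

lemma ev_shift: "\<lbrakk>q \<in> Q; s \<in> X\<rbrakk> \<Longrightarrow> ev (shift q s) = q \<otimes> ev s \<otimes> inv q"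
proof (induction s)
  case Nil
  then show ?case using Q_closed by simp
next
  case (Cons l s)
  have c: "q \<in> carrier G" "evl l \<in> carrier G" "ev s \<in> carrier G" "snd l \<in> cosets V"
    using Cons.prems Q_closed by (auto simp: X_Cons)
  have "inv q \<otimes> (q \<otimes> (ev s \<otimes> inv q)) = ev s \<otimes> inv q" using c by (simp add: m_assoc[symmetric])
  then show ?case using Cons evl_lcos[OF Cons.prems(1) c(4), of "fst l"] c by (simp add: X_Cons m_assoc)
qed

lemma ev_push: "\<lbrakk>c \<in> cosets V; s \<in> X\<rbrakk> \<Longrightarrow> ev (push (e, c) s) = evl (e, c) \<otimes> ev s"
proof (cases s)
  case (Cons l t)
  assume a: "c \<in> cosets V" "s \<in> X"
  have t: "t \<in> X" "snd l \<in> cosets V" using a(2) Cons by (auto simp: X_Cons)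
  show ?thesis
  proof (cases "l = flip (e, c)")
    case True
    have "evl (e, c) \<otimes> (inv (evl (e, c)) \<otimes> ev t) = ev t" using t a by (simp add: m_assoc[symmetric])
    then show ?thesis using True Cons evl_flip[of "(e, c)"] a by (simp add: push_def)
  qed (simp add: Cons push_def)
qed (simp add: push_def)

lemma kill_v_letter: "x \<in> V \<Longrightarrow> kill {v} (word_class [(e, x)]) = (if x = v then \<one> else word_class [(e, x)])"
  by (simp add: kill_word_class word_class_Nil)

lemma ev_lact:
  assumes "snd l \<in> V" "s \<in> X"
  shows "ev (lact l s) = word_class [l] \<otimes> ev s \<otimes> inv (kill {v} (word_class [l]))"
proof (cases "snd l = v")
  case True
  then show ?thesis using ev_push[OF L_in_cosets[OF order_refl] assms(2)] kill_v_letter[OF v] assms v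
    by (cases l) (simp add: lact_def evl_L)
next
  case False
  then show ?thesis using ev_shift[OF letter_Q[OF assms(1) False] assms(2)] kill_v_letter[OF assms(1)]
    by (cases l) (simp add: lact_def)
qed

text \<open>Read in the kernel, \<open>g\<close> acts by left multiplication, corrected on the right
  by its image in \<open>Q\<close> so that the product stays in the kernel. Free action of the
  kernel follows from this formula, and so does the fact that elements fixing the empty word are
  fixed by \<open>kill {v}\<close>.\<close>

lemma ev_act:
  assumes "g \<in> carrier G" "s \<in> X"
  shows "ev (act g s) = g \<otimes> ev s \<otimes> inv (kill {v} g)"
proof -
  obtain w where w: "w \<in> gwords V" "g = word_class w" using word_class_ex assms(1) by blast
  have "ev (wact w s) = word_class w \<otimes> ev s \<otimes> inv (kill {v} (word_class w))"
    using w(1)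
  proof (induction w)
    case Nil
    then show ?case using assms(2) by (simp add: word_class_Nil)
  next
    case (Cons l w)
    have lw: "snd l \<in> V" "w \<in> gwords V" "[l] \<in> gwords V" using Cons.prems by (auto simp: gwords_Cons')
    have "ev (wact (l # w) s) = word_class [l] \<otimes> (word_class w \<otimes> ev s \<otimes> inv (kill {v} (word_class w))) \<otimes> inv (kill {v} (word_class [l]))"
      using ev_lact[OF lw(1) wact_X[OF lw(2) assms(2)]] Cons.IH[OF lw(2)] by simp
    also have "\<dots> = (word_class [l] \<otimes> word_class w) \<otimes> ev s \<otimes> inv (kill {v} (word_class [l]) \<otimes> kill {v} (word_class w))"
      using lw assms(2) by (simp add: inv_mult_group m_assoc)
    also have "\<dots> = word_class (l # w) \<otimes> ev s \<otimes> inv (kill {v} (word_class (l # w)))"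
      using lw by (simp only: word_class_Cons kill_mult word_class_closed)
    finally show ?case .
  qed
  then show ?thesis using w assms(2) by (simp add: act_word_class)
qed

lemma act_kernel:
  assumes "g \<in> carrier G" "s \<in> X" "act g s = s" "kill {v} g = \<one>"
  shows "g = \<one>"
proof -
  have e: "ev s \<in> carrier G" using assms(2) by simp
  have "g \<otimes> ev s \<otimes> inv (kill {v} g) = ev s" using ev_act[OF assms(1,2), symmetric] unfolding assms(3) .
  then have 1: "g \<otimes> ev s = ev s" using assms(1,4) e by simp
  have "g = g \<otimes> ev s \<otimes> inv (ev s)" using assms(1) e by (simp add: m_assoc)
  then show ?thesis using e unfolding 1 by simp
qed

lemma wact_Q: "\<lbrakk>w \<in> gwords (V - {v}); s \<in> X\<rbrakk> \<Longrightarrow> wact w s = shift (word_class w) s"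
proof (induction w)
  case Nil
  then show ?case by (simp add: word_class_Nil shift_one)
next
  case (Cons l w)
  have w: "w \<in> gwords V" "snd l \<in> V" "snd l \<noteq> v" "w \<in> gwords (V - {v})"
    using Cons.prems gwords_mono[of w "V - {v}" V] by (auto simp: gwords_Cons')
  have "[l] \<in> gwords V" using w by (simp add: gwords_Cons')
  then show ?case using Cons w by (simp add: lact_def shift_shift word_class_Cons[of l w])
qed

lemma act_Q: "\<lbrakk>q \<in> Q; s \<in> X\<rbrakk> \<Longrightarrow> act q s = shift q s"
proof -
  assume "q \<in> Q" "s \<in> X"
  then obtain w where "w \<in> gwords (V - {v})" "q = word_class w" "s \<in> X" by (auto simp: parabolic_def)
  then show ?thesis using wact_Q[of w s] act_word_class[of w s] gwords_mono[of w "V - {v}" V] by auto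
qed

lemma act_evl:
  assumes "snd l \<in> cosets V" "s \<in> X"
  shows "act (evl l) s = push l s"
proof -
  interpret tree_action G X ldist act by (rule tree_action)
  obtain y where y: "y \<in> Q" "y \<in> carrier G" "snd l = y <# L" using assms(1) by (elim cosets_V_E)
  obtain e where l: "l = (e, y <# L)" using y(3) by (cases l) auto
  have iy: "inv y \<in> Q" using subgroup.m_inv_closed[OF sub(2) y(1)] .
  define t where "t = shift (inv y) s"
  have t: "t \<in> X" "shift y t = s" using shift_X[OF iy assms(2)] shift_inv[of "inv y" s] y assms(2) by (simp_all add: t_def)
  have LV: "L \<in> cosets V" using L_in_cosets by blast
  have "act (evl l) s = act y (act (word_class [(e, v)]) (act (inv y) s))"
    using evl_coset[OF y(1)] y(2) assms(2) by (simp add: l act_mult)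
  also have "\<dots> = act y (push (e, L) t)"
    using act_Q[OF iy assms(2)] act_word_class[of "[(e, v)]" t] v t by (simp add: t_def lact_def)
  also have "\<dots> = push l s"
    using act_Q[OF y(1) push_X[OF LV t(1)]] shift_push[OF y(2) LV t(1)] t(2) by (simp add: l)
  finally show ?thesis .
qed

text \<open>Transitivity on vertices, with an explicit translating element; questions about
  stabilizers reduce to the empty word by conjugation.\<close>

lemma act_ev: "s \<in> X \<Longrightarrow> act (ev s) [] = s"
proof (induction s)
  case Nil
  interpret tree_action G X ldist act by (rule tree_action)
  show ?case by simp
next
  case (Cons l s)
  interpret tree_action G X ldist act by (rule tree_action)
  have l: "snd l \<in> cosets V" "s \<in> X" "s = [] \<or> hd s \<noteq> flip l" using Cons.prems by (auto simp: X_Cons)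
  then show ?case using Cons.IH act_evl[OF l(1,2)] by (auto simp: act_mult push_def)
qed

lemma act_Nil_iff: "g \<in> carrier G \<Longrightarrow> act g [] = [] \<longleftrightarrow> kill {v} g = g"
proof
  assume g: "g \<in> carrier G" "act g [] = []"
  then have "\<one> = g \<otimes> inv (kill {v} g)" using ev_act[OF g(1) Nil_X] by simp
  then show "kill {v} g = g" using g(1) inv_equality[of g "inv (kill {v} g)"] by simp
next
  assume g: "g \<in> carrier G" "kill {v} g = g"
  then have "g \<in> Q" using parabolic_iff[of "V - {v}" g] v by (simp add: double_diff)
  then show "act g [] = []" using act_Q[of g "[]"] by simp
qed

text \<open>Elements over \<Lambda> move the empty word within the subtree with letters from
  \<open>cosets \<Lambda>\<close>; this is what keeps the root induction inside \<Lambda>.\<close>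

lemma letters_parabolic:
  assumes "\<Lambda> \<subseteq> V" "g \<in> parabolic \<Lambda>"
  shows "snd ` set (act g []) \<subseteq> cosets \<Lambda>"
proof -
  obtain w where w: "w \<in> gwords \<Lambda>" "g = word_class w" using assms(2) by (auto simp: parabolic_def)
  have "snd ` set (wact w []) \<subseteq> cosets \<Lambda>"
    using w(1)
  proof (induction w)
    case (Cons l w)
    have lw: "snd l \<in> \<Lambda>" "w \<in> gwords \<Lambda>" using Cons.prems by (auto simp: gwords_Cons')
    show ?case
    proof (cases "snd l = v")
      case True
      have "snd ` set (push (fst l, L) (wact w [])) \<subseteq> insert L (snd ` set (wact w []))"
        using image_mono[OF set_push[of "(fst l, L)" "wact w []"], of snd] by simp
      also have "\<dots> \<subseteq> cosets \<Lambda>" using Cons.IH[OF lw(2)] L_in_cosets[OF assms(1)] by simp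
      finally show ?thesis using True by (simp add: lact_def)
    next
      case False
      then have q: "word_class [l] \<in> parabolic (\<Lambda> - {v})" using letter_parabolic[OF lw(1)] by (cases l) auto
      have "snd ` set (shift (word_class [l]) (wact w [])) = (\<lambda>c. word_class [l] <# c) ` snd ` set (wact w [])"
        by (simp add: shift_def image_image)
      also have "\<dots> \<subseteq> cosets \<Lambda>" using Cons.IH[OF lw(2)] cosets_lcos[OF assms(1) q] by blast
      finally show ?thesis using False by (simp add: lact_def)
    qed
  qed simp
  then show ?thesis using w act_word_class[OF gwords_mono[OF w(1) assms(1)] Nil_X] by simp
qed

lemma ev_parabolic:
  assumes "\<Lambda> \<subseteq> V" "v \<in> \<Lambda>" "snd ` set s \<subseteq> cosets \<Lambda>"
  shows "ev s \<in> parabolic \<Lambda>"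
  using assms(3)
proof (induction s)
  case Nil
  then show ?case using subgroup.one_closed[OF parabolic_subgroup[OF assms(1)]] by simp
next
  case (Cons l s)
  then obtain y where y: "y \<in> parabolic (\<Lambda> - {v})" "snd l = y <# L" by (auto simp: cosets_def)
  have yQ: "y \<in> Q" "y \<in> parabolic \<Lambda>"
    using y(1) parabolic_mono[of "\<Lambda> - {v}" "V - {v}"] parabolic_mono[of "\<Lambda> - {v}" \<Lambda>] assms(1) by blast+
  have t: "word_class [(fst l, v)] \<in> parabolic \<Lambda>" using assms(2) by (simp add: parabolic_def)
  have "evl l = y \<otimes> word_class [(fst l, v)] \<otimes> inv y" using evl_coset[OF yQ(1), of "fst l"] unfolding y(2)[symmetric] by simp
  then have "evl l \<in> parabolic \<Lambda>"
    using yQ(2) t subgroup.m_closed[OF parabolic_subgroup[OF assms(1)]]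
      subgroup.m_inv_closed[OF parabolic_subgroup[OF assms(1)]] by simp
  then show ?case using Cons subgroup.m_closed[OF parabolic_subgroup[OF assms(1)]] by simp
qed

text \<open>Suppose that \<open>g\<close> moves the root \<open>[]\<close> while \<open>g^n\<close>
  fixes it. Then \<open>g\<close> fixes the midpoint \<open>q\<close> of the path to
  \<open>act g []\<close>, and the last edge before \<open>q\<close> is moved by \<open>g\<close>
  but fixed by \<open>g^n\<close>. Conjugated to the root, that edge is a coset
  \<open>y <# L\<close> moved by \<open>k\<close> but not by \<open>k^n\<close>; so
  \<open>z\<close>, the conjugate of \<open>k\<close> by \<open>inv y\<close>, lies over \<Lambda>
  without \<open>v\<close>, and \<open>z^n\<close> is in \<open>L\<close> but \<open>z\<close> is
  not. As \<open>L\<close> is cut out by single-vertex retractions, \<open>IH\<close> gives a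
  contradiction.\<close>

lemma root_fixes_Nil:
  assumes \<Lambda>: "\<Lambda> \<subseteq> V" "v \<in> \<Lambda>" and g: "g \<in> parabolic \<Lambda>" and n: "(n::int) \<noteq> 0" and fx: "kill {v} (g [^] n) = g [^] n"
    and IH: "\<And>z w. \<lbrakk>z \<in> parabolic (\<Lambda> - {v}); w \<in> V; kill {w} (z [^] n) = z [^] n\<rbrakk> \<Longrightarrow> kill {w} z = z"
  shows "kill {v} g = g"
proof (rule ccontr)
  assume not: "kill {v} g \<noteq> g"
  interpret T: tree_action G X ldist act by (rule tree_action)
  have gc: "g \<in> carrier G" using parabolic_closed[OF \<Lambda>(1) g] .
  define s where "s = act g []"
  have s: "s \<in> X" "s \<noteq> []" using not gc act_Nil_iff[OF gc] by (simp_all add: s_def)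
  have gn: "act (g [^] n) [] = []" using act_Nil_iff[of "g [^] n"] gc fx by simp
  obtain p where p: "p \<in> X" "act g p = p"
  proof (rule ccontr)
    assume "\<not> thesis"
    then have "\<And>x. x \<in> X \<Longrightarrow> act g x \<noteq> x" using that by blast
    from T.bounded_disp_pow[OF gc Nil_X this] obtain C
      where C: "\<And>m::int. nat \<bar>m\<bar> \<le> ldist [] (act (g [^] m) []) + C" by blast
    have "act ((g [^] n) [^] m) [] = []" for m :: int
      using T.act_int_pow_fixed[of "g [^] n" "[]" m] gn gc by simp
    \<comment> \<open>The power of exponent \<open>n * int (Suc C)\<close> fixes the root, although
      linear growth up to the error \<open>C\<close> would force it to move.\<close>
    then have "nat (\<bar>n\<bar> * int (Suc C)) \<le> C" using C[of "n * int (Suc C)"] gc by (simp add: int_pow_pow abs_mult)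
    then have "\<bar>n\<bar> * int (Suc C) \<le> int C" by (simp only: nat_le_iff)
    moreover have "1 * int (Suc C) \<le> \<bar>n\<bar> * int (Suc C)" using n by (intro mult_right_mono) simp_all
    ultimately have "1 * int (Suc C) \<le> int C" by (rule order_trans[rotated])
    then show False by simp
  qed
  define q where "q = take (length s div 2) s"
  have "ldist s p = ldist [] p" using T.d_act[OF gc Nil_X p(1)] p by (simp add: s_def)
  \<comment> \<open>The fixed point \<open>p\<close> is equally far from the root and from its
    images under \<open>g\<close> and \<open>inv g\<close>, so the paths to both images follow the
    path towards \<open>p\<close> for half of their length.\<close>
  then have gp1: "2 * T.gromov [] s p = length s" using T.gromov_eq[OF Nil_X s(1) p(1)] by simp
  have si: "act (inv g) [] \<in> X" using gc by simp
  have "ldist (act (inv g) []) p = ldist [] p"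
    using T.d_act[of "inv g" "[]" p] T.act_inv_fixed[OF gc p] gc p(1) by simp
  moreover have "length (act (inv g) []) = length s" using T.disp_inv[OF gc Nil_X] by (simp add: s_def)
  ultimately have gp2: "2 * T.gromov [] p (act (inv g) []) = length s" using T.gromov_eq[OF Nil_X p(1) si]
      ldist_sym[of p "act (inv g) []"] by simp
  have "T.gromov [] s p \<le> T.gromov [] s (act (inv g) [])" by (rule T.gromov_ultra[OF Nil_X s(1) p(1) si]) (use gp1 gp2 in simp_all)
  then have "ldist [] (act g []) \<le> 2 * T.gromov [] (act g []) (act (inv g) [])" using gp1 by (simp add: s_def)
  from T.elliptic_midpoint[OF gc Nil_X this] obtain q' where
    q': "q' \<in> X" "act g q' = q'" "2 * ldist [] q' = ldist [] (act g [])" .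
  have q: "q \<in> X" "T.btw [] q s" "ldist [] q = length s div 2"
    using take_X[OF s(1)] by (simp_all add: q_def T.btw_def ldist_def lcp_take min_absorb1)
  have "ldist s q' = ldist [] q'" using T.d_act[OF gc Nil_X q'(1)] q' by (simp add: s_def)
  then have "T.btw [] q' s" using q'(3) ldist_sym[of s q'] by (simp add: T.btw_def s_def)
  then have "q' = q"
    by (rule T.btw_eqI[OF Nil_X s(1) s(1) q'(1) q(1) _ q(2)])
      (use q'(3) q(3) T.gromov_self[OF Nil_X s(1)] in \<open>auto simp: s_def\<close>)
  then have gq: "act g q = q" "2 * length q = length s" using q' by (simp_all add: s_def)
  then have q_ne: "q \<noteq> []" using s(2) by auto
  define m where "m = butlast q"
  define l where "l = last q"
  have q_eq: "q = m @ [l]" using q_ne by (simp add: m_def l_def)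
  have m: "m \<in> X" using take_X[OF q(1), of "length q - 1"] by (simp add: m_def butlast_conv_take)
  have q_letters: "snd ` set q \<subseteq> cosets \<Lambda>"
    using letters_parabolic[OF \<Lambda>(1) g] set_take_subset[of "length s div 2" s] by (fastforce simp: q_def s_def)
  have lV: "snd l \<in> cosets \<Lambda>" "snd l \<in> cosets V" using q_letters cosets_mono[OF \<Lambda>(1)] by (auto simp: q_eq)
  have m_btw: "T.btw [] m q" "ldist [] m = length q - 1"
    by (simp_all add: q_eq T.btw_def ldist_def lcp_take[of "length m" "m @ [l]" "m @ [l]", simplified])
  have "act (g [^] n) q = q" using T.act_int_pow_fixed[OF gc q(1) gq(1)] .
  then have gm: "act (g [^] n) m = m"
    using T.fixed_initial[of "g [^] n" "[]" q m] gc gn q(1) m m_btw T.gromov_self[OF Nil_X q(1)] by simp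
  \<comment> \<open>Otherwise \<open>m\<close>, which is closer to the root than the midpoint, would
    be equally close to \<open>s\<close>.\<close>
  have not_gm: "act g m \<noteq> m"
  proof
    assume "act g m = m"
    then have "ldist m s = ldist m []" using T.d_act[OF gc m Nil_X] by (simp add: s_def)
    moreover have "length s \<le> ldist [] m + ldist m s" using T.d_tri[OF Nil_X m s(1)] by simp
    ultimately show False using m_btw(2) ldist_sym[of m "[]"] gq(2) q_ne by (cases q) auto
  qed
  define h where "h = ev q"
  have hL: "h \<in> parabolic \<Lambda>" "h \<in> carrier G" using ev_parabolic[OF \<Lambda> q_letters] parabolic_closed[OF \<Lambda>(1)] by (auto simp: h_def)
  have hq: "act h [] = q" using act_ev[OF q(1)] by (simp add: h_def)
  have fl: "[flip l] \<in> X" using lV(2) by (simp add: X_Cons flip_def)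
  have hm: "act h [flip l] = m"
  proof -
    have "snd ` set m \<subseteq> cosets V" using m by (simp add: X_iff)
    then have "h = ev m \<otimes> evl l" using ev_append[of m "[l]"] lV(2) by (simp add: h_def q_eq)
    moreover have "act (evl l) [flip l] = []" using act_evl[OF lV(2) fl] by (simp add: push_def)
    ultimately show ?thesis using act_ev[OF m] T.act_mult[of "ev m" "evl l" "[flip l]"] m lV(2) fl by simp
  qed
  have conj: "act (inv h \<otimes> x \<otimes> h) y = y \<longleftrightarrow> act x (act h y) = act h y" if "x \<in> carrier G" "y \<in> X" for x y
  proof -
    have "act (inv h \<otimes> x \<otimes> h) y = act (inv h) (act x (act h y))" using hL that by (simp add: T.act_mult)
    moreover have "act (inv h) W = y \<longleftrightarrow> W = act h y" if "W \<in> X" for W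
      using arg_cong[of "act (inv h) W" y "act h"] hL \<open>y \<in> X\<close> that by auto
    moreover have "act x (act h y) \<in> X" using hL that by simp
    ultimately show ?thesis by simp
  qed
  define k where "k = inv h \<otimes> g \<otimes> h"
  have kc: "k \<in> carrier G" using gc hL by (simp add: k_def)
  have kpow: "k [^] n = inv h \<otimes> g [^] n \<otimes> h"
    using int_pow_conj[of "inv h" g n] hL gc by (simp add: k_def)
  have "kill {v} k = k" using conj[OF gc Nil_X] hq gq(1) act_Nil_iff[OF kc] by (simp add: k_def)
  moreover have "k \<in> parabolic \<Lambda>" unfolding k_def
    using hL g subgroup.m_closed[OF parabolic_subgroup[OF \<Lambda>(1)]] subgroup.m_inv_closed[OF parabolic_subgroup[OF \<Lambda>(1)]] by blast
  ultimately have kP: "k \<in> parabolic (\<Lambda> - {v})" using parabolic_kill[OF \<Lambda>(1), of k "{v}"] by simp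
  have PQ: "parabolic (\<Lambda> - {v}) \<subseteq> Q" using parabolic_mono[of "\<Lambda> - {v}" "V - {v}"] \<Lambda>(1) by blast
  have kQ: "k \<in> Q" "k [^] n \<in> Q" using kP PQ subgroup_int_pow_closed[OF sub(2)] by blast+
  have "act k [flip l] \<noteq> [flip l]" using conj[OF gc fl] hm not_gm by (simp add: k_def)
  then have k1: "k <# snd l \<noteq> snd l" using act_Q[OF kQ(1) fl] by (auto simp: flip_def)
  have "act (k [^] n) [flip l] = [flip l]" using conj[of "g [^] n" "[flip l]"] gc fl hm gm by (simp add: kpow)
  then have k2: "k [^] n <# snd l = snd l" using act_Q[OF kQ(2) fl] by (auto simp: flip_def)
  obtain y where y: "y \<in> parabolic (\<Lambda> - {v})" "snd l = y <# L" using lV(1) by (auto simp: cosets_def)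
  have yc: "y \<in> carrier G" using y(1) PQ Q_closed by blast
  define z where "z = inv y \<otimes> k \<otimes> y"
  have zc: "z \<in> carrier G" using yc kc by (simp add: z_def)
  have \<Lambda>': "\<Lambda> - {v} \<subseteq> V" using \<Lambda>(1) by blast
  have zP: "z \<in> parabolic (\<Lambda> - {v})" unfolding z_def
    using y(1) kP subgroup.m_closed[OF parabolic_subgroup[OF \<Lambda>']] subgroup.m_inv_closed[OF parabolic_subgroup[OF \<Lambda>']] by blast
  have zpow: "z [^] n = inv y \<otimes> k [^] n \<otimes> y" using int_pow_conj[of "inv y" k n] yc kc by (simp add: z_def)
  have coset_iff: "inv y \<otimes> x \<otimes> y \<in> L \<longleftrightarrow> x <# (y <# L) = y <# L" if "x \<in> carrier G" for x
  proof -
    have "x <# (y <# L) = y <# L \<longleftrightarrow> inv y <# (x <# (y <# L)) = inv y <# (y <# L)"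
      using lcos_cancel[OF yc, of "x <# (y <# L)" "y <# L"] that yc l_coset_subset_G L_subset by simp
    also have "inv y <# (y <# L) = L" using lcos_m_assoc[OF L_subset] lcos_mult_one[OF L_subset] yc by simp
    also have "inv y <# (x <# (y <# L)) = (inv y \<otimes> x \<otimes> y) <# L"
      using lcos_m_assoc[OF L_subset] lcos_m_assoc[OF l_coset_subset_G[OF L_subset]] yc that by (simp add: m_assoc)
    finally show ?thesis using lcos_L_iff[of "inv y \<otimes> x \<otimes> y"] yc that by simp
  qed
  have "z [^] n \<in> L" using coset_iff[of "k [^] n"] kc k2 y(2) by (simp add: zpow)
  then have "kill {w} (z [^] n) = z [^] n" if "w \<in> V - link v" for w
    using parabolic_single_kill[OF link_subset(2)] that by (simp add: L_def)
  then have "kill {w} z = z" if "w \<in> V - link v" for w using IH[OF zP, of w] that by blast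
  then have "z \<in> L" unfolding L_def by (rule parabolic_memI[OF link_subset(2) zc])
  then show False using coset_iff[OF kc] k1 y(2) by (simp add: z_def)
qed

end

section \<open>Undistorted bases\<close>

context group
begin

lemma centralizer_hom_subgroup:
  assumes "group_hom G G f" "z \<in> carrier G"
  shows "subgroup {g \<in> carrier G. f g \<otimes> z = z \<otimes> f g} G"
proof -
  interpret f: group_hom G G f by fact
  show ?thesis
  proof (rule subgroupI)
    show "{g \<in> carrier G. f g \<otimes> z = z \<otimes> f g} \<noteq> {}" using assms(2) by (auto intro!: exI[of _ \<one>])
    fix g assume g: "g \<in> {g \<in> carrier G. f g \<otimes> z = z \<otimes> f g}"
    then have "inv (inv (f g)) \<otimes> z = z \<otimes> inv (inv (f g))" by simp
    then have "inv (f g) \<otimes> z = z \<otimes> inv (f g)" using commute_inv[of "inv (f g)" z] g assms(2) by simp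
    then show "inv g \<in> {g \<in> carrier G. f g \<otimes> z = z \<otimes> f g}" using g by simp
    fix h assume h: "h \<in> {g \<in> carrier G. f g \<otimes> z = z \<otimes> f g}"
    have "f g \<otimes> f h \<otimes> z = f g \<otimes> (z \<otimes> f h)" using g h assms(2) by (simp add: m_assoc)
    also have "\<dots> = f g \<otimes> z \<otimes> f h" using g h assms(2) m_assoc[of "f g" z "f h"] by simp
    also have "\<dots> = z \<otimes> f g \<otimes> f h" using g by simp
    also have "\<dots> = z \<otimes> (f g \<otimes> f h)" using g h assms(2) by (intro m_assoc) simp_all
    finally show "g \<otimes> h \<in> {g \<in> carrier G. f g \<otimes> z = z \<otimes> f g}" using g h by simp
  qed auto
qed

text \<open>Two passes through centralizers: first against the generators, then against an arbitrary
  element.\<close>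

lemma generate_hom_commute:
  assumes f: "group_hom G G f" and ab: "a \<in> carrier G" "b \<in> carrier G" "f a \<otimes> f b = f b \<otimes> f a"
    and gh: "g \<in> generate G {a, b}" "h \<in> generate G {a, b}"
  shows "f g \<otimes> f h = f h \<otimes> f g"
proof -
  interpret f: group_hom G G f by fact
  have gen: "generate G {a, b} \<subseteq> {g \<in> carrier G. f g \<otimes> z = z \<otimes> f g}"
    if "z \<in> carrier G" "f a \<otimes> z = z \<otimes> f a" "f b \<otimes> z = z \<otimes> f b" for z
    using generate_subgroup_incl[OF _ centralizer_hom_subgroup[OF f that(1)]] that ab by auto
  have hc: "h \<in> carrier G" using gh(2) generate_in_carrier[of "{a, b}" h] ab by simp
  have "f h \<otimes> f a = f a \<otimes> f h" "f h \<otimes> f b = f b \<otimes> f h"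
    using gen[of "f a"] gen[of "f b"] ab gh(2) by auto
  then have "f a \<otimes> f h = f h \<otimes> f a" "f b \<otimes> f h = f h \<otimes> f b" by simp_all
  then show ?thesis using gen[of "f h"] hc gh(1) by auto
qed

end

lemma (in tree_action) disp_le:
  assumes "g \<in> carrier G" "p \<in> X" "q \<in> X"
  shows "disp p g \<le> disp q g + 2 * d q p"
proof -
  have X: "act g p \<in> X" "act g q \<in> X" using assms by simp_all
  have "disp p g \<le> d p q + d q (act g p)" using d_tri[OF assms(2,3) X(1)] .
  moreover have "d q (act g p) \<le> disp q g + d (act g q) (act g p)" using d_tri[OF assms(3) X(2,1)] .
  moreover have "d (act g q) (act g p) = d q p" using assms by simp
  ultimately show ?thesis using d_sym[OF assms(2,3)] by simp
qed

section \<open>Roots, torsion and elliptic elements\<close>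

context artin
begin

lemma vertex: "v \<in> V \<Longrightarrow> artin_vertex G V E v"
  by unfold_locales

text \<open>Induction over the vertices occurring in \<open>g\<close>, for all killed vertices at
  once: the tree of \<open>u\<close> reduces the claim over \<Lambda> to elements over \<Lambda>
  without \<open>u\<close>, but tested against other vertices.\<close>

lemma kill_root:
  assumes "g \<in> carrier G" "u \<in> V" "(n::int) \<noteq> 0" "kill {u} (g [^] n) = g [^] n"
  shows "kill {u} g = g"
proof -
  have "\<forall>g u. \<Lambda> \<subseteq> V \<and> g \<in> parabolic \<Lambda> \<and> u \<in> V \<and> kill {u} (g [^] n) = g [^] n \<longrightarrow> kill {u} g = g" if "finite \<Lambda>" for \<Lambda>
    using that
  proof (induction \<Lambda> rule: finite_psubset_induct)
    case (psubset \<Lambda>)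
    show ?case
    proof (intro allI impI, elim conjE)
      fix g u assume a: "\<Lambda> \<subseteq> V" "g \<in> parabolic \<Lambda>" "u \<in> V" "kill {u} (g [^] n) = g [^] n"
      show "kill {u} g = g"
      proof (cases "u \<in> \<Lambda>")
        case True
        interpret artin_vertex G V E u by (rule vertex[OF a(3)])
        show ?thesis
        proof (rule root_fixes_Nil[OF a(1) True a(2) assms(3) a(4)])
          fix z w assume "z \<in> parabolic (\<Lambda> - {u})" "w \<in> V" "kill {w} (z [^] n) = z [^] n"
          moreover have "\<Lambda> - {u} \<subset> \<Lambda>" "\<Lambda> - {u} \<subseteq> V" using True a(1) by blast+
          ultimately show "kill {w} z = z" using psubset.IH by blast
        qed
      next
        case False
        then show ?thesis using parabolic_single_kill[OF a(1,2)] by blast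
      qed
    qed
  qed
  from this[OF finite_V] show ?thesis using assms parabolic_V by blast
qed

text \<open>The identity is fixed by all retractions, hence so are its roots; an element fixed by
  every single-vertex retraction is trivial.\<close>

lemma torsion_free:
  assumes "g \<in> carrier G" "(n::int) \<noteq> 0" "g [^] n = \<one>"
  shows "g = \<one>"
proof -
  have "kill {u} g = g" if "u \<in> V" for u
    using kill_root[OF assms(1) that assms(2)] assms(3) by simp
  then have "kill V g = g" using kill_finite_union[OF finite_V assms(1)] by blast
  then show ?thesis using kill_V[OF assms(1)] by simp
qed

text \<open>Being conjugate into the fixed set of the retraction means fixing a vertex of the tree
  of \<open>v\<close>. Stated without the tree, the notion is easily pushed forward along the
  retraction of another vertex.\<close>

definition elliptic :: "'v \<Rightarrow> 'v gword set \<Rightarrow> bool" where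
  "elliptic v g \<longleftrightarrow> (\<exists>h\<in>carrier G. kill {v} (inv h \<otimes> g \<otimes> h) = inv h \<otimes> g \<otimes> h)"

end

context artin_vertex
begin

sublocale T: tree_action G X ldist act
  by (rule tree_action)

lemma conj_fixes_Nil:
  assumes "g \<in> carrier G" "h \<in> carrier G"
  shows "act g (act h []) = act h [] \<longleftrightarrow> kill {v} (inv h \<otimes> g \<otimes> h) = inv h \<otimes> g \<otimes> h"
proof -
  have X: "act h [] \<in> X" "act g (act h []) \<in> X" using assms by simp_all
  have "act (inv h \<otimes> g \<otimes> h) [] = act (inv h) (act g (act h []))" using assms by (simp add: T.act_mult)
  moreover have "act (inv h) W = [] \<longleftrightarrow> W = act h []" if "W \<in> X" for W
  proof
    assume e: "act (inv h) W = []"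
    have "act h (act (inv h) W) = W" using assms(2) that by simp
    then show "W = act h []" unfolding e by (rule HOL.sym)
  qed (use assms(2) in simp)
  ultimately have "act (inv h \<otimes> g \<otimes> h) [] = [] \<longleftrightarrow> act g (act h []) = act h []"
    using X(2) by simp
  then show ?thesis using act_Nil_iff[of "inv h \<otimes> g \<otimes> h"] assms by simp
qed

lemma elliptic_iff: "g \<in> carrier G \<Longrightarrow> elliptic v g \<longleftrightarrow> (\<exists>x\<in>X. act g x = x)"
proof
  assume g: "g \<in> carrier G" "elliptic v g"
  then obtain h where "h \<in> carrier G" "act g (act h []) = act h []"
    using conj_fixes_Nil unfolding elliptic_def by blast
  then show "\<exists>x\<in>X. act g x = x" using T.act_closed[of h "[]"] by auto
next
  assume g: "g \<in> carrier G" "\<exists>x\<in>X. act g x = x"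
  then obtain x where x: "x \<in> X" "act g x = x" by blast
  then show "elliptic v g"
    using conj_fixes_Nil[OF g(1), of "ev x"] act_ev[OF x(1)] unfolding elliptic_def by (intro bexI[of _ "ev x"]) auto
qed

lemma root_closed_stabs: "H \<subseteq> carrier G \<Longrightarrow> T.root_closed_stabs H"
  unfolding T.root_closed_stabs_def
proof (intro ballI allI impI)
  fix g x and n :: int assume a: "H \<subseteq> carrier G" "g \<in> H" "x \<in> X" "n \<noteq> 0" "act (g [^] n) x = x"
  have g: "g \<in> carrier G" "ev x \<in> carrier G" using a by auto
  define k where "k = inv (ev x) \<otimes> g \<otimes> ev x"
  have k: "k \<in> carrier G" using g by (simp add: k_def)
  have kn: "k [^] n = inv (ev x) \<otimes> g [^] n \<otimes> ev x" using int_pow_conj[of "inv (ev x)" g n] g by (simp add: k_def)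
  have "kill {v} (k [^] n) = k [^] n"
    using conj_fixes_Nil[of "g [^] n" "ev x"] g a act_ev[OF a(3)] by (simp add: kn)
  from kill_root[OF k v a(4) this] show "act g x = x"
    using conj_fixes_Nil[OF g] act_ev[OF a(3)] by (simp add: k_def)
qed

text \<open>When \<open>kill {v}\<close> has abelian image on \<open>H\<close>, commutators from
  \<open>H\<close> lie in its kernel, and the kernel acts freely.\<close>

lemma commuting_stabs:
  assumes "H \<subseteq> carrier G" "\<And>g h. \<lbrakk>g \<in> H; h \<in> H\<rbrakk> \<Longrightarrow> kill {v} g \<otimes> kill {v} h = kill {v} h \<otimes> kill {v} g"
  shows "T.commuting_stabs H"
  unfolding T.commuting_stabs_def
proof (intro ballI impI)
  fix g h x assume a: "g \<in> H" "h \<in> H" "x \<in> X" "act (g \<otimes> h) x = act (h \<otimes> g) x"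
  have c: "g \<in> carrier G" "h \<in> carrier G" using a assms(1) by blast+
  define k where "k = inv (g \<otimes> h) \<otimes> (h \<otimes> g)"
  have k: "k \<in> carrier G" using c by (simp add: k_def)
  have "act k x = act (inv (g \<otimes> h)) (act (h \<otimes> g) x)"
    unfolding k_def by (rule T.act_mult) (use c a(3) in simp_all)
  also have "\<dots> = x" unfolding a(4)[symmetric] by (rule T.act_inv_act(1)) (use c a(3) in simp_all)
  finally have "act k x = x" .
  moreover have "kill {v} k = \<one>"
    using assms(2)[OF a(1,2)] c by (simp add: k_def kill_mult kill_inv)
  ultimately have "k = \<one>" using act_kernel[OF k a(3)] by blast
  then have "g \<otimes> h \<otimes> (inv (g \<otimes> h) \<otimes> (h \<otimes> g)) = g \<otimes> h" using c by (simp add: k_def)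
  then show "g \<otimes> h = h \<otimes> g" using c by (simp add: m_assoc[symmetric])
qed

lemma disp_le_len: "\<lbrakk>g \<in> carrier G; p \<in> X\<rbrakk> \<Longrightarrow> T.disp p g \<le> len g + 2 * length p"
  using T.disp_le[of g p "[]"] length_act_le[of g] by simp

end

context artin
begin

text \<open>Induction over the support. Retractions commute, so \<open>kill {v} g\<close> is again
  elliptic for all vertices and trivial by induction. Then \<open>g\<close> lies in the kernel of
  \<open>kill {v}\<close>, where a fixed point in the tree of \<open>v\<close> forces it to be
  trivial.\<close>

lemma elliptic_all_imp_one:
  assumes "g \<in> carrier G" "\<And>u. u \<in> V \<Longrightarrow> elliptic u g"
  shows "g = \<one>"
proof -
  have "\<forall>g \<in> parabolic \<Lambda>. (\<forall>u\<in>V. elliptic u g) \<longrightarrow> g = \<one>" if "finite \<Lambda>" "\<Lambda> \<subseteq> V" for \<Lambda>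
    using that
  proof (induction \<Lambda> rule: finite_induct)
    case empty
    have "w = []" if "w \<in> gwords {}" for w :: "'v gword" using that by (auto simp: gwords_iff)
    then have "g = \<one>" if "g \<in> parabolic {}" for g using that word_class_Nil unfolding parabolic_def by blast
    then show ?case by blast
  next
    case (insert v \<Lambda>)
    show ?case
    proof (intro ballI impI)
      fix g assume g: "g \<in> parabolic (insert v \<Lambda>)" "\<forall>u\<in>V. elliptic u g"
      have v: "v \<in> V" using insert.prems by blast
      have gc: "g \<in> carrier G" using parabolic_closed[OF insert.prems g(1)] .
      have "elliptic u (kill {v} g)" if u: "u \<in> V" for u
      proof -
        obtain h where h: "h \<in> carrier G" "kill {u} (inv h \<otimes> g \<otimes> h) = inv h \<otimes> g \<otimes> h"
          using g(2) u unfolding elliptic_def by blast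
        have eq: "kill {v} (inv h \<otimes> g \<otimes> h) = inv (kill {v} h) \<otimes> kill {v} g \<otimes> kill {v} h"
          using h(1) gc by (simp add: kill_mult kill_inv)
        have "kill {u} (kill {v} (inv h \<otimes> g \<otimes> h)) = kill {v} (inv h \<otimes> g \<otimes> h)"
          using kill_commute[of "inv h \<otimes> g \<otimes> h" "{u}" "{v}"] h gc by simp
        then show ?thesis unfolding elliptic_def using h(1) eq by (intro bexI[of _ "kill {v} h"]) auto
      qed
      moreover have "kill {v} g \<in> parabolic \<Lambda>"
        using parabolic_kill[OF insert.prems g(1), of "{v}"] parabolic_mono[of "insert v \<Lambda> - {v}" \<Lambda>] by blast
      ultimately have d: "kill {v} g = \<one>" using insert.IH insert.prems by blast
      interpret artin_vertex G V E v by (rule vertex[OF v])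
      obtain x where "x \<in> X" "act g x = x" using elliptic_iff[OF gc] g(2) v by blast
      then show "g = \<one>" using act_kernel[OF gc _ _ d] by blast
    qed
  qed
  from this[OF finite_V order_refl] show ?thesis using assms parabolic_V by blast
qed

definition undistorted_basis :: "'v gword set \<Rightarrow> 'v gword set \<Rightarrow> bool" where
  "undistorted_basis a b \<longleftrightarrow> (\<exists>K. \<forall>s. alternating s \<longrightarrow> exponent_length s \<le> K * (len (syllable_prod a b s) + 1)) \<and>
    (\<forall>s. alternating s \<longrightarrow> s \<noteq> [] \<longrightarrow> syllable_prod a b s \<noteq> \<one>)"

lemma undistorted_basis_tree:
  assumes c0: "a0 \<in> carrier G" "b0 \<in> carrier G" and nc0: "a0 \<otimes> b0 \<noteq> b0 \<otimes> a0"
    and kill: "\<And>v. \<lbrakk>v \<in> V; kill {v} a0 \<noteq> a0 \<or> kill {v} b0 \<noteq> b0\<rbrakk> \<Longrightarrow>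
      kill {v} a0 \<otimes> kill {v} b0 = kill {v} b0 \<otimes> kill {v} a0"
  shows "\<exists>a b. nielsen a0 b0 a b \<and> undistorted_basis a b"
proof -
  define H where "H = generate G {a0, b0}"
  have H: "subgroup H G" unfolding H_def by (rule generate_is_subgroup) (use c0 in simp)
  have Hc: "H \<subseteq> carrier G" using subgroup.subset[OF H] .
  have ab0: "a0 \<in> H" "b0 \<in> H" unfolding H_def by (auto intro: generate.incl)
  have cs: "tree_action.commuting_stabs G (artin_vertex.X G V E v) (artin_vertex.act G V E v) H"
    if vv: "v \<in> V" "kill {v} a0 \<noteq> a0 \<or> kill {v} b0 \<noteq> b0" for v
  proof -
    interpret artin_vertex G V E v by (rule vertex[OF vv(1)])
    show ?thesis
      by (rule commuting_stabs[OF Hc generate_hom_commute[OF group_hom_kill c0 kill[OF vv]]])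
        (simp_all add: H_def)
  qed
  obtain v where v: "v \<in> V" "kill {v} a0 \<noteq> a0 \<or> kill {v} b0 \<noteq> b0"
  proof (rule ccontr)
    assume "\<not> thesis"
    then have "\<And>v. v \<in> V \<Longrightarrow> kill {v} a0 = a0" using that by blast
    then have "kill V a0 = a0" using kill_finite_union[OF finite_V c0(1)] by blast
    then have "a0 = \<one>" using kill_V[OF c0(1)] by simp
    then show False using nc0 c0 by simp
  qed
  interpret Tv: artin_vertex G V E v by (rule vertex[OF v(1)])
  obtain a b p where N: "nielsen a0 b0 a b" and p: "p \<in> Tv.X"
    and alternative: "(\<forall>s. alternating s \<longrightarrow> exponent_length s \<le> Tv.T.disp p (syllable_prod a b s)) \<or>
     (\<forall>s. alternating s \<longrightarrow> length s \<le> 2 * Tv.T.disp p (syllable_prod a b s) + 1)"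
    by (rule Tv.T.nielsen_basis[OF H ab0 nc0 cs[OF v] Tv.root_closed_stabs[OF Hc]])
  have ab: "a \<in> H" "b \<in> H" using nielsen_in_subgroup[OF N H ab0] by blast+
  have c: "a \<in> carrier G" "b \<in> carrier G" using ab Hc by blast+
  have ne: "a \<noteq> \<one>" "b \<noteq> \<one>" using nielsen_not_commute[OF N c0] nc0 c by auto
  show ?thesis
  proof (intro exI conjI)
    show "nielsen a0 b0 a b" by fact
    show "undistorted_basis a b"
      using alternative
    proof
      assume *: "\<forall>s. alternating s \<longrightarrow> exponent_length s \<le> Tv.T.disp p (syllable_prod a b s)"
      have "exponent_length s \<le> (1 + 2 * length p) * (len (syllable_prod a b s) + 1)" if "alternating s" for s
      proof -
        have "exponent_length s \<le> len (syllable_prod a b s) + 2 * length p" using * that Tv.disp_le_len[of "syllable_prod a b s" p] c p by fastforce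
        then show ?thesis by (simp add: algebra_simps)
      qed
      moreover have "syllable_prod a b s \<noteq> \<one>" if s: "alternating s" "s \<noteq> []" for s
      proof
        assume "syllable_prod a b s = \<one>"
        then have "exponent_length s = 0" using * s(1) p by force
        then show False using s by (cases s) (auto simp: alternating_Cons)
      qed
      ultimately show ?thesis unfolding undistorted_basis_def by blast
    next
      assume *: "\<forall>s. alternating s \<longrightarrow> length s \<le> 2 * Tv.T.disp p (syllable_prod a b s) + 1"
      have free: "syllable_prod a b s \<noteq> \<one>" if s: "alternating s" "s \<noteq> []" for s
      proof
        assume one: "syllable_prod a b s = \<one>"
        \<comment> \<open>A trivial product has displacement 0, so at most one syllable remains, and
          a single syllable would be torsion.\<close>
        then have "length s \<le> 1" using * s(1) p by force
        then obtain x n where q: "s = [(x, n)]" using s(2) by (cases s) auto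
        then have "(if x then a else b) [^] n = \<one>" "n \<noteq> 0" using one s(1) c by (auto simp: alternating_Cons)
        then have "(if x then a else b) = \<one>" using torsion_free c by (cases x) auto
        then show False using ne by (auto split: if_splits)
      qed
      have growth: "\<exists>C. \<forall>s. alternating s \<longrightarrow> (\<Sum>q\<leftarrow>s. if fst q = x then nat \<bar>snd q\<bar> else 0) \<le> len (syllable_prod a b s) + C * (length s + 1)" for x
      proof -
        define y where "y = (if x then a else b)"
        have y: "y \<in> carrier G" "y \<noteq> \<one>" "y \<in> H" using c ne ab by (auto simp: y_def)
        \<comment> \<open>The vertex \<open>u\<close> depends on the generator \<open>y\<close>,
          which may be elliptic in the tree of \<open>v\<close>.\<close>
        obtain u where u: "u \<in> V" "\<not> elliptic u y" using elliptic_all_imp_one[OF y(1)] y(2) by blast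
        interpret Tu: artin_vertex G V E u by (rule vertex[OF u(1)])
        \<comment> \<open>If the retraction killing \<open>u\<close> fixed both generators, it would
          fix \<open>y\<close>, and \<open>y\<close> would be elliptic for \<open>u\<close>. Hence
          the commutation hypothesis is available in the tree of \<open>u\<close>.\<close>
        have "kill {u} a0 \<noteq> a0 \<or> kill {u} b0 \<noteq> b0"
        proof (rule ccontr)
          assume "\<not> ?thesis"
          then have "a0 \<in> parabolic (V - {u})" "b0 \<in> parabolic (V - {u})" using parabolic_iff[of "V - {u}"] u(1) c0 by (auto simp: double_diff)
          then have "H \<subseteq> parabolic (V - {u})" unfolding H_def
            by (intro generate_subgroup_incl parabolic_subgroup) auto
          then have "kill {u} y = y" using y(3) parabolic_single_kill[of "V - {u}" y u] by blast
          then have "elliptic u y" unfolding elliptic_def using y(1) by (intro bexI[of _ \<one>]) auto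
          then show False using u(2) by blast
        qed
        note cu = cs[OF u(1) this]
        obtain C l where l: "\<forall>x. (\<forall>p\<in>Tu.X. Tu.act (if x then a else b) p \<noteq> p) \<longrightarrow> l x \<ge> 1"
          "\<forall>s. alternating s \<longrightarrow> (\<Sum>q\<leftarrow>s. nat \<bar>snd q\<bar> * l (fst q)) \<le> Tu.T.disp [] (syllable_prod a b s) + C * (length s + 1)"
          using Tu.T.syllable_growth[OF H cu ab Tu.Nil_X free] by blast
        have lx: "l x \<ge> 1" using l(1)[rule_format, of x] Tu.elliptic_iff[OF y(1)] u(2) by (auto simp: y_def)
        have "(\<Sum>q\<leftarrow>s. if fst q = x then nat \<bar>snd q\<bar> else 0) \<le> len (syllable_prod a b s) + C * (length s + 1)" if s: "alternating s" for s
        proof -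
          have "(\<Sum>q\<leftarrow>s. if fst q = x then nat \<bar>snd q\<bar> else 0) \<le> (\<Sum>q\<leftarrow>s. nat \<bar>snd q\<bar> * l (fst q))"
            by (rule sum_list_mono) (use lx in auto)
          also have "\<dots> \<le> Tu.T.disp [] (syllable_prod a b s) + C * (length s + 1)" using l(2) s by blast
          also have "Tu.T.disp [] (syllable_prod a b s) \<le> len (syllable_prod a b s)" using Tu.disp_le_len[of "syllable_prod a b s" "[]"] c by simp
          finally show ?thesis by simp
        qed
        then show ?thesis by blast
      qed
      obtain C1 where C1: "\<And>s. alternating s \<Longrightarrow> (\<Sum>q\<leftarrow>s. if fst q = True then nat \<bar>snd q\<bar> else 0) \<le> len (syllable_prod a b s) + C1 * (length s + 1)"
        using growth[of True] by blast
      obtain C2 where C2: "\<And>s. alternating s \<Longrightarrow> (\<Sum>q\<leftarrow>s. if fst q = False then nat \<bar>snd q\<bar> else 0) \<le> len (syllable_prod a b s) + C2 * (length s + 1)"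
        using growth[of False] by blast
      define C where "C = C1 + C2"
      define D where "D = length p"
      \<comment> \<open>The two growth bounds contribute \<open>2 * len\<close> and \<open>C\<close>
        times the number of syllables plus one; that number is at most
        \<open>2 * (len + 2 * D) + 1\<close>, where \<open>2 * D\<close> is the cost of the base
        point \<open>p\<close>.\<close>
      have "exponent_length s \<le> (2 + C * (4 * D + 2)) * (len (syllable_prod a b s) + 1)" if s: "alternating s" for s
      proof -
        let ?n = "len (syllable_prod a b s)"
        have "exponent_length s = (\<Sum>q\<leftarrow>s. (if fst q = True then nat \<bar>snd q\<bar> else 0) + (if fst q = False then nat \<bar>snd q\<bar> else 0))"
          unfolding exponent_length_def by (rule arg_cong[of _ _ sum_list]) auto
        also have "\<dots> = (\<Sum>q\<leftarrow>s. if fst q = True then nat \<bar>snd q\<bar> else 0) + (\<Sum>q\<leftarrow>s. if fst q = False then nat \<bar>snd q\<bar> else 0)"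
          by (rule sum_list_addf)
        also have "\<dots> \<le> 2 * ?n + C * (length s + 1)" using C1[OF s] C2[OF s] by (simp add: C_def algebra_simps)
        also have "length s \<le> 2 * (?n + 2 * D) + 1"
          using * s Tv.disp_le_len[of "syllable_prod a b s" p] c p unfolding D_def by fastforce
        finally have "exponent_length s \<le> 2 * ?n + C * (2 * (?n + 2 * D) + 1 + 1)" by simp
        also have "\<dots> \<le> (2 + C * (4 * D + 2)) * (?n + 1)" by (simp add: algebra_simps)
        finally show ?thesis .
      qed
      then show ?thesis using free unfolding undistorted_basis_def by blast
    qed
  qed
qed

text \<open>Induction on the number of vertices whose retraction moves the pair. Killing
  \<open>v\<close> removes \<open>v\<close> from this set and, since retractions commute, adds no
  other vertex.\<close>

theorem nielsen_undistorted_basis: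
  assumes "a0 \<in> carrier G" "b0 \<in> carrier G" "a0 \<otimes> b0 \<noteq> b0 \<otimes> a0"
  shows "\<exists>a b. nielsen a0 b0 a b \<and> undistorted_basis a b"
  using assms
proof (induction "card {v \<in> V. kill {v} a0 \<noteq> a0 \<or> kill {v} b0 \<noteq> b0}" arbitrary: a0 b0 rule: less_induct)
  case less
  show ?case
  proof (cases "\<exists>v\<in>V. (kill {v} a0 \<noteq> a0 \<or> kill {v} b0 \<noteq> b0) \<and> kill {v} a0 \<otimes> kill {v} b0 \<noteq> kill {v} b0 \<otimes> kill {v} a0")
    case True
    then obtain v where v: "v \<in> V" "kill {v} a0 \<noteq> a0 \<or> kill {v} b0 \<noteq> b0"
      "kill {v} a0 \<otimes> kill {v} b0 \<noteq> kill {v} b0 \<otimes> kill {v} a0" by blast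
    let ?S = "\<lambda>a b. {w \<in> V. kill {w} a \<noteq> a \<or> kill {w} b \<noteq> b}"
    have 1: "kill {w} (kill {v} x) = kill {v} x" if "x \<in> carrier G" "w = v \<or> kill {w} x = x" for w x
      using that kill_commute[of x "{w}" "{v}"] kill_kill[of x "{v}" "{v}"] by auto
    have "?S (kill {v} a0) (kill {v} b0) \<subseteq> ?S a0 b0 - {v}"
      using 1[OF less.prems(1)] 1[OF less.prems(2)] by blast
    then have "?S (kill {v} a0) (kill {v} b0) \<subset> ?S a0 b0" using v by blast
    then have "card (?S (kill {v} a0) (kill {v} b0)) < card (?S a0 b0)"
      using finite_V by (intro psubset_card_mono) auto
    from less.hyps[OF this] obtain a' b' where
      "nielsen (kill {v} a0) (kill {v} b0) a' b'" and ub: "undistorted_basis a' b'"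
      using v less.prems by auto
    then obtain a b where ab: "nielsen a0 b0 a b" "kill {v} a = a'" "kill {v} b = b'"
      using group_hom.nielsen_lift[OF group_hom_kill] less.prems by blast
    have c: "a \<in> carrier G" "b \<in> carrier G" using nielsen_closed[OF ab(1)] less.prems by blast+
    have syllable_prod: "kill {v} (syllable_prod a b s) = syllable_prod a' b' s" for s using group_hom.hom_syllable_prod[OF group_hom_kill c] ab by simp
    have le: "len (syllable_prod a' b' s) \<le> len (syllable_prod a b s)" for s using len_kill_le[of "syllable_prod a b s" "{v}"] c syllable_prod by simp
    obtain K where K: "\<And>s. alternating s \<Longrightarrow> exponent_length s \<le> K * (len (syllable_prod a' b' s) + 1)"
      using ub unfolding undistorted_basis_def by blast
    have "exponent_length s \<le> K * (len (syllable_prod a b s) + 1)" if "alternating s" for s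
      using K[OF that] le[of s] by (meson add_le_mono1 le_trans mult_le_mono2)
    moreover have "syllable_prod a b s \<noteq> \<one>" if "alternating s" "s \<noteq> []" for s
      using ub that syllable_prod[of s] unfolding undistorted_basis_def by auto
    ultimately show ?thesis using ab(1) unfolding undistorted_basis_def by blast
  next
    case False
    then show ?thesis using undistorted_basis_tree[OF less.prems] by blast
  qed
qed

end

section \<open>Word lengths and free groups\<close>

context group
begin

text \<open>A subadditive function is bounded on the finitely many generators and their inverses,
  hence by that bound times the word length. All comparisons in the quasi-isometry below are
  instances of this.\<close>

lemma length_function_le_word_length:
  fixes f :: "'a \<Rightarrow> nat"
  assumes S: "finite S" "S \<subseteq> carrier G" "generate G S = carrier G"
    and f: "f \<one> = 0" "\<And>g h. \<lbrakk>g \<in> carrier G; h \<in> carrier G\<rbrakk> \<Longrightarrow> f (g \<otimes> h) \<le> f g + f h"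
  shows "\<exists>M. \<forall>g\<in>carrier G. f g \<le> M * word_length G S g"
proof -
  let ?L = "S \<union> m_inv G ` S"
  define M where "M = Max (insert 0 (f ` ?L))"
  have M: "f l \<le> M" if "l \<in> ?L" for l unfolding M_def by (rule Max_ge) (use S(1) that in auto)
  have L: "?L \<subseteq> carrier G" using S(2) by auto
  have words: "f (foldr (\<otimes>) ws \<one>) \<le> M * length ws" if "set ws \<subseteq> ?L" for ws
    using that
  proof (induction ws)
    case (Cons l ws)
    have c: "l \<in> carrier G" "foldr (\<otimes>) ws \<one> \<in> carrier G" using Cons.prems L foldr_mult_closed[of ws] by auto
    have "f (foldr (\<otimes>) (l # ws) \<one>) \<le> f l + f (foldr (\<otimes>) ws \<one>)" using f(2)[OF c] by simp
    also have "\<dots> \<le> M + M * length ws" using M[of l] Cons by (intro add_mono) auto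
    finally show ?case by simp
  qed (simp add: f(1))
  have "f g \<le> M * word_length G S g" if g: "g \<in> carrier G" for g
  proof -
    obtain ws where "set ws \<subseteq> ?L" "foldr (\<otimes>) ws \<one> = g" "length ws = word_length G S g"
      by (rule word_length_witness[OF S(2,3) g])
    then show ?thesis using words[of ws] by simp
  qed
  then show ?thesis by blast
qed

lemma word_length_int_pow_le:
  assumes S: "S \<subseteq> carrier G" "generate G S = carrier G" and x: "x \<in> S"
  shows "word_length G S (x [^] (n::int)) \<le> nat \<bar>n\<bar>"
proof -
  have xc: "x \<in> carrier G" using S x by blast
  have one: "word_length G S x \<le> 1" using word_length_le[of "[x]" S x] x xc by simp
  have pow: "word_length G S (x [^] k) \<le> k" for k :: nat
  proof (induction k)
    case 0
    then show ?case using word_length_eq_0_iff[OF S one_closed] by simp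
  next
    case (Suc k)
    have "word_length G S (x [^] Suc k) \<le> word_length G S (x [^] k) + word_length G S x"
      using word_length_mult_le[OF S, of "x [^] k" x] xc by simp
    then show ?case using Suc one by simp
  qed
  show ?thesis
  proof (cases "n < 0")
    case True
    then have "x [^] n = inv (x [^] nat (- n))" by (simp only: int_pow_def2 if_True)
    then show ?thesis using word_length_inv_le[OF S, of "x [^] nat (- n)"] pow[of "nat (- n)"] xc True
      by (metis abs_of_neg le_trans nat_pow_closed)
  next
    case False
    then have "x [^] n = x [^] nat n" by (simp only: int_pow_def2 if_False)
    then show ?thesis using pow[of "nat n"] False by (metis abs_of_nonneg not_less)
  qed
qed

lemma word_length_syllable_prod_le:
  assumes S: "S \<subseteq> carrier G" "generate G S = carrier G" and ab: "a \<in> S" "b \<in> S"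
  shows "word_length G S (syllable_prod a b s) \<le> exponent_length s"
proof (induction s)
  case Nil
  then show ?case using word_length_eq_0_iff[OF S one_closed] by simp
next
  case (Cons q s)
  obtain x n where q: "q = (x, n)" by fastforce
  have c: "a \<in> carrier G" "b \<in> carrier G" using S ab by blast+
  have x: "(if x then a else b) \<in> S" "(if x then a else b) \<in> carrier G" using ab c by simp_all
  have "word_length G S (syllable_prod a b (q # s)) \<le> word_length G S ((if x then a else b) [^] n) + word_length G S (syllable_prod a b s)"
    using word_length_mult_le[OF S, of "(if x then a else b) [^] n" "syllable_prod a b s"] x c q by simp
  then show ?case using word_length_int_pow_le[OF S x(1), of n] Cons q by simp
qed

lemma subgroup_syllable_prod:
  assumes H: "subgroup H G" and ab: "a \<in> H" "b \<in> H"
  shows "group.syllable_prod (G\<lparr>carrier := H\<rparr>) a b s = syllable_prod a b s"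
proof -
  interpret H: group "G\<lparr>carrier := H\<rparr>" by (rule subgroup.subgroup_is_group[OF H is_group])
  show ?thesis
    using ab int_pow_consistent[OF H] by (induction s) auto
qed

text \<open>The bound with constant \<open>C\<close> is the content; the rest compares generating
  sets. The lower estimate runs from \<open>S\<close> to \<open>S0\<close>, then to
  \<open>f\<close>, then to \<open>T\<close>, which explains \<open>C1 * C * C2\<close>; the
  additive constant stems from the \<open>+ 1\<close> in the bound.\<close>

theorem quasi_isometric_subgroup:
  fixes f :: "'a \<Rightarrow> nat"
  assumes H: "subgroup H G" and S0: "finite_generating_set (G\<lparr>carrier := H\<rparr>) S0"
    and f: "f \<one> = 0" "\<And>g h. \<lbrakk>g \<in> carrier G; h \<in> carrier G\<rbrakk> \<Longrightarrow> f (g \<otimes> h) \<le> f g + f h"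
    and C: "\<And>h. h \<in> H \<Longrightarrow> word_length (G\<lparr>carrier := H\<rparr>) S0 h \<le> C * (f h + 1)"
    and S: "finite_generating_set (G\<lparr>carrier := H\<rparr>) S" and T: "finite_generating_set G T"
  shows "quasi_isometric_embedding (word_metric (G\<lparr>carrier := H\<rparr>) S) (word_metric G T) (\<lambda>h. h)"
proof -
  let ?H = "G\<lparr>carrier := H\<rparr>"
  interpret H: group ?H by (rule subgroup.subgroup_is_group[OF H is_group])
  have Hc: "H \<subseteq> carrier G" using subgroup.subset[OF H] .
  note S0' = S0[unfolded finite_generating_set_def] and S' = S[unfolded finite_generating_set_def]
    and T' = T[unfolded finite_generating_set_def]
  have "\<exists>M. \<forall>g\<in>carrier ?H. word_length ?H S g \<le> M * word_length ?H S0 g"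
    by (rule H.length_function_le_word_length)
      (use S0' S' H.word_length_mult_le[of S] H.word_length_eq_0_iff[of S] subgroup.one_closed[OF H] in auto)
  then obtain C1 where C1: "\<And>h. h \<in> H \<Longrightarrow> word_length ?H S h \<le> C1 * word_length ?H S0 h" by auto
  have "\<exists>M. \<forall>g\<in>carrier G. f g \<le> M * word_length G T g"
    by (rule length_function_le_word_length) (use T' f in auto)
  then obtain C2 where C2: "\<And>g. g \<in> carrier G \<Longrightarrow> f g \<le> C2 * word_length G T g" by auto
  have "\<exists>M. \<forall>g\<in>carrier ?H. word_length G T g \<le> M * word_length ?H S g"
    by (rule H.length_function_le_word_length)
      (use S' T' Hc word_length_mult_le[of T] word_length_eq_0_iff[of T] in \<open>auto simp: subset_iff\<close>)
  then obtain C3 where C3: "\<And>h. h \<in> H \<Longrightarrow> word_length G T h \<le> C3 * word_length ?H S h" by auto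
  define K where "K = C1 * C * C2 + C3 + 1"
  define e where "e = C1 * C"
  have low: "word_length ?H S h \<le> K * word_length G T h + e" if h: "h \<in> H" for h
  proof -
    have "word_length ?H S h \<le> C1 * (C * (C2 * word_length G T h + 1))"
      using C1[OF h] C[OF h] C2[of h] h Hc by (meson add_le_mono1 le_trans mult_le_mono2 subsetD)
    also have "\<dots> \<le> K * word_length G T h + e" by (simp add: K_def e_def algebra_simps)
    finally show ?thesis .
  qed
  have up: "word_length G T h \<le> K * word_length ?H S h" if h: "h \<in> H" for h
  proof -
    have "C3 * word_length ?H S h \<le> K * word_length ?H S h" by (intro mult_le_mono1) (simp add: K_def)
    then show ?thesis using C3[OF h] by linarith
  qed
  have dist: "word_dist ?H S p q = real (word_length ?H S (inv p \<otimes> q))"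
    "word_dist G T p q = real (word_length G T (inv p \<otimes> q))" "inv p \<otimes> q \<in> H" if "p \<in> H" "q \<in> H" for p q
    using that m_inv_consistent[OF H that(1)] Hc subgroup.m_closed[OF H] subgroup.m_inv_closed[OF H]
    by (auto simp: word_dist_def)
  have "mspace (word_metric ?H S) = H" "mdist (word_metric ?H S) = word_dist ?H S"
    using H.mspace_word_metric[of S] H.mdist_word_metric[of S] S' by auto
  moreover have "mspace (word_metric G T) = carrier G" "mdist (word_metric G T) = word_dist G T"
    using mspace_word_metric[of T] mdist_word_metric[of T] T' by auto
  moreover have "1 / real K * word_dist ?H S p q - real e \<le> word_dist G T p q \<and>
      word_dist G T p q \<le> real K * word_dist ?H S p q + real e" if pq: "p \<in> H" "q \<in> H" for p q
  proof -
    let ?h = "inv p \<otimes> q"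
    have K1: "real K \<ge> 1" by (simp add: K_def)
    have "real (word_length ?H S ?h) \<le> real (K * word_length G T ?h + e)"
      using low[OF dist(3)[OF pq]] by (rule of_nat_mono)
    also have "\<dots> \<le> real K * (real (word_length G T ?h) + real e)"
      using mult_right_mono[OF K1, of "real e"] by (simp add: algebra_simps)
    finally have "1 / real K * real (word_length ?H S ?h) \<le> real (word_length G T ?h) + real e"
      using K1 by (simp add: field_simps)
    moreover have "real (word_length G T ?h) \<le> real (K * word_length ?H S ?h)"
      using up[OF dist(3)[OF pq]] by (rule of_nat_mono)
    ultimately show ?thesis using dist[OF pq] by simp
  qed
  moreover have "real K \<ge> 1" "real e \<ge> 0" by (simp_all add: K_def)
  ultimately show ?thesis unfolding quasi_isometric_embedding_def using Hc
    by (intro conjI exI[of _ "real K"] exI[of _ "real e"]) auto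
qed

section \<open>Free subgroups on two generators\<close>

definition word_val :: "'a gword \<Rightarrow> 'a" where
  "word_val w = foldr (\<lambda>l g. (if fst l then snd l else inv (snd l)) \<otimes> g) w \<one>"

lemma word_val_simps [simp]:
  "word_val [] = \<one>" "word_val (l # w) = (if fst l then snd l else inv (snd l)) \<otimes> word_val w"
  by (simp_all add: word_val_def)

lemma word_val_closed: "S \<subseteq> carrier G \<Longrightarrow> w \<in> gwords S \<Longrightarrow> word_val w \<in> carrier G"
  by (induction w) (auto simp: gwords_def)

lemma word_val_append:
  "\<lbrakk>S \<subseteq> carrier G; u \<in> gwords S; w \<in> gwords S\<rbrakk> \<Longrightarrow> word_val (u @ w) = word_val u \<otimes> word_val w"
proof (induction u)
  case (Cons l u)
  then have "snd l \<in> carrier G" "u \<in> gwords S" by (auto simp: gwords_def)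
  then show ?case using Cons word_val_closed[OF Cons.prems(1)] by (auto simp: m_assoc)
qed (simp add: word_val_closed)

lemma word_val_cong:
  assumes S: "S \<subseteq> carrier G" and "(u, w) \<in> word_cong S {}"
  shows "word_val u = word_val w"
  using assms(2)
proof (rule word_cong_fun_eq)
  fix u w e x assume a: "u \<in> gwords S" "w \<in> gwords S" "x \<in> S"
  have c: "x \<in> carrier G" "word_val w \<in> carrier G" using a S word_val_closed[OF S] by auto
  have "word_val ([(e, x), (\<not> e, x)] @ w) = word_val w"
    using c by (cases e) (simp_all add: m_assoc[symmetric])
  then show "word_val (u @ [(e, x), (\<not> e, x)] @ w) = word_val (u @ w)"
    using word_val_append[OF S a(1)] a by simp
qed simp

lemma generate_word_val:
  assumes S: "S \<subseteq> carrier G" and "g \<in> generate G S"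
  shows "\<exists>w\<in>gwords S. g = word_val w"
  using assms(2)
proof (induction rule: generate.induct)
  case one
  show ?case by (intro bexI[of _ "[]"]) simp_all
next
  case (incl h)
  then show ?case using S by (intro bexI[of _ "[(True, h)]"]) auto
next
  case (inv h)
  then show ?case using S by (intro bexI[of _ "[(False, h)]"]) auto
next
  case (eng g h)
  then obtain u w where "u \<in> gwords S" "g = word_val u" "w \<in> gwords S" "h = word_val w" by blast
  then show ?case using word_val_append[OF S] by (intro bexI[of _ "u @ w"]) auto
qed

definition syllable_word :: "'a \<Rightarrow> 'a \<Rightarrow> (bool \<times> int) list \<Rightarrow> 'a gword" where
  "syllable_word a b s = map (\<lambda>l. (fst l, if snd l then a else b)) (letters s)"

lemma syllable_word_gwords: "syllable_word a b s \<in> gwords {a, b}"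
  by (auto simp: syllable_word_def gwords_def)

lemma word_val_syllable_word:
  "\<lbrakk>a \<in> carrier G; b \<in> carrier G\<rbrakk> \<Longrightarrow> word_val (syllable_word a b s) = syllable_prod a b s"
proof -
  assume ab: "a \<in> carrier G" "b \<in> carrier G"
  have "word_val (map (\<lambda>l. (fst l, if snd l then a else b)) ls) = foldr (\<lambda>i h. letter_val a b i \<otimes> h) ls \<one>" for ls
    by (induction ls) (auto simp: letter_val_def)
  then show ?thesis using foldr_letters[OF ab] by (simp add: syllable_word_def)
qed

text \<open>A letter put in front opens a syllable, lengthens the first one or cancels in it; a
  first syllable that reaches exponent 0 disappears, and what follows is alternating
  already.\<close>

lemma word_cong_syllable_word:
  assumes "w \<in> gwords {a, b}"
  shows "\<exists>s. alternating s \<and> (w, syllable_word a b s) \<in> word_cong {a, b} {}"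
  using assms
proof (induction w)
  case Nil
  show ?case by (intro exI[of _ "[]"]) (simp add: syllable_word_def word_cong.refl)
next
  case (Cons l w)
  obtain e z where l: "l = (e, z)" by (cases l)
  have z: "z \<in> {a, b}" "w \<in> gwords {a, b}" using Cons.prems l by auto
  then obtain y where y: "z = (if y then a else b)" by (metis insertE singletonD)
  obtain s where s: "alternating s" "(w, syllable_word a b s) \<in> word_cong {a, b} {}" using Cons.IH z by blast
  have step: "(l # w, l # syllable_word a b s) \<in> word_cong {a, b} {}"
    using word_cong_append[OF word_cong.refl[of "[l]" "{a, b}" "{}"] s(2)] z l by simp
  define m where "m = (if e then 1 else -1 :: int)"
  have "\<exists>t. alternating t \<and> (l # syllable_word a b s, syllable_word a b t) \<in> word_cong {a, b} {}"
  proof (cases "s = [] \<or> fst (hd s) \<noteq> y")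
    case True
    then have "alternating ((y, m) # s)" using s(1) by (simp add: alternating_Cons m_def)
    moreover have "syllable_word a b ((y, m) # s) = l # syllable_word a b s"
      by (simp add: syllable_word_def m_def l y)
    ultimately show ?thesis
      using word_cong.refl[OF syllable_word_gwords[of a b "(y, m) # s"], of "{}"] by (intro exI[of _ "(y, m) # s"]) simp
  next
    case False
    then obtain n t where t: "s = (y, n) # t" by (cases s) auto
    have n: "n \<noteq> 0" "alternating t" "t = [] \<or> fst (hd t) \<noteq> y" using s(1) t by (auto simp: alternating_Cons)
    show ?thesis
    proof (cases "(n > 0) = e")
      case True
      have "letters ((y, n + m) # t) = (e, y) # letters s"
        using True n(1) by (cases e) (auto simp: t m_def nat_add_distrib abs_if nat_diff_distrib replicate_add[symmetric]
            simp flip: replicate_Suc intro!: arg_cong2[of _ _ _ _ "(@)"] arg_cong[of _ _ "\<lambda>k. replicate k _"])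
      then have "syllable_word a b ((y, n + m) # t) = l # syllable_word a b s" by (simp add: syllable_word_def l y)
      moreover have "alternating ((y, n + m) # t)" using n True by (auto simp: alternating_Cons m_def)
      ultimately show ?thesis
        using word_cong.refl[OF syllable_word_gwords[of a b "(y, n + m) # t"], of "{}"] by (intro exI[of _ "(y, n + m) # t"]) simp
    next
      case False
      define t' where "t' = (if n + m = 0 then t else (y, n + m) # t)"
      have "nat \<bar>n\<bar> = Suc (nat \<bar>n + m\<bar>)" using False n(1) by (cases e) (auto simp: m_def)
      moreover have "(n + m > 0) = (n > 0)" if "n + m \<noteq> 0" using False n(1) that by (cases e) (auto simp: m_def)
      ultimately have "letters s = (\<not> e, y) # letters t'"
        using False by (auto simp: t t'_def)
      then have "syllable_word a b s = (\<not> e, z) # syllable_word a b t'" by (simp add: syllable_word_def y)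
      then have "(l # syllable_word a b s, syllable_word a b t') \<in> word_cong {a, b} {}"
        using word_cong.cancel[of "[]" "{a, b}" "syllable_word a b t'" z e "{}"] syllable_word_gwords[of a b t'] z(1) l by simp
      moreover have "alternating t'" using n by (auto simp: t'_def alternating_Cons)
      ultimately show ?thesis by blast
    qed
  qed
  then show ?case using word_cong.trans[OF step] by blast
qed

lemma generate_syllable_prod:
  assumes ab: "a \<in> carrier G" "b \<in> carrier G" and "g \<in> generate G {a, b}"
  shows "\<exists>s. alternating s \<and> g = syllable_prod a b s"
proof -
  have S: "{a, b} \<subseteq> carrier G" using ab by simp
  obtain w where w: "w \<in> gwords {a, b}" "g = word_val w" using generate_word_val[OF S assms(3)] by blast
  obtain s where "alternating s" "(w, syllable_word a b s) \<in> word_cong {a, b} {}" using word_cong_syllable_word[OF w(1)] by blast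
  then show ?thesis using word_val_cong[OF S] word_val_syllable_word[OF ab] w(2) by metis
qed

text \<open>A word of value 1 is freely congruent to an alternating word of value 1, which is empty
  by \<open>free\<close>; so the natural map from the free group is injective.\<close>

theorem free_group_generate:
  assumes ab: "a \<in> carrier G" "b \<in> carrier G"
    and free: "\<And>s. \<lbrakk>alternating s; s \<noteq> []\<rbrakk> \<Longrightarrow> syllable_prod a b s \<noteq> \<one>"
  shows "is_free_group (G\<lparr>carrier := generate G {a, b}\<rparr>)"
proof -
  let ?S = "{a, b}" and ?H = "G\<lparr>carrier := generate G {a, b}\<rparr>" and ?F = "free_group {a, b}"
  let ?c = "\<lambda>w. word_cong ?S {} `` {w}"
  have S: "?S \<subseteq> carrier G" using ab by simp
  have sub: "subgroup (generate G ?S) G" by (rule generate_is_subgroup[OF S])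
  interpret H: group ?H by (rule subgroup.subgroup_is_group[OF sub is_group])
  interpret F: group ?F unfolding free_group_def by (rule group_presented_group)
  define rp where "rp = (\<lambda>A. SOME w. w \<in> gwords ?S \<and> A = ?c w)"
  define \<phi> where "\<phi> = (\<lambda>A. word_val (rp A))"
  have \<phi>: "\<phi> (?c w) = word_val w" if w: "w \<in> gwords ?S" for w
  proof -
    have "\<exists>u. u \<in> gwords ?S \<and> ?c w = ?c u" using w by blast
    then have "rp (?c w) \<in> gwords ?S \<and> ?c w = ?c (rp (?c w))" unfolding rp_def by (rule someI_ex)
    then have "(rp (?c w), w) \<in> word_cong ?S {}" using eq_equiv_class[OF _ equiv_word_cong w] by metis
    then show ?thesis using word_val_cong[OF S] by (simp add: \<phi>_def)
  qed
  have F_cases: "\<exists>w\<in>gwords ?S. A = ?c w" if "A \<in> carrier ?F" for A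
    using that unfolding free_group_def by (elim presented_group_cases) blast
  have val_H: "word_val w \<in> generate G ?S" if "w \<in> gwords ?S" for w
    using that
  proof (induction w)
    case Nil
    then show ?case by (simp add: generate.one)
  next
    case (Cons l w)
    then have "snd l \<in> ?S" "word_val w \<in> generate G ?S" by (cases l; auto)+
    then show ?case by (auto intro!: generate.eng intro: generate.incl generate.inv simp del: insert_iff)
  qed
  interpret h: group_hom ?F ?H \<phi>
  proof (intro group_hom.intro group_hom_axioms.intro F.is_group H.is_group homI)
    show "\<phi> A \<in> carrier ?H" if "A \<in> carrier ?F" for A using F_cases[OF that] \<phi> val_H by auto
    fix A B assume "A \<in> carrier ?F" "B \<in> carrier ?F"
    then obtain u w where uw: "u \<in> gwords ?S" "A = ?c u" "w \<in> gwords ?S" "B = ?c w" using F_cases by metis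
    then have "A \<otimes>\<^bsub>?F\<^esub> B = ?c (u @ w)" by (simp add: free_group_def mult_presented_group)
    then show "\<phi> (A \<otimes>\<^bsub>?F\<^esub> B) = \<phi> A \<otimes>\<^bsub>?H\<^esub> \<phi> B" using uw \<phi> word_val_append[OF S] by simp
  qed
  have "\<phi> \<in> iso ?F ?H"
    unfolding h.iso_iff
  proof (intro conjI ballI impI)
    show "carrier ?H \<subseteq> \<phi> ` carrier ?F"
    proof
      fix g assume "g \<in> carrier ?H"
      then obtain w where w: "w \<in> gwords ?S" "g = word_val w" using generate_word_val[OF S] by auto
      then have "?c w \<in> carrier ?F" by (simp add: free_group_def presented_group_class_in_carrier)
      then show "g \<in> \<phi> ` carrier ?F" using \<phi>[OF w(1)] w(2) by (metis imageI)
    qed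
    fix A assume A: "A \<in> carrier ?F" "\<phi> A = \<one>\<^bsub>?H\<^esub>"
    then obtain w where w: "w \<in> gwords ?S" "A = ?c w" using F_cases by blast
    obtain s where s: "alternating s" "(w, syllable_word a b s) \<in> word_cong ?S {}" using word_cong_syllable_word[OF w(1)] by blast
    have "syllable_prod a b s = \<one>" using word_val_cong[OF S s(2)] word_val_syllable_word[OF ab] A(2) \<phi>[OF w(1)] w(2) by simp
    then have "s = []" using free[OF s(1)] by blast
    then have "(w, []) \<in> word_cong ?S {}" using s(2) by (simp add: syllable_word_def)
    then show "A = \<one>\<^bsub>?F\<^esub>" using equiv_class_eq[OF equiv_word_cong] w(2)
      by (simp add: free_group_def one_presented_group)
  qed
  then have "?F \<cong> ?H" by (auto simp: is_iso_def)
  then have "?H \<cong> ?F" by (rule F.iso_sym)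
  then show ?thesis unfolding is_free_group_def by blast
qed

end

section \<open>Commuting pairs\<close>

context group
begin

lemma commute_int_pow:
  assumes "x \<in> carrier G" "y \<in> carrier G" "x \<otimes> y = y \<otimes> x"
  shows "x [^] (m::int) \<otimes> y [^] (n::int) = y [^] n \<otimes> x [^] m"
proof -
  have id: "group_hom G G (\<lambda>x. x)" by (intro group_hom.intro group_hom_axioms.intro is_group homI) auto
  have *: "x [^] m \<otimes> y = y \<otimes> x [^] m" if "x \<in> carrier G" "y \<in> carrier G" "x \<otimes> y = y \<otimes> x" for x y and m :: int
    using subgroup_int_pow_closed[OF centralizer_hom_subgroup[OF id that(2)], of x m] that by simp
  have "y \<otimes> x [^] m = x [^] m \<otimes> y" using *[OF assms] by simp
  from *[OF assms(2) _ this, of n] show ?thesis using assms(1) by simp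
qed

lemma commute_pow_mult:
  assumes "x \<in> carrier G" "y \<in> carrier G" "x \<otimes> y = y \<otimes> x"
  shows "(x [^] (m::int) \<otimes> y [^] (n::int)) \<otimes> (x [^] m' \<otimes> y [^] n') = x [^] (m + m') \<otimes> y [^] (n + n')"
proof -
  have "y [^] n \<otimes> (x [^] m' \<otimes> y [^] n') = x [^] m' \<otimes> (y [^] n \<otimes> y [^] n')"
    using commute_int_pow[OF assms, of m' n] m_assoc[of "y [^] n" "x [^] m'" "y [^] n'"] 
      m_assoc[of "x [^] m'" "y [^] n" "y [^] n'"] assms by simp
  then show ?thesis using assms by (simp add: m_assoc int_pow_mult)
qed

lemma commute_pow_pow:
  assumes "x \<in> carrier G" "y \<in> carrier G" "x \<otimes> y = y \<otimes> x"
  shows "(x [^] (m::int) \<otimes> y [^] (n::int)) [^] (k::int) = x [^] (m * k) \<otimes> y [^] (n * k)"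
  using int_pow_mult_distrib[OF commute_int_pow[OF assms]] assms by (simp add: int_pow_pow)

lemma generate_commuting_pair:
  assumes "x \<in> carrier G" "y \<in> carrier G" "x \<otimes> y = y \<otimes> x"
  shows "generate G {x, y} = {x [^] (m::int) \<otimes> y [^] (n::int) |m n. True}"
proof
  have sub: "subgroup (generate G {x, y}) G" using assms by (intro generate_is_subgroup) simp
  show "generate G {x, y} \<subseteq> {x [^] (m::int) \<otimes> y [^] (n::int) |m n. True}"
  proof
    fix g assume "g \<in> generate G {x, y}"
    then show "g \<in> {x [^] (m::int) \<otimes> y [^] (n::int) |m n. True}"
    proof (induction rule: generate.induct)
      case one
      have "\<one> = x [^] (0::int) \<otimes> y [^] (0::int)" by simp
      then show ?case by blast
    next
      case (incl h)
      have "x = x [^] (1::int) \<otimes> y [^] (0::int)" "y = x [^] (0::int) \<otimes> y [^] (1::int)" using assms by simp_all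
      then show ?case using incl by blast
    next
      case (inv h)
      have "inv x = x [^] (-1::int) \<otimes> y [^] (0::int)" "inv y = x [^] (0::int) \<otimes> y [^] (-1::int)"
        using assms int_pow_neg[of x 1] int_pow_neg[of y 1] by simp_all
      then show ?case using inv by blast
    next
      case (eng g h)
      then show ?case using commute_pow_mult[OF assms] by blast
    qed
  qed
  have "x [^] m \<in> generate G {x, y}" "y [^] m \<in> generate G {x, y}" for m :: int
    by (rule subgroup_int_pow_closed[OF sub]; simp add: generate.incl)+
  then show "{x [^] (m::int) \<otimes> y [^] (n::int) |m n. True} \<subseteq> generate G {x, y}"
    using subgroup.m_closed[OF sub] by blast
qed

lemma int_pow_of_generator:
  assumes "c \<in> carrier G"
  shows "generate G {c} = range (\<lambda>n::int. c [^] n)"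
proof -
  have "c [^] (m::int) \<otimes> c [^] (n::int) = c [^] (m + n)" for m n using assms by (simp add: int_pow_mult)
  then have "generate G {c} = {c [^] (m + n) |m n::int. True}" using generate_commuting_pair[OF assms assms] by simp
  also have "\<dots> = range (\<lambda>n::int. c [^] n)"
  proof -
    have "c [^] n = c [^] (n + 0)" for n :: int by simp
    then show ?thesis by blast
  qed
  finally show ?thesis .
qed

text \<open>Torsion-freeness allows the relation to be divided by the gcd of its exponents. With
  \<open>u * m' + v * n' = 1\<close>, the exponents of \<open>c\<close> are chosen so that
  multiplying \<open>c^n'\<close> and \<open>c^(-m')\<close> by powers of the relation gives
  \<open>x\<close> and \<open>y\<close>.\<close>

lemma dependent_pair_cyclic:
  assumes xy: "x \<in> carrier G" "y \<in> carrier G" "x \<otimes> y = y \<otimes> x"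
    and tf: "\<And>g n. \<lbrakk>g \<in> carrier G; (n::int) \<noteq> 0; g [^] n = \<one>\<rbrakk> \<Longrightarrow> g = \<one>"
    and dep: "x [^] (m::int) \<otimes> y [^] (n::int) = \<one>" "m \<noteq> 0 \<or> n \<noteq> 0"
  shows "\<exists>c\<in>carrier G. generate G {x, y} = generate G {c}"
proof -
  define m' where "m' = m div gcd m n"
  define n' where "n' = n div gcd m n"
  have d: "gcd m n \<noteq> 0" "m' * gcd m n = m" "n' * gcd m n = n" using dep(2) by (simp_all add: m'_def n'_def)
  have "coprime m' n'" unfolding m'_def n'_def using dep(2) by (rule div_gcd_coprime)
  then obtain u v where uv: "u * m' + v * n' = 1" using bezout_int[of m' n'] by (metis coprime_imp_gcd_eq_1)
  have gcd_pow: "(x [^] m' \<otimes> y [^] n') [^] gcd m n = \<one>" using commute_pow_pow[OF xy, of m' n' "gcd m n"] d dep(1) by simp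
  have one: "x [^] m' \<otimes> y [^] n' = \<one>" by (rule tf[OF _ d(1) gcd_pow]) (use xy in simp)
  define c where "c = x [^] v \<otimes> y [^] (- u)"
  have c: "c \<in> carrier G" using xy by (simp add: c_def)
  have cp: "c [^] k = x [^] (v * k) \<otimes> y [^] (- u * k)" for k using commute_pow_pow[OF xy] by (simp add: c_def)
  have op: "x [^] (m' * k) \<otimes> y [^] (n' * k) = \<one>" for k
    using commute_pow_pow[OF xy, of m' n' k] one by simp
  have "c [^] n' = c [^] n' \<otimes> (x [^] (m' * u) \<otimes> y [^] (n' * u))" using op[of u] c by simp
  also have "\<dots> = x [^] (v * n' + m' * u) \<otimes> y [^] (- u * n' + n' * u)"
    unfolding cp by (rule commute_pow_mult[OF xy])
  also have "\<dots> = x" using uv xy by (simp add: algebra_simps)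
  finally have x: "c [^] n' = x" .
  have "c [^] (- m') = c [^] (- m') \<otimes> (x [^] (m' * v) \<otimes> y [^] (n' * v))" using op[of v] c by simp
  also have "\<dots> = x [^] (v * - m' + m' * v) \<otimes> y [^] (- u * - m' + n' * v)"
    unfolding cp by (rule commute_pow_mult[OF xy])
  also have "\<dots> = y" using uv xy by (simp add: algebra_simps)
  finally have y: "c [^] (- m') = y" .
  have sub: "subgroup (generate G {c}) G" "subgroup (generate G {x, y}) G"
    using c xy by (simp_all add: generate_is_subgroup)
  have "x \<in> generate G {c}" "y \<in> generate G {c}"
    unfolding int_pow_of_generator[OF c] using x y by blast+
  then have 1: "generate G {x, y} \<subseteq> generate G {c}" by (intro generate_subgroup_incl sub) simp
  have "c \<in> generate G {x, y}" unfolding generate_commuting_pair[OF xy] c_def by blast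
  then have "generate G {c} \<subseteq> generate G {x, y}" by (intro generate_subgroup_incl sub) simp
  then show ?thesis using 1 c by blast
qed

lemma free_Abelian_pair:
  assumes xy: "x \<in> carrier G" "y \<in> carrier G" "x \<otimes> y = y \<otimes> x"
    and ind: "\<And>m n. x [^] (m::int) \<otimes> y [^] (n::int) = \<one> \<Longrightarrow> m = 0 \<and> n = 0"
  shows "is_free_abelian_group (G\<lparr>carrier := generate G {x, y}\<rparr>)"
proof -
  let ?H = "G\<lparr>carrier := generate G {x, y}\<rparr>" and ?F = "free_Abelian_group {x, y}"
  have sub: "subgroup (generate G {x, y}) G" using xy by (intro generate_is_subgroup) simp
  interpret H: group ?H by (rule subgroup.subgroup_is_group[OF sub is_group])
  interpret F: group ?F by simp
  have ne: "x \<noteq> y"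
  proof
    assume "x = y"
    then have "x [^] (1::int) \<otimes> y [^] (-1::int) = \<one>" using xy int_pow_neg[of y 1] by simp
    then show False using ind by fastforce
  qed
  define \<phi> where "\<phi> = (\<lambda>f :: 'a \<Rightarrow>\<^sub>0 int. x [^] Poly_Mapping.lookup f x \<otimes> y [^] Poly_Mapping.lookup f y)"
  interpret h: group_hom ?F ?H \<phi>
  proof (intro group_hom.intro group_hom_axioms.intro F.is_group H.is_group homI)
    show "\<phi> f \<in> carrier ?H" for f unfolding \<phi>_def using generate_commuting_pair[OF xy] by auto
    show "\<phi> (f \<otimes>\<^bsub>?F\<^esub> g) = \<phi> f \<otimes>\<^bsub>?H\<^esub> \<phi> g" for f g
      using commute_pow_mult[OF xy] by (simp add: \<phi>_def lookup_add)
  qed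
  have "\<phi> \<in> iso ?F ?H"
    unfolding h.iso_iff
  proof (intro conjI ballI impI)
    show "carrier ?H \<subseteq> \<phi> ` carrier ?F"
    proof
      fix g assume "g \<in> carrier ?H"
      then obtain m n :: int where g: "g = x [^] m \<otimes> y [^] n" using generate_commuting_pair[OF xy] by auto
      let ?f = "frag_cmul m (frag_of x) + frag_cmul n (frag_of y)"
      have "\<phi> ?f = g" using ne by (simp add: \<phi>_def g lookup_add)
      moreover have "?f \<in> carrier ?F"
        by (auto simp: in_keys_iff lookup_add split: if_splits)
      ultimately show "g \<in> \<phi> ` carrier ?F" by blast
    qed
    fix f assume f: "f \<in> carrier ?F" "\<phi> f = \<one>\<^bsub>?H\<^esub>"
    then have "Poly_Mapping.lookup f x = 0 \<and> Poly_Mapping.lookup f y = 0" using ind by (simp add: \<phi>_def)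
    moreover have "Poly_Mapping.lookup f z = 0" if "z \<notin> {x, y}" for z
      using f(1) that by (auto simp: in_keys_iff)
    ultimately have "f = 0" by (intro poly_mapping_eqI) (metis insertE lookup_zero singletonD)
    then show "f = \<one>\<^bsub>?F\<^esub>" by simp
  qed
  then have "?F \<cong> ?H" by (auto simp: is_iso_def)
  then have "?H \<cong> ?F" by (rule F.iso_sym)
  then show ?thesis unfolding is_free_abelian_group_def by blast
qed

lemma free_Abelian_cyclic:
  assumes c: "c \<in> carrier G" and tf: "\<And>n. \<lbrakk>c [^] (n::int) = \<one>; n \<noteq> 0\<rbrakk> \<Longrightarrow> c = \<one>"
  shows "is_free_abelian_group (G\<lparr>carrier := generate G {c}\<rparr>)"
proof -
  let ?H = "G\<lparr>carrier := generate G {c}\<rparr>"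
  \<comment> \<open>The trivial group has the empty basis.\<close>
  define S where "S = (if c = \<one> then {} else {c})"
  let ?F = "free_Abelian_group S"
  have sub: "subgroup (generate G {c}) G" using c by (intro generate_is_subgroup) simp
  interpret H: group ?H by (rule subgroup.subgroup_is_group[OF sub is_group])
  interpret F: group ?F by simp
  define \<phi> where "\<phi> = (\<lambda>f :: 'a \<Rightarrow>\<^sub>0 int. c [^] Poly_Mapping.lookup f c)"
  interpret h: group_hom ?F ?H \<phi>
  proof (intro group_hom.intro group_hom_axioms.intro F.is_group H.is_group homI)
    show "\<phi> f \<in> carrier ?H" for f unfolding \<phi>_def using int_pow_of_generator[OF c] by auto
    show "\<phi> (f \<otimes>\<^bsub>?F\<^esub> g) = \<phi> f \<otimes>\<^bsub>?H\<^esub> \<phi> g" for f g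
      using c by (simp add: \<phi>_def lookup_add int_pow_mult)
  qed
  have "\<phi> \<in> iso ?F ?H"
    unfolding h.iso_iff
  proof (intro conjI ballI impI)
    show "carrier ?H \<subseteq> \<phi> ` carrier ?F"
    proof
      fix g assume "g \<in> carrier ?H"
      then obtain n :: int where g: "g = c [^] n" using int_pow_of_generator[OF c] by auto
      show "g \<in> \<phi> ` carrier ?F"
      proof (cases "c = \<one>")
        case True
        then have "\<phi> 0 = g" using g by (simp add: \<phi>_def)
        moreover have "0 \<in> carrier ?F" by simp
        ultimately show ?thesis by blast
      next
        case False
        have "\<phi> (frag_cmul n (frag_of c)) = g" by (simp add: \<phi>_def g)
        moreover have "frag_cmul n (frag_of c) \<in> carrier ?F"
          using False by (auto simp: S_def in_keys_iff split: if_splits)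
        ultimately show ?thesis by blast
      qed
    qed
    fix f assume f: "f \<in> carrier ?F" "\<phi> f = \<one>\<^bsub>?H\<^esub>"
    have "Poly_Mapping.lookup f z = 0" for z
    proof (cases "z \<in> S")
      case True
      then have "z = c" "c \<noteq> \<one>" by (auto simp: S_def split: if_splits)
      then show ?thesis using tf[of "Poly_Mapping.lookup f c"] f(2) by (auto simp: \<phi>_def)
    next
      case False
      then show ?thesis using f(1) by (auto simp: in_keys_iff)
    qed
    then show "f = \<one>\<^bsub>?F\<^esub>" by (simp add: poly_mapping_eqI)
  qed
  then have "?F \<cong> ?H" by (auto simp: is_iso_def)
  then have "?H \<cong> ?F" by (rule F.iso_sym)
  then show ?thesis unfolding is_free_abelian_group_def by blast
qed

end

section \<open>Commuting pairs acting on a tree\<close>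

context tree_action
begin

lemma disp_pow_le:
  assumes "g \<in> carrier G" "p \<in> X"
  shows "disp p (g [^] (n::int)) \<le> nat \<bar>n\<bar> * disp p g"
proof -
  have nat: "disp p (g [^] k) \<le> k * disp p g" for k :: nat
  proof (induction k)
    case (Suc k)
    have X: "act (g [^] k) p \<in> X" "act (g [^] Suc k) p \<in> X" using assms by (simp_all del: nat_pow_Suc)
    have "disp p (g [^] Suc k) \<le> disp p (g [^] k) + d (act (g [^] k) p) (act (g [^] Suc k) p)"
      using d_tri[OF assms(2) X] .
    moreover have "d (act (g [^] k) p) (act (g [^] Suc k) p) = disp p g"
      using assms by (simp add: act_mult)
    ultimately show ?case using Suc by simp
  qed (use assms in simp)
  show ?thesis
  proof (cases "n < 0")
    case True
    have "disp p (g [^] n) = disp p (g [^] nat (- n))"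
      using disp_inv[of "g [^] nat (- n)" p] assms True by (simp only: int_pow_def2 if_True nat_pow_closed)
    then show ?thesis using nat[of "nat (- n)"] True by simp
  next
    case False
    then have "disp p (g [^] n) = disp p (g [^] nat n)" by (simp only: int_pow_def2 if_False)
    then show ?thesis using nat[of "nat n"] False by simp
  qed
qed

text \<open>Points that \<open>a\<close> moves as little as \<open>p\<close> lie on the axis through \<open>p\<close>: by the four point
  condition such a point \<open>x\<close> lies between \<open>a\<^sup>-\<^sup>N p\<close> and \<open>a\<^sup>N p\<close> for large \<open>N\<close>.\<close>

lemma axis_fundamental_domain:
  assumes a: "a \<in> carrier G" and p: "p \<in> X" and x: "x \<in> X" and l: "1 \<le> l"
    and ap: "\<And>n::int. disp p (a [^] n) = nat \<bar>n\<bar> * l" and ax: "\<And>n::int. disp x (a [^] n) = nat \<bar>n\<bar> * l"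
  shows "\<exists>j::int. btw p (act (a [^] j) x) (act a p)"
proof -
  \<comment> \<open>Large enough for \<open>d p x \<le> N * l\<close>, so that the second term
    decides the maximum in the four point condition.\<close>
  define N where "N = d p x + 1"
  define P where "P = (\<lambda>i::int. act (a [^] i) p)"
  have PX: "P i \<in> X" for i using a p by (simp add: P_def)
  have shift: "act (a [^] k) (P i) = P (k + i)" for k i
    using a p by (simp add: P_def act_mult[symmetric] int_pow_mult)
  have dP: "d (P i) (P j) = nat \<bar>j - i\<bar> * l" for i j
  proof -
    have "d (P i) (P j) = d (act (a [^] i) p) (act (a [^] i) (P (j - i)))" by (simp add: shift) (simp add: P_def)
    also have "\<dots> = d p (P (j - i))" using a p PX by simp
    finally show ?thesis using ap by (simp add: P_def)
  qed
  define e where "e = P (int N)"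
  define q where "q = P (- int N)"
  have X: "e \<in> X" "q \<in> X" "act (a [^] int N) x \<in> X" using PX a x by (simp_all add: e_def q_def)
  have pe: "d p e = N * l" using ap[of "int N"] by (simp add: e_def P_def)
  have xe: "d x (act (a [^] int N) x) = N * l" using ax[of "int N"] by simp
  have ee: "d e (act (a [^] int N) x) = d p x" using a p x by (simp add: e_def P_def)
  have "d p (act (a [^] int N) x) = d (act (a [^] int N) q) (act (a [^] int N) x)"
    using p by (simp add: q_def shift) (simp add: P_def)
  also have "\<dots> = d q x" using a X x by simp
  finally have pq: "d p (act (a [^] int N) x) = d q x" .
  have "d p (act (a [^] int N) x) + d x e \<le> max (d p x + d (act (a [^] int N) x) e) (d p e + d (act (a [^] int N) x) x)"
    using four_point[OF p X(3) x X(1)] .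
  then have "d q x + d x e \<le> max (2 * d p x) (2 * (N * l))"
    using pq ee pe xe d_sym[OF X(1,3)] d_sym[OF x X(3)] by simp
  moreover have "d p x \<le> N * l"
  proof -
    have "N * 1 \<le> N * l" using l by (intro mult_le_mono2)
    then show ?thesis by (simp add: N_def)
  qed
  ultimately have le: "d q x + d x e \<le> 2 * (N * l)" by simp
  have qe: "d q e = 2 * N * l" using dP[of "- int N" "int N"] by (simp add: q_def e_def nat_mult_distrib)
  then have bx: "btw q x e" using le d_tri[OF X(2) x X(1)] by (simp add: btw_def)
  define t where "t = d q x"
  have t: "t \<le> 2 * N * l" using bx qe by (simp add: btw_def t_def)
  \<comment> \<open>The index of the period containing \<open>x\<close>; at the right end of the
    last period \<open>div\<close> would give an index one too large.\<close>
  define i where "i = (if t = 2 * N * l then 2 * N - 1 else t div l)"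
  have i: "i * l \<le> t" "t \<le> Suc i * l" "Suc i \<le> 2 * N"
  proof -
    have "Suc (2 * N - 1) = 2 * N" by (simp add: N_def)
    have "t div l < 2 * N" if "t < 2 * N * l" using that l by (simp add: less_mult_imp_div_less)
    then show "Suc i \<le> 2 * N" using t by (auto simp: i_def N_def)
    show "i * l \<le> t" by (auto simp: i_def)
    show "t \<le> Suc i * l"
    proof (cases "t = 2 * N * l")
      case True
      then have "Suc i = 2 * N" using \<open>Suc (2 * N - 1) = 2 * N\<close> by (simp add: i_def)
      then show ?thesis using True by simp
    next
      case False
      have "t div l * l + t mod l = t" by (rule div_mult_mod_eq)
      moreover have "t mod l < l" using l by simp
      ultimately have "t \<le> l + t div l * l" by linarith
      then show ?thesis using False by (simp add: i_def)
    qed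
  qed
  define r where "r = P (int i - int N)"
  define r' where "r' = P (int (Suc i) - int N)"
  have rX: "r \<in> X" "r' \<in> X" using PX by (simp_all add: r_def r'_def)
  have dr: "d q r = i * l" "d q r' = Suc i * l" "d r e = (2 * N - i) * l" "d r' e = (2 * N - Suc i) * l" "d r r' = l"
  proof -
    have "nat \<bar>(int i - int N) - (- int N)\<bar> = i" "nat \<bar>(int (Suc i) - int N) - (- int N)\<bar> = Suc i"
      "nat \<bar>int N - (int i - int N)\<bar> = 2 * N - i" "nat \<bar>int N - (int (Suc i) - int N)\<bar> = 2 * N - Suc i"
      "nat \<bar>(int (Suc i) - int N) - (int i - int N)\<bar> = 1"
      using i(3) by arith+
    then show "d q r = i * l" "d q r' = Suc i * l" "d r e = (2 * N - i) * l" "d r' e = (2 * N - Suc i) * l" "d r r' = l"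
      by (simp_all only: q_def e_def r_def r'_def dP mult_1)
  qed
  have br: "btw q r e" "btw q r' e"
  proof -
    have "i * l + (2 * N - i) * l = 2 * N * l" "Suc i * l + (2 * N - Suc i) * l = 2 * N * l"
      using i(3) by (simp_all only: add_mult_distrib[symmetric] le_add_diff_inverse Suc_leD)
    then show "btw q r e" "btw q r' e" using dr qe by (simp_all only: btw_def)
  qed
  have "btw q r x" "btw r x e" using btw_order[OF X(2,1) x rX(1) bx br(1)] dr i(1) by (simp_all add: t_def)
  moreover have "btw q x r'" using btw_order(1)[OF X(2,1) rX(2) x br(2) bx] dr i(2) by (simp add: t_def)
  ultimately have "btw r x r'" using btw_trans'(2)[OF X(2) rX(2) x rX(1)] by blast
  then have "btw (act (a [^] (int N - int i)) r) (act (a [^] (int N - int i)) x) (act (a [^] (int N - int i)) r')"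
    using a rX x by simp
  moreover have "act (a [^] (int N - int i)) r = p" "act (a [^] (int N - int i)) r' = act a p"
    using a p by (simp_all add: r_def r'_def shift) (simp_all add: P_def)
  ultimately show ?thesis by auto
qed

text \<open>The translates \<open>b\<^sup>k p\<close> lie on the axis of \<open>a\<close>, so two of them agree modulo \<open>a\<close>.\<close>

lemma commuting_elliptic_combination:
  assumes c: "a \<in> carrier G" "b \<in> carrier G" "a \<otimes> b = b \<otimes> a" and p: "p \<in> X" and l: "1 \<le> l"
    and ap: "\<And>n::int. disp p (a [^] n) = nat \<bar>n\<bar> * l"
  shows "\<exists>(x::int) (y::int). 0 < y \<and> act (a [^] x \<otimes> b [^] y) p = p"
proof -
  have "\<exists>j::int. btw p (act (a [^] j) (act (b [^] (k::int)) p)) (act a p)" for k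
  proof (rule axis_fundamental_domain[OF c(1) p _ l ap])
    show bX: "act (b [^] k) p \<in> X" using c p by simp
    show "disp (act (b [^] k) p) (a [^] n) = nat \<bar>n\<bar> * l" for n :: int
    proof -
      have "act (a [^] n) (act (b [^] k) p) = act (b [^] k) (act (a [^] n) p)"
        using commute_int_pow[OF c, of n k] act_mult[of "a [^] n" "b [^] k" p] act_mult[of "b [^] k" "a [^] n" p] c p by simp
      then show ?thesis using ap[of n] c p by simp
    qed
  qed
  then obtain j where j: "\<And>k. btw p (act (a [^] (j k :: int)) (act (b [^] (k::int)) p)) (act a p)" by metis
  define z where "z = (\<lambda>k::nat. act (a [^] j (int k)) (act (b [^] int k) p))"
  have z: "z k \<in> X" "btw p (z k) (act a p)" for k using c p j by (simp_all add: z_def)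
  have aX: "act a p \<in> X" using c p by simp
  have "d p (z k) \<le> disp p a" for k using z(2)[of k] by (simp add: btw_def)
  then have "(\<lambda>k. d p (z k)) ` {..Suc (disp p a)} \<subseteq> {..disp p a}" by auto
  then have "card ((\<lambda>k. d p (z k)) ` {..Suc (disp p a)}) \<le> Suc (disp p a)"
    using card_mono[of "{..disp p a}"] by fastforce
  then have "\<not> inj_on (\<lambda>k. d p (z k)) {..Suc (disp p a)}" by (intro pigeonhole) simp
  then obtain k1 k2 where k: "k1 < k2" "d p (z k1) = d p (z k2)" unfolding inj_on_def by (metis linorder_neqE_nat)
  have eq: "z k1 = z k2"
    by (rule btw_eqI[OF p aX aX z(1) z(1) z(2) z(2) k(2)])
      (use gromov_self[OF p aX] z(2)[of k1] in \<open>simp add: btw_def\<close>)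
  define x where "x = j (int k2) - j (int k1)"
  define y where "y = int k2 - int k1"
  have "a [^] j (int k2) \<otimes> b [^] int k2 = (a [^] j (int k1) \<otimes> b [^] int k1) \<otimes> (a [^] x \<otimes> b [^] y)"
    using commute_pow_mult[OF c, of "j (int k1)" "int k1" x y] by (simp add: x_def y_def)
  then have "act (a [^] j (int k1) \<otimes> b [^] int k1) (act (a [^] x \<otimes> b [^] y) p) = z k2"
    using act_mult[of "a [^] j (int k1) \<otimes> b [^] int k1" "a [^] x \<otimes> b [^] y" p]
      act_mult[of "a [^] j (int k2)" "b [^] int k2" p] c p by (simp add: z_def)
  also have "z k2 = act (a [^] j (int k1) \<otimes> b [^] int k1) p"
    using eq act_mult[of "a [^] j (int k1)" "b [^] int k1" p] c p by (simp add: z_def)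
  finally have "act (inv (a [^] j (int k1) \<otimes> b [^] int k1)) (act (a [^] j (int k1) \<otimes> b [^] int k1) (act (a [^] x \<otimes> b [^] y) p))
      = act (inv (a [^] j (int k1) \<otimes> b [^] int k1)) (act (a [^] j (int k1) \<otimes> b [^] int k1) p)" by simp
  then have "act (a [^] x \<otimes> b [^] y) p = p" using c p by simp
  then show ?thesis using k(1) by (intro exI[of _ x] exI[of _ y]) (simp add: y_def)
qed

end

section \<open>Two-generated subgroups\<close>

lemma (in tree_action) disp_mult_le:
  assumes "g \<in> carrier G" "h \<in> carrier G" "p \<in> X"
  shows "disp p (g \<otimes> h) \<le> disp p g + disp p h"
  using d_tri[of p "act g p" "act g (act h p)"] assms by (simp add: act_mult)

context artin
begin

lemma len_one: "len \<one> = 0"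
  using len_le[of "[]"] by (simp add: word_class_Nil)

lemma len_pow_le: "g \<in> carrier G \<Longrightarrow> len (g [^] (k::nat)) \<le> k * len g"
proof (induction k)
  case 0
  then show ?case by (simp add: len_one)
next
  case (Suc k)
  then show ?case using len_mult_le[of "g [^] k" g] by simp
qed

lemma cyclic_growth:
  assumes "c \<in> carrier G"
  shows "\<exists>K. \<forall>n::int. c \<noteq> \<one> \<longrightarrow> nat \<bar>n\<bar> \<le> K * (len (c [^] n) + 1)"
proof (cases "c = \<one>")
  case False
  then obtain u where u: "u \<in> V" "\<not> elliptic u c" using elliptic_all_imp_one[OF assms] by blast
  interpret Tu: artin_vertex G V E u by (rule vertex[OF u(1)])
  have "\<And>x. x \<in> Tu.X \<Longrightarrow> Tu.act c x \<noteq> x" using Tu.elliptic_iff[OF assms] u(2) by blast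
  from Tu.T.bounded_disp_pow[OF assms Tu.Nil_X this] obtain C
    where C: "\<And>n::int. nat \<bar>n\<bar> \<le> Tu.T.disp [] (c [^] n) + C" by blast
  have "nat \<bar>n\<bar> \<le> (C + 1) * (len (c [^] n) + 1)" for n :: int
  proof -
    have "nat \<bar>n\<bar> \<le> len (c [^] n) + C" using C[of n] Tu.disp_le_len[of "c [^] n" "[]"] assms by simp
    then show ?thesis by (simp add: algebra_simps)
  qed
  then show ?thesis by blast
qed simp

text \<open>If \<open>a\<close> is hyperbolic in the tree of \<open>u\<close>, a combination
  \<open>e\<close> of the pair fixes a point on its axis, so the displacement of
  \<open>a^m e^n\<close> there depends on \<open>m\<close> alone. A second tree, in which
  \<open>e\<close> is hyperbolic, bounds \<open>n\<close> in terms of the length and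
  \<open>m\<close>. As \<open>a\<close> and \<open>e\<close> may generate a proper subgroup, the
  estimates are applied to the \<open>y\<close>-th power of an element.\<close>

lemma abelian_pair_growth:
  assumes c: "a \<in> carrier G" "b \<in> carrier G" "a \<otimes> b = b \<otimes> a"
    and ind: "\<And>m n. a [^] (m::int) \<otimes> b [^] (n::int) = \<one> \<Longrightarrow> m = 0 \<and> n = 0"
  shows "\<exists>K. \<forall>(m::int) (n::int). nat \<bar>m\<bar> + nat \<bar>n\<bar> \<le> K * (len (a [^] m \<otimes> b [^] n) + 1)"
proof -
  have "a \<noteq> \<one>" using ind[of 1 0] c by auto
  then obtain u where u: "u \<in> V" "\<not> elliptic u a" using elliptic_all_imp_one[OF c(1)] by blast
  interpret Tu: artin_vertex G V E u by (rule vertex[OF u(1)])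
  obtain p where p: "p \<in> Tu.X" "\<And>n::int. Tu.T.disp p (a [^] n) = nat \<bar>n\<bar> * Tu.T.disp p a"
    by (rule Tu.T.obtain_axis[OF c(1)]) (rule that)
  have la: "1 \<le> Tu.T.disp p a"
    using Tu.T.d_eq_0[OF p(1), of "Tu.act a p"] Tu.elliptic_iff[OF c(1)] u(2) p(1) c(1)
    by (metis One_nat_def Suc_leI Tu.T.act_closed neq0_conv)
  obtain x y :: int where xy: "0 < y" "Tu.act (a [^] x \<otimes> b [^] y) p = p"
    using Tu.T.commuting_elliptic_combination[OF c p(1) la p(2)] by blast
  define e where "e = a [^] x \<otimes> b [^] y"
  have e: "e \<in> carrier G" "e \<noteq> \<one>" using c ind[of x y] xy(1) by (auto simp: e_def)
  have ep: "e [^] j = a [^] (x * j) \<otimes> b [^] (y * j)" for j :: int using commute_pow_pow[OF c] by (simp add: e_def)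
  obtain w where w: "w \<in> V" "\<not> elliptic w e" using elliptic_all_imp_one[OF e(1)] e(2) by blast
  interpret Tw: artin_vertex G V E w by (rule vertex[OF w(1)])
  obtain q where q: "q \<in> Tw.X" "\<And>n::int. Tw.T.disp q (e [^] n) = nat \<bar>n\<bar> * Tw.T.disp q e"
    by (rule Tw.T.obtain_axis[OF e(1)]) (rule that)
  have le: "1 \<le> Tw.T.disp q e"
    using Tw.T.d_eq_0[OF q(1), of "Tw.act e q"] Tw.elliptic_iff[OF e(1)] w(2) q(1) e(1)
    by (metis One_nat_def Suc_leI Tw.T.act_closed neq0_conv)
  define A1 where "A1 = 2 * length p"
  define A2 where "A2 = 2 * length q"
  define D where "D = Tw.T.disp q a"
  have m_le: "nat \<bar>m\<bar> \<le> len (a [^] m \<otimes> e [^] n) + A1" for m n :: int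
  proof -
    have "Tu.act (e [^] n) p = p" using Tu.T.act_int_pow_fixed[OF e(1) p(1)] xy(2) by (simp add: e_def)
    then have "Tu.T.disp p (a [^] m \<otimes> e [^] n) = nat \<bar>m\<bar> * Tu.T.disp p a"
      using Tu.T.act_mult[of "a [^] m" "e [^] n" p] c e p by simp
    moreover have "nat \<bar>m\<bar> * 1 \<le> nat \<bar>m\<bar> * Tu.T.disp p a" using la by (rule mult_le_mono2)
    moreover have "Tu.T.disp p (a [^] m \<otimes> e [^] n) \<le> len (a [^] m \<otimes> e [^] n) + 2 * length p"
      by (rule Tu.disp_le_len) (use c e p in simp_all)
    ultimately show ?thesis unfolding A1_def by linarith
  qed
  have n_le: "nat \<bar>n\<bar> \<le> len (a [^] m \<otimes> e [^] n) + A2 + nat \<bar>m\<bar> * D" for m n :: int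
  proof -
    have "e [^] n = a [^] (- m) \<otimes> (a [^] m \<otimes> e [^] n)"
      using c e m_assoc[of "a [^] (- m)" "a [^] m" "e [^] n"] by (simp add: int_pow_neg)
    then have "Tw.T.disp q (e [^] n) \<le> Tw.T.disp q (a [^] (- m)) + Tw.T.disp q (a [^] m \<otimes> e [^] n)"
      using Tw.T.disp_mult_le[of "a [^] (- m)" "a [^] m \<otimes> e [^] n" q] c e q(1) by simp
    moreover have "Tw.T.disp q (a [^] (- m)) \<le> nat \<bar>- m\<bar> * D"
      unfolding D_def by (rule Tw.T.disp_pow_le[OF c(1) q(1)])
    moreover have "nat \<bar>n\<bar> * 1 \<le> nat \<bar>n\<bar> * Tw.T.disp q e" using le by (rule mult_le_mono2)
    moreover have "Tw.T.disp q (a [^] m \<otimes> e [^] n) \<le> len (a [^] m \<otimes> e [^] n) + 2 * length q"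
      by (rule Tw.disp_le_len) (use c e q in simp_all)
    ultimately show ?thesis using q(2)[of n] unfolding A2_def abs_minus_cancel mult_1_right by linarith
  qed
  define Y where "Y = nat y"
  define B where "B = Y + A1"
  define J where "J = Y + A2 + B * D"
  define Z where "Z = nat \<bar>x\<bar>"
  have "nat \<bar>i\<bar> + nat \<bar>j\<bar> \<le> (B + Z * J + J) * (len (a [^] i \<otimes> b [^] j) + 1)" for i j :: int
  proof -
    define g where "g = a [^] i \<otimes> b [^] j"
    define L where "L = len g"
    \<comment> \<open>Solves \<open>(a^i b^j)^y = a^m e^j\<close>.\<close>
    define m where "m = i * y - x * j"
    have g: "g \<in> carrier G" using c by (simp add: g_def)
    have "a [^] m \<otimes> e [^] j = (a [^] m \<otimes> b [^] (0::int)) \<otimes> (a [^] (x * j) \<otimes> b [^] (y * j))" using c by (simp add: ep)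
    also have "\<dots> = a [^] (i * y) \<otimes> b [^] (j * y)"
      using commute_pow_mult[OF c, of m 0 "x * j" "y * j"] by (simp add: m_def mult.commute)
    also have "\<dots> = g [^] y" using commute_pow_pow[OF c, of i j y] by (simp add: g_def)
    also have "\<dots> = g [^] Y" using xy(1) by (simp add: Y_def)
    finally have ga: "a [^] m \<otimes> e [^] j = g [^] Y" .
    have len: "len (g [^] Y) \<le> Y * L" using len_pow_le[OF g] by (simp add: L_def)
    have "nat \<bar>m\<bar> \<le> Y * L + A1" using m_le[of m j] len unfolding ga by simp
    also have "\<dots> \<le> B * (L + 1)" by (simp add: B_def algebra_simps)
    finally have m: "nat \<bar>m\<bar> \<le> B * (L + 1)" .
    have "nat \<bar>j\<bar> \<le> Y * L + A2 + nat \<bar>m\<bar> * D" using n_le[of j m] len unfolding ga by simp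
    also have "\<dots> \<le> Y * L + A2 + B * (L + 1) * D" using m by (simp add: mult_le_mono1)
    also have "\<dots> \<le> J * (L + 1)" by (simp add: J_def algebra_simps)
    finally have j: "nat \<bar>j\<bar> \<le> J * (L + 1)" .
    have "\<bar>i\<bar> * 1 \<le> \<bar>i\<bar> * y" using xy(1) by (intro mult_left_mono) auto
    also have "\<bar>i\<bar> * y = \<bar>m + x * j\<bar>" using xy(1) by (simp add: m_def abs_mult)
    also have "\<dots> \<le> \<bar>m\<bar> + \<bar>x\<bar> * \<bar>j\<bar>" using abs_triangle_ineq[of m "x * j"] by (simp add: abs_mult)
    finally have "nat \<bar>i\<bar> \<le> nat (\<bar>m\<bar> + \<bar>x\<bar> * \<bar>j\<bar>)" by (intro nat_mono) simp
    also have "\<dots> = nat \<bar>m\<bar> + Z * nat \<bar>j\<bar>" by (simp add: Z_def nat_add_distrib nat_mult_distrib)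
    also have "\<dots> \<le> B * (L + 1) + Z * (J * (L + 1))" using m j by (intro add_mono mult_le_mono2)
    finally have "nat \<bar>i\<bar> + nat \<bar>j\<bar> \<le> B * (L + 1) + Z * (J * (L + 1)) + J * (L + 1)" using j by linarith
    also have "\<dots> = (B + Z * J + J) * (L + 1)" by (simp add: algebra_simps)
    finally show ?thesis by (simp add: L_def g_def)
  qed
  then show ?thesis by blast
qed

lemma two_generated_subgroup:
  assumes ab0: "a0 \<in> carrier G" "b0 \<in> carrier G"
  defines "H \<equiv> generate G {a0, b0}"
  shows "(is_free_group (G\<lparr>carrier := H\<rparr>) \<or> is_free_abelian_group (G\<lparr>carrier := H\<rparr>)) \<and>
    (\<exists>S0 C. finite_generating_set (G\<lparr>carrier := H\<rparr>) S0 \<and>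
      (\<forall>h\<in>H. word_length (G\<lparr>carrier := H\<rparr>) S0 h \<le> C * (len h + 1)))"
proof -
  have H: "subgroup H G" unfolding H_def using ab0 by (intro generate_is_subgroup) simp
  let ?H = "G\<lparr>carrier := H\<rparr>"
  interpret H: group ?H by (rule subgroup.subgroup_is_group[OF H is_group])
  have gen: "finite_generating_set ?H S" if "finite S" "S \<subseteq> carrier G" "generate G S = H" for S
  proof -
    have "S \<subseteq> H" using generate.incl[of _ S G] that(3) by blast
    then show ?thesis using generate_consistent[OF _ H] that by (simp add: finite_generating_set_def)
  qed
  show ?thesis
  proof (cases "a0 \<otimes> b0 = b0 \<otimes> a0")
    case False
    obtain a b where N: "nielsen a0 b0 a b" and ub: "undistorted_basis a b"
      using nielsen_undistorted_basis[OF ab0 False] by blast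
    have ab: "a \<in> carrier G" "b \<in> carrier G" using nielsen_closed[OF N ab0] .
    have HG: "H = generate G {a, b}" using nielsen_generate[OF N ab0] by (simp add: H_def)
    have S: "finite_generating_set ?H {a, b}" by (rule gen) (use ab HG in simp_all)
    have free: "syllable_prod a b s \<noteq> \<one>" if "alternating s" "s \<noteq> []" for s using ub that unfolding undistorted_basis_def by blast
    obtain K where K: "\<And>s. alternating s \<Longrightarrow> exponent_length s \<le> K * (len (syllable_prod a b s) + 1)"
      using ub unfolding undistorted_basis_def by blast
    have abH: "a \<in> H" "b \<in> H" unfolding HG by (auto intro: generate.incl)
    have "word_length ?H {a, b} h \<le> K * (len h + 1)" if h: "h \<in> H" for h
    proof -
      obtain s where s: "alternating s" "h = syllable_prod a b s" using generate_syllable_prod[OF ab] h HG by blast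
      have "word_length ?H {a, b} (H.syllable_prod a b s) \<le> exponent_length s"
        by (rule H.word_length_syllable_prod_le) (use S in \<open>simp_all add: finite_generating_set_def\<close>)
      then show ?thesis using K[OF s(1)] s(2) subgroup_syllable_prod[OF H abH] by simp
    qed
    then show ?thesis using S free_group_generate[OF ab free] unfolding HG[symmetric] by blast
  next
    case comm: True
    show ?thesis
    proof (cases "\<forall>m n. a0 [^] (m::int) \<otimes> b0 [^] (n::int) = \<one> \<longrightarrow> m = 0 \<and> n = 0")
      case True
      then have ind: "\<And>m n. a0 [^] (m::int) \<otimes> b0 [^] (n::int) = \<one> \<Longrightarrow> m = 0 \<and> n = 0" by blast
      obtain K where K: "\<And>m n :: int. nat \<bar>m\<bar> + nat \<bar>n\<bar> \<le> K * (len (a0 [^] m \<otimes> b0 [^] n) + 1)"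
        using abelian_pair_growth[OF ab0 comm ind] by blast
      have S: "finite_generating_set ?H {a0, b0}" by (rule gen) (use ab0 in \<open>simp_all add: H_def\<close>)
      have abH: "a0 \<in> H" "b0 \<in> H" unfolding H_def by (auto intro: generate.incl)
      have "word_length ?H {a0, b0} h \<le> K * (len h + 1)" if h: "h \<in> H" for h
      proof -
        obtain m n :: int where mn: "h = a0 [^] m \<otimes> b0 [^] n"
          using generate_commuting_pair[OF ab0 comm] h unfolding H_def by blast
        have "word_length ?H {a0, b0} (H.syllable_prod a0 b0 [(True, m), (False, n)]) \<le> exponent_length [(True, m), (False, n)]"
          by (rule H.word_length_syllable_prod_le) (use S in \<open>simp_all add: finite_generating_set_def\<close>)
        moreover have "H.syllable_prod a0 b0 [(True, m), (False, n)] = h"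
          unfolding subgroup_syllable_prod[OF H abH] using ab0 by (simp add: mn)
        ultimately show ?thesis using K[of m n] mn by simp
      qed
      then show ?thesis using S free_Abelian_pair[OF ab0 comm ind] unfolding H_def[symmetric] by blast
    next
      case False
      then obtain m n :: int where dep: "a0 [^] m \<otimes> b0 [^] n = \<one>" "m \<noteq> 0 \<or> n \<noteq> 0" by blast
      have "\<exists>c\<in>carrier G. generate G {a0, b0} = generate G {c}"
        by (rule dependent_pair_cyclic[OF ab0 comm _ dep]) (rule torsion_free)
      then obtain c where c: "c \<in> carrier G" "H = generate G {c}" unfolding H_def by blast
      have S: "finite_generating_set ?H {c}" by (rule gen) (use c in simp_all)
      have cH: "c \<in> H" unfolding c(2) by (auto intro: generate.incl)
      obtain K where K: "\<And>n::int. c \<noteq> \<one> \<Longrightarrow> nat \<bar>n\<bar> \<le> K * (len (c [^] n) + 1)"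
        using cyclic_growth[OF c(1)] by blast
      have S': "{c} \<subseteq> carrier ?H" "generate ?H {c} = carrier ?H" using S by (simp_all add: finite_generating_set_def)
      have "word_length ?H {c} h \<le> K * (len h + 1)" if h: "h \<in> H" for h
      proof -
        obtain n :: int where n: "h = c [^] n" using int_pow_of_generator[OF c(1)] h c(2) by auto
        show ?thesis
        proof (cases "c = \<one>")
          case True
          then have "h = \<one>\<^bsub>?H\<^esub>" using n by simp
          then have "word_length ?H {c} h = 0" using H.word_length_eq_0_iff[OF S', of h] H.one_closed by simp
          then show ?thesis by simp
        next
          case False
          have "c [^]\<^bsub>?H\<^esub> n = h" using int_pow_consistent[OF H cH] n by simp
          then have "word_length ?H {c} h \<le> nat \<bar>n\<bar>" using H.word_length_int_pow_le[OF S', of c n] by simp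
          then show ?thesis using K[OF False, of n] n by simp
        qed
      qed
      moreover have "is_free_abelian_group ?H"
        unfolding c(2) by (rule free_Abelian_cyclic[OF c(1)]) (rule torsion_free[OF c(1)])
      ultimately show ?thesis using S by blast
    qed
  qed
qed

end

lemma artin_raag:
  assumes "graph \<Gamma>"
  shows "artin (raag \<Gamma>) (verts \<Gamma>) (\<lambda>u v. u \<rightarrow>\<^bsub>\<Gamma>\<^esub> v)"
proof -
  interpret graph \<Gamma> by fact
  show ?thesis
  proof (intro artin.intro artin_axioms.intro group_raag)
    show "raag \<Gamma> = presented_group (verts \<Gamma>) (commutations (\<lambda>u v. u \<rightarrow>\<^bsub>\<Gamma>\<^esub> v))"
      by (simp add: raag_def commutations_def)
    show "v \<rightarrow>\<^bsub>\<Gamma>\<^esub> u" if "u \<rightarrow>\<^bsub>\<Gamma>\<^esub> v" for u v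
      using that sym_arcs by (auto simp: symmetric_def dest: symD)
    show "\<not> v \<rightarrow>\<^bsub>\<Gamma>\<^esub> v" for v using adj_not_same by blast
  qed simp
qed

theorem corollary1p5:
  fixes \<Gamma> :: "('v, 'e) pre_digraph"
    and H :: "'v gword set set"
  assumes "graph \<Gamma>"
    and "subgroup H (raag \<Gamma>)"
    and "\<exists>a \<in> carrier (raag \<Gamma>). \<exists>b \<in> carrier (raag \<Gamma>). H = generate (raag \<Gamma>) {a, b}"
  shows "(is_free_group (raag \<Gamma>\<lparr>carrier := H\<rparr>) \<or> is_free_abelian_group (raag \<Gamma>\<lparr>carrier := H\<rparr>)) \<and>
    (\<forall>S T. finite_generating_set (raag \<Gamma>\<lparr>carrier := H\<rparr>) S \<longrightarrow>
       finite_generating_set (raag \<Gamma>) T \<longrightarrow>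
       quasi_isometric_embedding
         (word_metric (raag \<Gamma>\<lparr>carrier := H\<rparr>) S) (word_metric (raag \<Gamma>) T) (\<lambda>h. h))"
proof -
  interpret artin "raag \<Gamma>" "verts \<Gamma>" "\<lambda>u v. u \<rightarrow>\<^bsub>\<Gamma>\<^esub> v" by (rule artin_raag[OF assms(1)])
  obtain a b where ab: "a \<in> carrier (raag \<Gamma>)" "b \<in> carrier (raag \<Gamma>)" "H = generate (raag \<Gamma>) {a, b}"
    using assms(3) by blast
  have 1: "is_free_group (raag \<Gamma>\<lparr>carrier := H\<rparr>) \<or> is_free_abelian_group (raag \<Gamma>\<lparr>carrier := H\<rparr>)"
    using two_generated_subgroup[OF ab(1,2)] unfolding ab(3) by blast
  obtain S0 C where "finite_generating_set (raag \<Gamma>\<lparr>carrier := H\<rparr>) S0"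
    "\<And>h. h \<in> H \<Longrightarrow> word_length (raag \<Gamma>\<lparr>carrier := H\<rparr>) S0 h \<le> C * (len h + 1)"
    using two_generated_subgroup[OF ab(1,2)] unfolding ab(3)[symmetric] by blast
  then have "quasi_isometric_embedding (word_metric (raag \<Gamma>\<lparr>carrier := H\<rparr>) S) (word_metric (raag \<Gamma>) T) (\<lambda>h. h)"
    if "finite_generating_set (raag \<Gamma>\<lparr>carrier := H\<rparr>) S" "finite_generating_set (raag \<Gamma>) T" for S T
    using quasi_isometric_subgroup[OF assms(2) _ len_one len_mult_le _ that] by blast
  with 1 show ?thesis by blast
qed

end
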